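(* For each $N\ge1$ let $Q_N=(q_1,\dots,q_N),P_N=(p_1,\dots,p_N)\in(\mathbb{R}^2)^N$ with $q_i\neq q_j$ for $i\neq j$, and let $\omega,\omega_N,\rho\in L^1\cap L^\infty(\mathbb{R}^2,\mathbb{R})$ be probability densities with compact supports and $v\in W^{2,\infty}(\mathbb{R}^2,\mathbb{R}^2)$. Assume that $\sup_{N\in\mathbb{N}}\|\omega_N\|_{L^\infty}<+\infty$. Then there exist positive constants $C$ and $\beta$ (independent of $N$) such that $$\left\|\frac1N\sum_{i=1}^N\delta_{(q_i,p_i)}-\rho\otimes\delta_{\xi=v(x)}\right\|_{H^{-5}}\leq C\big(1+\|\nabla v\|_{W^{1,\infty}}^2\big)\Big(\mathcal{H}(\omega,\rho,v,\omega_N,Q_N,P_N)^{\frac12}+(1+\|\rho\|_{L^\infty})N^{-\beta}\Big)^{\frac12}.$$ In particular, if $\mathcal{H}(\omega,\rho,v,\omega_N,Q_N,P_N)\to0$ as $N\to\infty$, then for any $a<-1$, as $N\to+\infty$, $$\rho_N\to\rho\ \text{ in } H^a,\qquad \omega_N-\omega\to0\ \text{ in } L^2\cap\dot H^{-1},\qquad \frac1N\sum_{i=1}^N\delta_{(q_i,p_i)}\to\rho\otimes\delta_{\xi=v(x)}\ \text{ in } H^{-5}.$$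
   Context: $g(x):=-\frac{1}{2\pi}\ln|x|$ on $\mathbb{R}^2$; $\Delta:=\{(x,x):x\in\mathbb{R}^2\}$; $\nu^{\otimes2}:=\nu\otimes\nu$; $\rho_N:=\frac1N\sum_{i=1}^N\delta_{q_i}$. $\rho\otimes\delta_{\xi=v(x)}$ is the measure on $\mathbb{R}^2\times\mathbb{R}^2$ acting by $\phi\mapsto\int\phi(x,v(x))\rho(x)\,\mathrm{d}x$. The $H^{-5}$ norm is that of $H^{-5}(\mathbb{R}^2\times\mathbb{R}^2)$. The functional $\mathcal{H}$ is $$\begin{aligned}\mathcal{H}(\omega,\rho,v,\omega_N,Q_N,P_N):=&\ \frac1N\sum_{i=1}^N|v(q_i)-p_i|^2+\iint_{(\mathbb{R}^2\times\mathbb{R}^2)\setminus\Delta}g(x-y)(\rho+\omega-\rho_N-\omega_N)^{\otimes2}(\mathrm{d}x\,\mathrm{d}y)\\&+\iint_{\mathbb{R}^2\times\mathbb{R}^2}g(x-y)(\omega-\omega_N)(x)(\omega-\omega_N)(y)\,\mathrm{d}x\,\mathrm{d}y+\|\omega-\omega_N\|_{L^2}^2+BN^{-\gamma},\end{aligned}$$ where $\gamma\in(0,1)$ is fixed and $B$ is a constant independent of $N$ such that the second term plus $BN^{-\gamma}$ is nonnegative for all $N$ (such a $B$ exists, depending only on $\gamma$, $\|\omega\|_{L^1\cap L^\infty}$, $\|\rho\|_{L^1\cap L^\infty}$, $\sup_N\|\omega_N\|_{L^1\cap L^\infty}$); in particular $\mathcal{H}\ge0$. *)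

theory Defs
  imports "HOL-Analysis.Analysis" "HOL-Probability.Essential_Supremum"
begin

section \<open>Lebesgue and Sobolev spaces\<close>

definition Linf_norm :: "('a::euclidean_space \<Rightarrow> 'b::real_normed_vector) \<Rightarrow> ereal" where
  "Linf_norm f = esssup lborel (\<lambda>x. ereal (norm (f x)))"

definition in_Linf :: "('a::euclidean_space \<Rightarrow> 'b::real_normed_vector) \<Rightarrow> bool" where
  "in_Linf f \<longleftrightarrow> f \<in> borel_measurable borel \<and> Linf_norm f < \<infinity>"

definition ennsqrt :: "ennreal \<Rightarrow> ennreal" where
  "ennsqrt x = (if x = \<infinity> then \<infinity> else ennreal (sqrt (enn2real x)))"

definition L2_norm :: "('a::euclidean_space \<Rightarrow> real) \<Rightarrow> ennreal" where
  "L2_norm f = ennsqrt (\<integral>\<^sup>+x. ennreal ((f x)\<^sup>2) \<partial>lborel)"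

text \<open>The essential support: the complement of the largest open set on which the function
  vanishes almost everywhere.\<close>

definition ess_support :: "('a::euclidean_space \<Rightarrow> 'b::zero) \<Rightarrow> 'a set" where
  "ess_support f = - \<Union>{U. open U \<and> (AE x in lborel. x \<in> U \<longrightarrow> f x = 0)}"

definition prob_density :: "('a::euclidean_space \<Rightarrow> real) \<Rightarrow> bool" where
  "prob_density f \<longleftrightarrow>
     integrable lborel f \<and> (AE x in lborel. 0 \<le> f x) \<and> (\<integral>x. f x \<partial>lborel) = 1"

definition partial_deriv ::
    "'a::euclidean_space \<Rightarrow> ('a \<Rightarrow> real) \<Rightarrow> 'a \<Rightarrow> real" where
  "partial_deriv b \<phi> x = frechet_derivative \<phi> (at x) b"

fun cont_diff :: "nat \<Rightarrow> ('a::euclidean_space \<Rightarrow> real) \<Rightarrow> bool" where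
  "cont_diff 0 \<phi> \<longleftrightarrow> continuous_on UNIV \<phi>"
| "cont_diff (Suc k) \<phi> \<longleftrightarrow>
     (\<forall>x. \<phi> differentiable (at x)) \<and> (\<forall>b\<in>Basis. cont_diff k (partial_deriv b \<phi>))"

definition test_function :: "('a::euclidean_space \<Rightarrow> real) \<Rightarrow> bool" where
  "test_function \<phi> \<longleftrightarrow> (\<forall>k. cont_diff k \<phi>) \<and> compact (closure {x. \<phi> x \<noteq> 0})"

definition locally_integrable ::
    "('a::euclidean_space \<Rightarrow> 'b::euclidean_space) \<Rightarrow> bool" where
  "locally_integrable f \<longleftrightarrow>
     f \<in> borel_measurable borel \<and> (\<forall>K. compact K \<longrightarrow> set_integrable lborel K f)"

definition is_weak_partial ::
    "'a::euclidean_space \<Rightarrow> ('a \<Rightarrow> 'b::euclidean_space) \<Rightarrow> ('a \<Rightarrow> 'b) \<Rightarrow> bool" where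
  "is_weak_partial b f h \<longleftrightarrow> locally_integrable f \<and> locally_integrable h \<and>
     (\<forall>\<phi>. test_function \<phi> \<longrightarrow>
        (\<integral>x. partial_deriv b \<phi> x *\<^sub>R f x \<partial>lborel) = - (\<integral>x. \<phi> x *\<^sub>R h x \<partial>lborel))"

text \<open>A choice of representative; weak derivatives are unique up to null sets, so the norms below
  do not depend on it.\<close>

definition weak_partial ::
    "'a::euclidean_space \<Rightarrow> ('a \<Rightarrow> 'b::euclidean_space) \<Rightarrow> 'a \<Rightarrow> 'b" where
  "weak_partial b f = (SOME h. is_weak_partial b f h)"

fun in_Winf :: "nat \<Rightarrow> ('a::euclidean_space \<Rightarrow> 'b::euclidean_space) \<Rightarrow> bool" where
  "in_Winf 0 f \<longleftrightarrow> in_Linf f"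
| "in_Winf (Suc k) f \<longleftrightarrow>
     in_Linf f \<and> (\<forall>b\<in>Basis. \<exists>h. is_weak_partial b f h \<and> in_Winf k h)"

fun Winf_norm :: "nat \<Rightarrow> ('a::euclidean_space \<Rightarrow> 'b::euclidean_space) \<Rightarrow> ereal" where
  "Winf_norm 0 f = Linf_norm f"
| "Winf_norm (Suc k) f = Linf_norm f + (\<Sum>b\<in>Basis. Winf_norm k (weak_partial b f))"

definition grad_Winf_norm ::
    "nat \<Rightarrow> ('a::euclidean_space \<Rightarrow> 'b::euclidean_space) \<Rightarrow> ereal" where
  "grad_Winf_norm k f = (\<Sum>b\<in>Basis. Winf_norm k (weak_partial b f))"

section \<open>Finite signed measures and their Sobolev norms\<close>

text \<open>The list \<open>[(a\<^sub>1, \<mu>\<^sub>1), \<dots>, (a\<^sub>n, \<mu>\<^sub>n)]\<close> of real coefficients and finite positive Borel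
  measures stands for the signed measure \<open>a\<^sub>1 \<mu>\<^sub>1 + \<dots> + a\<^sub>n \<mu>\<^sub>n\<close>.\<close>

type_synonym 'a signed_measure = "(real \<times> 'a measure) list"

definition fourier :: "'a::euclidean_space signed_measure \<Rightarrow> 'a \<Rightarrow> complex" where
  "fourier \<sigma> \<xi> = (\<Sum>(a, \<mu>)\<leftarrow>\<sigma>. complex_of_real a * (\<integral>x. cis (- (x \<bullet> \<xi>)) \<partial>\<mu>))"

text \<open>With this normalisation of the Fourier transform, the factor \<open>(2\<pi>)\<^sup>-\<^sup>d\<close> makes \<open>s = 0\<close> the
  \<open>L\<^sup>2\<close> norm.\<close>

definition Sobolev_norm :: "real \<Rightarrow> 'a::euclidean_space signed_measure \<Rightarrow> ennreal" where
  "Sobolev_norm s \<sigma> = ennsqrt (\<integral>\<^sup>+\<xi>.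
     ennreal ((1 + (norm \<xi>)\<^sup>2) powr s * (cmod (fourier \<sigma> \<xi>))\<^sup>2 / (2 * pi) ^ DIM('a)) \<partial>lborel)"

definition homogeneous_Sobolev_norm ::
    "real \<Rightarrow> 'a::euclidean_space signed_measure \<Rightarrow> ennreal" where
  "homogeneous_Sobolev_norm s \<sigma> = ennsqrt (\<integral>\<^sup>+\<xi>.
     ennreal (norm \<xi> powr (2 * s) * (cmod (fourier \<sigma> \<xi>))\<^sup>2 / (2 * pi) ^ DIM('a)) \<partial>lborel)"

definition ac_measure :: "('a::euclidean_space \<Rightarrow> real) \<Rightarrow> 'a measure" where
  "ac_measure f = density lborel (\<lambda>x. ennreal (f x))"

definition empirical_measure :: "nat \<Rightarrow> (nat \<Rightarrow> 'a::euclidean_space) \<Rightarrow> 'a measure" where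
  "empirical_measure N z = distr (uniform_count_measure {1..N}) borel z"

text \<open>The monokinetic measure \<open>\<rho> \<otimes> \<delta>\<^bsub>\<xi>=v(x)\<^esub>\<close>.\<close>

definition monokinetic ::
    "('a::euclidean_space \<Rightarrow> real) \<Rightarrow> ('a \<Rightarrow> 'a) \<Rightarrow> ('a \<times> 'a) measure" where
  "monokinetic \<rho> v = distr (ac_measure \<rho>) borel (\<lambda>x. (x, v x))"

section \<open>The modulated energy\<close>

text \<open>The value at the origin is irrelevant: the diagonal is either excluded or negligible.\<close>

definition log_kernel :: "real^2 \<Rightarrow> real" where
  "log_kernel x = - (1 / (2 * pi)) * ln (norm x)"

definition diagonal :: "((real^2) \<times> (real^2)) set" where
  "diagonal = {(x, x) | x. True}"

text \<open>The integral of \<open>g(x - y)\<close> against \<open>\<sigma> \<otimes> \<sigma>\<close> off the diagonal, where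
  \<open>\<sigma> \<otimes> \<sigma> = \<Sum>\<^sub>i\<^sub>j a\<^sub>i a\<^sub>j \<mu>\<^sub>i \<otimes> \<mu>\<^sub>j\<close> for \<open>\<sigma> = \<Sum>\<^sub>i a\<^sub>i \<mu>\<^sub>i\<close>.\<close>

definition offdiag_energy :: "(real^2) signed_measure \<Rightarrow> real" where
  "offdiag_energy \<sigma> = (\<Sum>(a, \<mu>)\<leftarrow>\<sigma>. \<Sum>(b, \<nu>)\<leftarrow>\<sigma>.
     a * b * (LINT z:- diagonal|\<mu> \<Otimes>\<^sub>M \<nu>. log_kernel (fst z - snd z)))"

definition interaction_energy ::
    "nat \<Rightarrow> (real^2 \<Rightarrow> real) \<Rightarrow> (real^2 \<Rightarrow> real) \<Rightarrow> (real^2 \<Rightarrow> real) \<Rightarrow> (nat \<Rightarrow> real^2) \<Rightarrow> real" where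
  "interaction_energy N \<omega> \<rho> \<omega>N q = offdiag_energy
     [(1, ac_measure \<rho>), (1, ac_measure \<omega>), (-1, empirical_measure N q), (-1, ac_measure \<omega>N)]"

definition modulated_energy ::
    "real \<Rightarrow> real \<Rightarrow> nat \<Rightarrow> (real^2 \<Rightarrow> real) \<Rightarrow> (real^2 \<Rightarrow> real) \<Rightarrow> (real^2 \<Rightarrow> real^2) \<Rightarrow>
     (real^2 \<Rightarrow> real) \<Rightarrow> (nat \<Rightarrow> real^2) \<Rightarrow> (nat \<Rightarrow> real^2) \<Rightarrow> real" where
  "modulated_energy B \<gamma> N \<omega> \<rho> v \<omega>N q p =
     (1 / real N) * (\<Sum>i=1..N. (norm (v (q i) - p i))\<^sup>2)
     + interaction_energy N \<omega> \<rho> \<omega>N q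
     + (\<integral>z. log_kernel (fst z - snd z) * (\<omega> (fst z) - \<omega>N (fst z)) * (\<omega> (snd z) - \<omega>N (snd z))
          \<partial>(lborel \<Otimes>\<^sub>M lborel))
     + (enn2real (L2_norm (\<lambda>x. \<omega> x - \<omega>N x)))\<^sup>2
     + B * real N powr (- \<gamma>)"

end

theory Submission
  imports Defs "HOL-Probability.Probability"
begin

text \<open>The kernel satisfies \<open>- ln a = \<integral>\<^sub>0\<^sup>\<infinity> (exp (- t a) - exp (- t)) / t dt\<close>, and Gaussians have positive Fourier
  transform. So for a signed measure \<open>\<sigma>\<close> of total mass zero the energy with kernel
  \<open>- ln (\<bar>x - y\<bar>\<^sup>2 + \<epsilon>)\<close> controls a weighted \<open>L\<^sup>2\<close> norm of the Fourier transform of \<open>\<sigma>\<close>, which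
  behaves like the norm of \<open>H\<^sup>-\<^sup>1\<close> up to frequencies of order \<open>\<epsilon>\<^sup>-\<^sup>1\<^sup>/\<^sup>2\<close>. With \<open>\<epsilon> = 1 / N\<close>, passing from
  the off-diagonal energy of \<open>\<rho> + \<omega> - \<rho>\<^sub>N - \<omega>\<^sub>N\<close> to this regularized energy costs \<open>ln N / N\<close> for the
  diagonal and \<open>O(N\<^sup>-\<^sup>1\<^sup>/\<^sup>2)\<close> for the interactions with bounded densities. By duality \<open>\<rho>\<^sub>N - \<rho>\<close> is small
  against Lipschitz functions, with the square root of the modulated energy as rate.
  Tested on \<open>x \<mapsto> exp (- i (x, v x) \<bullet> \<zeta>)\<close>, and together with the velocity
  fluctuations, this bounds the Fourier transform of the difference in the theorem by a constant times
  \<open>(1 + \<bar>\<zeta>\<bar>) (\<H>\<^sup>1\<^sup>/\<^sup>2 + N\<^sup>-\<^sup>\<beta>)\<close>. It is also at most \<open>2\<close>, and the product of the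
  two bounds gives the square root in the statement.\<close>

section \<open>Gaussian Fourier transforms\<close>

text \<open>The off-diagonal energy has no sign: the infinite self-energies that would make it a
  square have been removed. Adding \<open>\<epsilon>\<close> to the squared distance makes the
  self-energies finite, and the energy becomes a superposition of Gaussian energies, each
  nonnegative. Total mass zero is what cancels the exp (- t) in the formula for the logarithm. Every
  Fourier identity carries a Gaussian weight, so it follows from Fubini; where Plancherel for
  gradients would be natural, an inequality obtained from difference quotients and Fatou takes its
  place. The energy sees \<rho> + \<omega> - \<rho>_N - \<omega>_N only as a whole. To isolate
  \<rho>_N - \<rho>, the part \<omega> - \<omega>_N is removed by Cauchy-Schwarz, which is the role
  of the L2 term in the modulated energy. The phase (x, v x) \<bullet> \<zeta> must be Lipschitz in
  x, while \<open>v\<close> is given through weak derivatives; mollification along coordinate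
  directions bridges this. The Lipschitz constant grows linearly in \<zeta>, and the Sobolev weight
  absorbs this growth.\<close>

lemma gaussian_fourier_real:
  fixes x t :: real
  assumes t: "t > 0"
  shows "integrable lborel (\<lambda>s. exp (- s\<^sup>2 / (4 * t)) *\<^sub>R cis (x * s))"
    and "(\<integral>s. exp (- s\<^sup>2 / (4 * t)) *\<^sub>R cis (x * s) \<partial>lborel)
      = of_real (sqrt (4 * pi * t) * exp (- t * x\<^sup>2))"
proof -
  \<comment> \<open>Dilation by \<open>c\<close> turns the standard normal density into a multiple
    of exp (- s^2 / (4 t)), so the claim is the known characteristic function of the normal law,
    rescaled.\<close>
  define c where "c = 1 / sqrt (2 * t)"
  have c: "c > 0" "c\<^sup>2 = 1 / (2 * t)" using t by (auto simp: c_def power_divide)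
  define F where "F = (\<lambda>s. std_normal_density s *\<^sub>R iexp ((x / c) * s))"
  have "integrable std_normal_distribution (\<lambda>s. iexp ((x / c) * s))"
    by (intro finite_measure.integrable_const_bound[where B = 1]
       prob_space.finite_measure prob_space_normal_density) auto
  hence i: "integrable lborel F"
    unfolding F_def by (subst (asm) integrable_density) auto
  have "char std_normal_distribution (x / c) = (\<integral>s. F s \<partial>lborel)"
    unfolding char_def F_def by (subst integral_density) auto
  hence e: "(\<integral>s. F s \<partial>lborel) = of_real (exp (- t * x\<^sup>2))"
    using t c by (simp add: char_std_normal_distribution power_divide mult.commute)
  have F: "F (0 + c * s) = (1 / sqrt (2 * pi)) *\<^sub>R (exp (- s\<^sup>2 / (4 * t)) *\<^sub>R cis (x * s))" for s
    using t c by (simp add: F_def std_normal_density_def power_mult_distrib cis_conv_exp mult.commute)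
  have "integrable lborel (\<lambda>s. (sqrt (2 * pi)) *\<^sub>R F (0 + c * s))"
    using lborel_integrable_real_affine[OF i, of c 0] c by (intro integrable_scaleR_right) auto
  thus "integrable lborel (\<lambda>s. exp (- s\<^sup>2 / (4 * t)) *\<^sub>R cis (x * s))"
    unfolding F by simp
  have "(\<integral>s. F s \<partial>lborel) = c *\<^sub>R (\<integral>s. F (0 + c * s) \<partial>lborel)"
    using lborel_integral_real_affine[of c F 0] c by simp
  also have "\<dots> = (c / sqrt (2 * pi)) *\<^sub>R (\<integral>s. exp (- s\<^sup>2 / (4 * t)) *\<^sub>R cis (x * s) \<partial>lborel)"
    unfolding F integral_scaleR_right by simp
  finally have "(\<integral>s. exp (- s\<^sup>2 / (4 * t)) *\<^sub>R cis (x * s) \<partial>lborel)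
     = (sqrt (2 * pi) / c) *\<^sub>R of_real (exp (- t * x\<^sup>2))"
    using e c by (simp add: scaleR_conv_of_real field_simps)
  also have "sqrt (2 * pi) / c = sqrt (4 * pi * t)"
    using t by (simp add: c_def real_sqrt_mult[symmetric])
  finally show "(\<integral>s. exp (- s\<^sup>2 / (4 * t)) *\<^sub>R cis (x * s) \<partial>lborel)
      = of_real (sqrt (4 * pi * t) * exp (- t * x\<^sup>2))"
    by (simp add: scaleR_conv_of_real)
qed

lemma lborel_prod_Basis:
  fixes f :: "'a::euclidean_space \<Rightarrow> real \<Rightarrow> 'b::{real_normed_field, banach, second_countable_topology}"
  assumes i: "\<And>b. b \<in> Basis \<Longrightarrow> integrable lborel (f b)"
  shows integrable_lborel_prod_Basis: "integrable lborel (\<lambda>x::'a. \<Prod>b\<in>Basis. f b (x \<bullet> b))"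
    and integral_lborel_prod_Basis:
      "(\<integral>(x::'a). (\<Prod>b\<in>Basis. f b (x \<bullet> b)) \<partial>lborel) = (\<Prod>b\<in>Basis. (\<integral>s. f b s \<partial>lborel))"
proof -
  interpret product_sigma_finite "\<lambda>_::'a. lborel :: real measure" ..
  have m[measurable]: "b \<in> Basis \<Longrightarrow> f b \<in> borel_measurable borel" for b
    using i[of b] by auto
  have eq: "(\<Prod>b\<in>Basis. f b ((\<Sum>c\<in>Basis. g c *\<^sub>R c) \<bullet> b)) = (\<Prod>b\<in>Basis. f b (g b))" for g :: "'a \<Rightarrow> real"
    by (intro prod.cong) auto
  show "integrable lborel (\<lambda>x::'a. \<Prod>b\<in>Basis. f b (x \<bullet> b))"
    unfolding lborel_eq[where 'a='a]
    by (subst integrable_distr_eq) (auto simp: eq intro!: product_integrable_prod i)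
  show "(\<integral>(x::'a). (\<Prod>b\<in>Basis. f b (x \<bullet> b)) \<partial>lborel) = (\<Prod>b\<in>Basis. (\<integral>s. f b s \<partial>lborel))"
    unfolding lborel_eq[where 'a='a]
    by (subst integral_distr) (auto simp: eq intro!: product_integral_prod i)
qed

lemma norm_square_Basis: "(norm (x::'a::euclidean_space))\<^sup>2 = (\<Sum>b\<in>Basis. (x \<bullet> b)\<^sup>2)"
  by (subst norm_eq_sqrt_inner, subst euclidean_inner) (simp add: power2_eq_square sum_nonneg)

lemma cis_sum: "cis (\<Sum>i\<in>A. f i) = (\<Prod>i\<in>A. cis (f i))"
  by (induction A rule: infinite_finite_induct) (auto simp flip: cis_mult)

text \<open>The Gaussian and the character both factor over coordinates. The width is chosen so that
  the transform is exp (- t |x|^2), the function that appears in the integral formula for the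
  logarithm.\<close>

lemma gaussian_fourier:
  fixes x :: "'a::euclidean_space"
  assumes t: "t > 0"
  shows "integrable lborel (\<lambda>\<xi>. exp (- (norm \<xi>)\<^sup>2 / (4 * t)) *\<^sub>R cis (x \<bullet> \<xi>))"
    and "(\<integral>\<xi>. exp (- (norm \<xi>)\<^sup>2 / (4 * t)) *\<^sub>R cis (x \<bullet> \<xi>) \<partial>lborel)
      = of_real (sqrt (4 * pi * t) ^ DIM('a) * exp (- t * (norm x)\<^sup>2))"
proof -
  have e: "exp (- (norm \<xi>)\<^sup>2 / (4 * t)) *\<^sub>R cis (x \<bullet> \<xi>) =
    (\<Prod>b\<in>Basis. exp (- (\<xi> \<bullet> b)\<^sup>2 / (4 * t)) *\<^sub>R cis ((x \<bullet> b) * (\<xi> \<bullet> b)))" for \<xi>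
    unfolding norm_square_Basis euclidean_inner[of x \<xi>] cis_sum scaleR_conv_of_real prod.distrib
    by (simp add: exp_sum sum_divide_distrib flip: of_real_prod sum_negf)
  show "integrable lborel (\<lambda>\<xi>. exp (- (norm \<xi>)\<^sup>2 / (4 * t)) *\<^sub>R cis (x \<bullet> \<xi>))"
    unfolding e by (intro integrable_lborel_prod_Basis gaussian_fourier_real t)
  have "(\<integral>\<xi>. exp (- (norm \<xi>)\<^sup>2 / (4 * t)) *\<^sub>R cis (x \<bullet> \<xi>) \<partial>lborel)
      = (\<Prod>b\<in>Basis. of_real (sqrt (4 * pi * t) * exp (- t * (x \<bullet> b)\<^sup>2)))"
    unfolding e
    by (subst integral_lborel_prod_Basis)
      (rule gaussian_fourier_real t prod.cong refl | assumption)+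
  also have "\<dots> = of_real (sqrt (4 * pi * t) ^ DIM('a) * exp (- t * (norm x)\<^sup>2))"
    unfolding norm_square_Basis by (simp add: prod.distrib exp_sum sum_distrib_left)
  finally show "(\<integral>\<xi>. exp (- (norm \<xi>)\<^sup>2 / (4 * t)) *\<^sub>R cis (x \<bullet> \<xi>) \<partial>lborel)
      = of_real (sqrt (4 * pi * t) ^ DIM('a) * exp (- t * (norm x)\<^sup>2))" .
qed

lemma gaussian_integral:
  assumes t: "t > 0"
  shows "integrable lborel (\<lambda>\<xi>::'a::euclidean_space. exp (- t * (norm \<xi>)\<^sup>2))"
    and "(\<integral>(\<xi>::'a). exp (- t * (norm \<xi>)\<^sup>2) \<partial>lborel) = sqrt (pi / t) ^ DIM('a)"
proof -
  define s where "s = 1 / (4 * t)"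
  have s: "s > 0" "4 * pi * s = pi / t" "z / (4 * s) = t * z" for z using t by (auto simp: s_def)
  have "integrable lborel (\<lambda>\<xi>::'a. Re (exp (- (norm \<xi>)\<^sup>2 / (4 * s)) *\<^sub>R cis (0 \<bullet> \<xi>)))"
    by (intro integrable_Re gaussian_fourier s)
  thus "integrable lborel (\<lambda>\<xi>::'a. exp (- t * (norm \<xi>)\<^sup>2))" using s by simp
  have "(\<integral>(\<xi>::'a). complex_of_real (exp (- t * (norm \<xi>)\<^sup>2)) \<partial>lborel) = of_real (sqrt (pi / t) ^ DIM('a))"
    using gaussian_fourier(2)[OF s(1), of "0::'a"] s by (simp add: scaleR_conv_of_real)
  thus "(\<integral>(\<xi>::'a). exp (- t * (norm \<xi>)\<^sup>2) \<partial>lborel) = sqrt (pi / t) ^ DIM('a)"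
    by (simp flip: of_real_power)
qed

lemma integrable_pair_mult:
  fixes u :: "'x \<Rightarrow> 'c::{real_normed_field, banach, second_countable_topology}" and w :: "'y \<Rightarrow> 'c"
  assumes "sigma_finite_measure M1" "sigma_finite_measure M2"
    and u: "integrable M1 u" and w: "integrable M2 w"
  shows "integrable (M1 \<Otimes>\<^sub>M M2) (\<lambda>z. u (fst z) * w (snd z))"
    and "(\<integral>z. u (fst z) * w (snd z) \<partial>(M1 \<Otimes>\<^sub>M M2)) = (\<integral>x. u x \<partial>M1) * (\<integral>y. w y \<partial>M2)"
proof -
  interpret M1: sigma_finite_measure M1 by fact
  interpret M2: sigma_finite_measure M2 by fact
  interpret P: pair_sigma_finite M1 M2 ..
  have [measurable]: "u \<in> borel_measurable M1" "w \<in> borel_measurable M2" using u w by auto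
  show i: "integrable (M1 \<Otimes>\<^sub>M M2) (\<lambda>z. u (fst z) * w (snd z))"
    using u w by (intro P.Fubini_integrable) (auto simp: norm_mult)
  show "(\<integral>z. u (fst z) * w (snd z) \<partial>(M1 \<Otimes>\<^sub>M M2)) = (\<integral>x. u x \<partial>M1) * (\<integral>y. w y \<partial>M2)"
    using P.integral_fst'[OF i] by simp
qed

lemma borel_measurable_cis [measurable]: "cis \<in> borel_measurable borel"
  by (intro borel_measurable_continuous_onI continuous_intros)

text \<open>Parseval's identity with a Gaussian weight: the weight is integrable, so Fubini
  suffices. Measures and densities are kept apart so that one statement serves finite measures
  (weight 1), functions on \<open>lborel\<close>, and mixed pairs.\<close>

lemma gaussian_pairing:
  fixes M1 M2 :: "'a::euclidean_space measure" and u w :: "'a \<Rightarrow> real"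
  assumes t: "t > 0"
    and M: "sigma_finite_measure M1" "sigma_finite_measure M2" "sets M1 = sets borel" "sets M2 = sets borel"
    and u: "integrable M1 u" and w: "integrable M2 w"
  defines "h \<equiv> \<lambda>\<xi>. exp (- (norm \<xi>)\<^sup>2 / (4 * t)) *\<^sub>R
      ((\<integral>x. u x *\<^sub>R cis (- (x \<bullet> \<xi>)) \<partial>M1) * cnj (\<integral>x. w x *\<^sub>R cis (- (x \<bullet> \<xi>)) \<partial>M2))"
  shows "integrable lborel h"
    and "integrable (M1 \<Otimes>\<^sub>M M2) (\<lambda>z. u (fst z) * w (snd z) * exp (- t * (norm (fst z - snd z))\<^sup>2))"
    and "(\<integral>\<xi>. h \<xi> \<partial>lborel) = of_real (sqrt (4 * pi * t) ^ DIM('a) *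
        (\<integral>z. u (fst z) * w (snd z) * exp (- t * (norm (fst z - snd z))\<^sup>2) \<partial>(M1 \<Otimes>\<^sub>M M2)))"
proof -
  interpret M1: sigma_finite_measure M1 by fact
  interpret M2: sigma_finite_measure M2 by fact
  interpret P: pair_sigma_finite M1 M2 ..
  interpret PL: pair_sigma_finite "M1 \<Otimes>\<^sub>M M2" "lborel :: 'a measure" ..
  note [measurable_cong] = M(3,4)
  have [measurable]: "u \<in> borel_measurable borel" "w \<in> borel_measurable borel"
    using u w M by (auto simp: borel_measurable_integrable cong: measurable_cong_sets)
  define G where "G = (\<lambda>\<xi>::'a. exp (- (norm \<xi>)\<^sup>2 / (4 * t)))"
  have [measurable]: "G \<in> borel_measurable borel" unfolding G_def by measurable
  have G: "integrable lborel G"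
    using gaussian_integral(1)[of "1/(4*t)", where 'a='a] t by (simp add: G_def)
  have uw: "integrable (M1 \<Otimes>\<^sub>M M2) (\<lambda>z. u (fst z) * w (snd z))"
    by (intro integrable_pair_mult M u w)
  define K where "K = (\<lambda>(z, \<xi>). (u (fst z) * w (snd z)) *\<^sub>R (G \<xi> *\<^sub>R cis ((snd z - fst z) \<bullet> \<xi>)))"
  have "integrable ((M1 \<Otimes>\<^sub>M M2) \<Otimes>\<^sub>M lborel) (\<lambda>p. (u (fst (fst p)) * w (snd (fst p))) * G (snd p))"
    by (intro integrable_pair_mult(1)[OF _ _ uw G] P.sigma_finite_measure_axioms lborel.sigma_finite_measure_axioms)
  hence K: "integrable ((M1 \<Otimes>\<^sub>M M2) \<Otimes>\<^sub>M lborel) K"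
    by (rule Bochner_Integration.integrable_bound)
      (auto simp: K_def case_prod_unfold abs_mult)
  show 1: "integrable (M1 \<Otimes>\<^sub>M M2) (\<lambda>z. u (fst z) * w (snd z) * exp (- t * (norm (fst z - snd z))\<^sup>2))"
    using uw by (rule Bochner_Integration.integrable_bound) (use t in \<open>auto simp: abs_mult intro!: mult_left_le\<close>)
  have hK: "h \<xi> = (\<integral>z. K (z, \<xi>) \<partial>(M1 \<Otimes>\<^sub>M M2))" for \<xi>
  proof -
    have "integrable M1 (\<lambda>x. u x *\<^sub>R cis (- (x \<bullet> \<xi>)))"
      using u by (rule Bochner_Integration.integrable_bound) auto
    moreover have "integrable M2 (\<lambda>x. w x *\<^sub>R cis (x \<bullet> \<xi>))"
      using w by (rule Bochner_Integration.integrable_bound) auto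
    ultimately have "(\<integral>x. u x *\<^sub>R cis (- (x \<bullet> \<xi>)) \<partial>M1) * (\<integral>x. w x *\<^sub>R cis (x \<bullet> \<xi>) \<partial>M2)
       = (\<integral>z. (u (fst z) *\<^sub>R cis (- (fst z \<bullet> \<xi>))) * (w (snd z) *\<^sub>R cis (snd z \<bullet> \<xi>)) \<partial>(M1 \<Otimes>\<^sub>M M2))"
      by (intro integrable_pair_mult(2)[symmetric] M)
    also have "G \<xi> *\<^sub>R \<dots> = (\<integral>z. K (z, \<xi>) \<partial>(M1 \<Otimes>\<^sub>M M2))"
      unfolding K_def prod.case integral_scaleR_right[symmetric]
      by (intro Bochner_Integration.integral_cong)
        (auto simp: inner_diff_left cis_mult scaleR_conv_of_real mult_ac)
    finally have *: "G \<xi> *\<^sub>R ((\<integral>x. u x *\<^sub>R cis (- (x \<bullet> \<xi>)) \<partial>M1) * (\<integral>x. w x *\<^sub>R cis (x \<bullet> \<xi>) \<partial>M2))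
      = (\<integral>z. K (z, \<xi>) \<partial>(M1 \<Otimes>\<^sub>M M2))" .
    have "(\<integral>x. w x *\<^sub>R cis (x \<bullet> \<xi>) \<partial>M2) = (\<integral>x. cnj (w x *\<^sub>R cis (- (x \<bullet> \<xi>))) \<partial>M2)"
      by (simp add: cis_cnj del: Bochner_Integration.integral_cnj)
    also have "\<dots> = cnj (\<integral>x. w x *\<^sub>R cis (- (x \<bullet> \<xi>)) \<partial>M2)"
      by (rule Bochner_Integration.integral_cnj)
    finally have "(\<integral>x. w x *\<^sub>R cis (x \<bullet> \<xi>) \<partial>M2) = cnj (\<integral>x. w x *\<^sub>R cis (- (x \<bullet> \<xi>)) \<partial>M2)" .
    with * show ?thesis
      unfolding h_def G_def by simp
  qed
  show "integrable lborel h"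
    unfolding hK using PL.integrable_snd[of "\<lambda>z \<xi>. K (z, \<xi>)"] K by simp
  have "(\<integral>\<xi>. h \<xi> \<partial>lborel) = (\<integral>z. (\<integral>\<xi>. K (z, \<xi>) \<partial>lborel) \<partial>(M1 \<Otimes>\<^sub>M M2))"
    unfolding hK using PL.Fubini_integral[of "\<lambda>z \<xi>. K (z, \<xi>)"] K by simp
  also have "\<dots> = (\<integral>z. of_real (sqrt (4 * pi * t) ^ DIM('a) *
        (u (fst z) * w (snd z) * exp (- t * (norm (fst z - snd z))\<^sup>2))) \<partial>(M1 \<Otimes>\<^sub>M M2))"
    unfolding K_def G_def prod.case integral_scaleR_right gaussian_fourier(2)[OF t]
    by (simp add: scaleR_conv_of_real norm_minus_commute mult_ac)
  finally show "(\<integral>\<xi>. h \<xi> \<partial>lborel) = of_real (sqrt (4 * pi * t) ^ DIM('a) *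
        (\<integral>z. u (fst z) * w (snd z) * exp (- t * (norm (fst z - snd z))\<^sup>2) \<partial>(M1 \<Otimes>\<^sub>M M2)))"
    unfolding integral_complex_of_real by simp
qed

section \<open>Fourier lower bound for the logarithmic energy\<close>

text \<open>The quotient is the integral of exp (- t s) over s from \<open>p\<close> to
  \<open>q\<close>. By Tonelli the integral over t comes first and leaves 1 / s.\<close>

lemma frullani_nn:
  fixes p q :: real
  assumes "0 < p" "p \<le> q"
  shows "(\<integral>\<^sup>+t. ennreal (indicator {0<..} t * ((exp (- t * p) - exp (- t * q)) / t)) \<partial>lborel) = ennreal (ln q - ln p)"
proof -
  have 1: "ennreal (indicator {0<..} t * ((exp (- t * p) - exp (- t * q)) / t))
     = (\<integral>\<^sup>+s. ennreal (exp (- t * s)) * indicator {0<..} t * indicator {p..q} s \<partial>lborel)" for t :: real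
  proof (cases "t > 0")
    case True
    have "(\<integral>\<^sup>+s. ennreal (exp (- t * s)) * indicator {p..q} s \<partial>lborel)
       = ennreal (- exp (- t * q) / t - (- exp (- t * p) / t))"
      using True assms by (intro nn_integral_FTC_Icc) (auto intro!: derivative_eq_intros simp: has_real_derivative_iff_has_vector_derivative[symmetric])
    thus ?thesis using True by (simp add: diff_divide_distrib)
  qed simp
  have 2: "(\<integral>\<^sup>+t. ennreal (exp (- t * s)) * indicator {0<..} t * indicator {p..q} s \<partial>lborel)
     = ennreal (1 / s) * indicator {p..q} s" for s :: real
  proof (cases "s \<in> {p..q}")
    case True
    hence s: "s > 0" using assms by auto
    have "((\<lambda>t. - exp (- t * s) / s) \<longlongrightarrow> 0) at_top"
      using s by real_asymp
    hence "(\<integral>\<^sup>+t. ennreal (exp (- t * s)) * indicator {0..} t \<partial>lborel) = ennreal (0 - (- exp (- 0 * s) / s))"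
      using s by (intro nn_integral_FTC_atLeast) (auto intro!: derivative_eq_intros)
    moreover have "(\<integral>\<^sup>+t. ennreal (exp (- t * s)) * indicator {0<..} t \<partial>lborel) = (\<integral>\<^sup>+t. ennreal (exp (- t * s)) * indicator {0..} t \<partial>lborel)"
      by (intro nn_integral_cong_AE, use AE_lborel_singleton[of "0::real"] in eventually_elim) (auto simp: indicator_def)
    ultimately show ?thesis using True by simp
  qed simp
  have "(\<integral>\<^sup>+t. ennreal (indicator {0<..} t * ((exp (- t * p) - exp (- t * q)) / t)) \<partial>lborel)
     = (\<integral>\<^sup>+s. (\<integral>\<^sup>+t. ennreal (exp (- t * s)) * indicator {0<..} t * indicator {p..q} s \<partial>lborel) \<partial>lborel)"
    unfolding 1 by (rule lborel_pair.Fubini') simp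
  also have "\<dots> = (\<integral>\<^sup>+s. ennreal (1 / s) * indicator {p..q} s \<partial>lborel)"
    unfolding 2 ..
  also have "\<dots> = ennreal (ln q - ln p)"
    using assms by (intro nn_integral_FTC_Icc) (auto intro!: derivative_eq_intros simp: has_real_derivative_iff_has_vector_derivative[symmetric] divide_simps)
  finally show ?thesis .
qed

text \<open>The integrand has a constant sign, decided by whether \<open>a \<le> 1\<close>, so both
  cases reduce to the nonnegative integral. The same fact gives the absolute integral, which is the
  input for Fubini in \<open>frullani_average\<close>.\<close>

lemma frullani:
  fixes a :: real
  defines "F \<equiv> \<lambda>t. indicator {0<..} t * ((exp (- t * a) - exp (- t)) / t)"
  assumes a: "0 < a"
  shows "integrable lborel F" "(\<integral>t. F t \<partial>lborel) = - ln a" "(\<integral>t. \<bar>F t\<bar> \<partial>lborel) = \<bar>ln a\<bar>"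
proof -
  have "integrable lborel F \<and> (\<integral>t. F t \<partial>lborel) = - ln a \<and> (\<integral>t. \<bar>F t\<bar> \<partial>lborel) = \<bar>ln a\<bar>"
  proof (cases "a \<le> 1")
    case True
    have nn: "F t \<ge> 0" for t
      using True a by (auto simp: F_def indicator_def divide_simps mult_le_cancel_left2)
    have "has_bochner_integral lborel F (- ln a)"
      using frullani_nn[of a 1] a True nn
      by (intro has_bochner_integral_nn_integral) (auto simp: F_def)
    thus ?thesis using nn True a by (auto simp: has_bochner_integral_iff)
  next
    case False
    have nn: "- F t \<ge> 0" for t
      using False a by (auto simp: F_def indicator_def divide_simps mult_le_cancel_left1)
    have eq: "- F t = indicator {0<..} t * ((exp (- t * 1) - exp (- t * a)) / t)" for t
      by (simp add: F_def diff_divide_distrib algebra_simps)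
    have "(\<integral>\<^sup>+t. ennreal (- F t) \<partial>lborel) = ennreal (ln a)"
      unfolding eq using frullani_nn[of 1 a] False by simp
    hence "has_bochner_integral lborel (\<lambda>t. - F t) (ln a)"
      using False nn by (intro has_bochner_integral_nn_integral) (auto simp: F_def)
    hence "has_bochner_integral lborel F (- ln a)" "has_bochner_integral lborel (\<lambda>t. - F t) (ln a)"
      using has_bochner_integral_minus by force+
    moreover have "\<bar>F t\<bar> = - F t" for t using nn[of t] by simp
    ultimately show ?thesis using False by (auto simp: has_bochner_integral_iff)
  qed
  thus "integrable lborel F" "(\<integral>t. F t \<partial>lborel) = - ln a" "(\<integral>t. \<bar>F t\<bar> \<partial>lborel) = \<bar>ln a\<bar>" by auto
qed

text \<open>The inner absolute integral equals \<open>\<bar>ln (a z)\<bar>\<close>, so integrability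
  of the logarithm is exactly what Fubini asks for. The term exp (- t) stays, weighted by the mass
  of \<open>M\<close>; it cancels only in the sum over all pairs of a signed measure.\<close>

lemma frullani_average:
  fixes a :: "'z \<Rightarrow> real"
  assumes "finite_measure M" and a: "AE z in M. 0 < a z" "integrable M (\<lambda>z. ln (a z))"
    and [measurable]: "a \<in> borel_measurable M"
  shows "integrable lborel (\<lambda>t. indicator {0<..} t * (((\<integral>z. exp (- t * a z) \<partial>M) - exp (- t) * measure M (space M)) / t))"
    and "(\<integral>t. indicator {0<..} t * (((\<integral>z. exp (- t * a z) \<partial>M) - exp (- t) * measure M (space M)) / t) \<partial>lborel)
      = (\<integral>z. - ln (a z) \<partial>M)"
proof -
  interpret finite_measure M by fact
  interpret P: pair_sigma_finite M "lborel :: real measure" ..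
  define F where "F = (\<lambda>z t. indicator {0<..} t * ((exp (- t * a z) - exp (- t)) / t))"
  have i: "integrable (M \<Otimes>\<^sub>M lborel) (\<lambda>(z, t). F z t)"
  proof (rule P.Fubini_integrable)
    show "(\<lambda>(z, t). F z t) \<in> borel_measurable (M \<Otimes>\<^sub>M lborel)"
      unfolding F_def by measurable
    have "AE z in M. \<bar>ln (a z)\<bar> = (\<integral>t. norm (F z t) \<partial>lborel)"
      using a(1) by eventually_elim (simp only: F_def real_norm_def frullani(3))
    moreover have "integrable M (\<lambda>z. \<bar>ln (a z)\<bar>)" using a(2) by simp
    moreover have "(\<lambda>z. \<integral>t. norm (F z t) \<partial>lborel) \<in> borel_measurable M"
      unfolding F_def by measurable
    ultimately show "integrable M (\<lambda>z. \<integral>t. norm (case (z, t) of (z, t) \<Rightarrow> F z t) \<partial>lborel)"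
      by (subst integrable_cong_AE[symmetric]) auto
    show "AE z in M. integrable lborel (\<lambda>t. case (z, t) of (z, t) \<Rightarrow> F z t)"
      using a(1) by eventually_elim (simp only: F_def prod.case frullani(1))
  qed
  have eq: "(\<integral>z. F z t \<partial>M) = indicator {0<..} t * (((\<integral>z. exp (- t * a z) \<partial>M) - exp (- t) * measure M (space M)) / t)" for t
  proof (cases "t > 0")
    case True
    have "integrable M (\<lambda>z. exp (- t * a z))"
      using True a(1) by (intro integrable_const_bound[where B = 1]) auto
    thus ?thesis using True by (simp add: F_def)
  qed (simp add: F_def)
  show "integrable lborel (\<lambda>t. indicator {0<..} t * (((\<integral>z. exp (- t * a z) \<partial>M) - exp (- t) * measure M (space M)) / t))"
    using P.integrable_snd[OF i] unfolding eq by simp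
  have "(\<integral>t. (\<integral>z. F z t \<partial>M) \<partial>lborel) = (\<integral>z. (\<integral>t. F z t \<partial>lborel) \<partial>M)"
    by (rule P.Fubini_integral[OF i])
  also have "\<dots> = (\<integral>z. - ln (a z) \<partial>M)"
  proof (rule integral_cong_AE)
    show "AE z in M. (\<integral>t. F z t \<partial>lborel) = - ln (a z)"
      using a(1) by eventually_elim (simp only: F_def frullani(2))
    show "(\<lambda>z. \<integral>t. F z t \<partial>lborel) \<in> borel_measurable M" unfolding F_def by measurable
  qed simp
  finally show "(\<integral>t. indicator {0<..} t * (((\<integral>z. exp (- t * a z) \<partial>M) - exp (- t) * measure M (space M)) / t) \<partial>lborel)
      = (\<integral>z. - ln (a z) \<partial>M)" unfolding eq .
qed

section \<open>Energies of signed measures with a general kernel\<close>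

definition energy :: "('a::euclidean_space \<Rightarrow> real) \<Rightarrow> 'a signed_measure \<Rightarrow> real" where
  "energy k \<sigma> = (\<Sum>(a, \<mu>)\<leftarrow>\<sigma>. \<Sum>(b, \<nu>)\<leftarrow>\<sigma>. a * b * (\<integral>z. k (fst z - snd z) \<partial>(\<mu> \<Otimes>\<^sub>M \<nu>)))"

definition finite_borel :: "'a::euclidean_space signed_measure \<Rightarrow> bool" where
  "finite_borel \<sigma> \<longleftrightarrow> (\<forall>\<mu>\<in>snd ` set \<sigma>. finite_measure \<mu> \<and> sets \<mu> = sets borel)"

definition total_mass :: "'a::euclidean_space signed_measure \<Rightarrow> real" where
  "total_mass \<sigma> = (\<Sum>(a, \<mu>)\<leftarrow>\<sigma>. a * measure \<mu> (space \<mu>))"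

text \<open>The Bochner integral of a nonintegrable function is 0, so linearity of the energy in the
  kernel can fail unless every pair of components is integrable.\<close>

definition pairs_integrable :: "('a::euclidean_space \<Rightarrow> real) \<Rightarrow> 'a signed_measure \<Rightarrow> bool" where
  "pairs_integrable k \<sigma> \<longleftrightarrow> (\<forall>\<mu>\<in>snd ` set \<sigma>. \<forall>\<nu>\<in>snd ` set \<sigma>.
     integrable (\<mu> \<Otimes>\<^sub>M \<nu>) (\<lambda>z. k (fst z - snd z)))"

lemma sum_list_case_prod_nth: "(\<Sum>(a, \<mu>)\<leftarrow>\<sigma>. f a \<mu>) = (\<Sum>i<length \<sigma>. f (fst (\<sigma> ! i)) (snd (\<sigma> ! i)))"
  by (simp add: sum_list_sum_nth case_prod_unfold atLeast0LessThan)

lemma energy_nth: "energy k \<sigma> = (\<Sum>i<length \<sigma>. \<Sum>j<length \<sigma>. fst (\<sigma> ! i) * fst (\<sigma> ! j) *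
    (\<integral>z. k (fst z - snd z) \<partial>(snd (\<sigma> ! i) \<Otimes>\<^sub>M snd (\<sigma> ! j))))"
  unfolding energy_def sum_list_case_prod_nth ..

lemma integral_double_sum:
  fixes f :: "'i \<Rightarrow> 'j \<Rightarrow> 'x \<Rightarrow> 'b::{banach, second_countable_topology}"
  assumes "\<And>i j. i \<in> A \<Longrightarrow> j \<in> B \<Longrightarrow> integrable M (f i j)"
  shows "(\<integral>x. (\<Sum>i\<in>A. \<Sum>j\<in>B. f i j x) \<partial>M) = (\<Sum>i\<in>A. \<Sum>j\<in>B. (\<integral>x. f i j x \<partial>M))"
  using assms by (subst Bochner_Integration.integral_sum)
    (auto intro!: Bochner_Integration.integrable_sum sum.cong Bochner_Integration.integral_sum)

text \<open>Expanding the squared modulus of the Fourier transform as a double sum reduces this to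
  \<open>gaussian_pairing\<close> with unit weights. The left side of the identity is visibly
  nonnegative, which is the source of the positivity of the logarithmic energy.\<close>

lemma energy_gauss:
  fixes \<sigma> :: "'a::euclidean_space signed_measure"
  assumes t: "t > 0" and \<sigma>: "finite_borel \<sigma>"
  shows "integrable lborel (\<lambda>\<xi>. exp (- (norm \<xi>)\<^sup>2 / (4 * t)) * (cmod (fourier \<sigma> \<xi>))\<^sup>2)"
    and "(\<integral>\<xi>. exp (- (norm \<xi>)\<^sup>2 / (4 * t)) * (cmod (fourier \<sigma> \<xi>))\<^sup>2 \<partial>lborel)
      = sqrt (4 * pi * t) ^ DIM('a) * energy (\<lambda>x. exp (- t * (norm x)\<^sup>2)) \<sigma>"
proof -
  define n where "n = length \<sigma>"
  define a where "a i = fst (\<sigma> ! i)" for i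
  define m where "m i = snd (\<sigma> ! i)" for i
  have m: "finite_measure (m i)" "sigma_finite_measure (m i)" "sets (m i) = sets borel" if "i < n" for i
    using \<sigma> that by (auto simp: finite_borel_def n_def m_def finite_measure_def)
  define F where "F i \<xi> = (\<integral>x. 1 *\<^sub>R cis (- (x \<bullet> \<xi>)) \<partial>m i)" for i \<xi>
  have f: "fourier \<sigma> \<xi> = (\<Sum>i<n. of_real (a i) * F i \<xi>)" for \<xi>
    unfolding fourier_def sum_list_case_prod_nth F_def a_def m_def n_def by simp
  have c: "of_real ((cmod (fourier \<sigma> \<xi>))\<^sup>2) = (\<Sum>i<n. \<Sum>j<n. of_real (a i * a j) * (F i \<xi> * cnj (F j \<xi>)))" for \<xi>
    unfolding complex_norm_square unfolding f cnj_sum sum_product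
    by (simp add: mult_ac)
  have i1: "integrable (m i) (\<lambda>_. 1::real)" if "i < n" for i
    using finite_measure.integrable_const[OF m(1)[OF that]] .
  have G: "integrable lborel (\<lambda>\<xi>. exp (- (norm \<xi>)\<^sup>2 / (4 * t)) *\<^sub>R (F i \<xi> * cnj (F j \<xi>)))"
     "(\<integral>\<xi>. exp (- (norm \<xi>)\<^sup>2 / (4 * t)) *\<^sub>R (F i \<xi> * cnj (F j \<xi>)) \<partial>lborel)
      = of_real (sqrt (4 * pi * t) ^ DIM('a) * (\<integral>z. exp (- t * (norm (fst z - snd z))\<^sup>2) \<partial>(m i \<Otimes>\<^sub>M m j)))"
    if "i < n" "j < n" for i j
    using gaussian_pairing(1,3)[OF t m(2) m(2) m(3) m(3) i1 i1, of i j] that unfolding F_def by simp_all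
  have e: "complex_of_real (exp (- (norm \<xi>)\<^sup>2 / (4 * t)) * (cmod (fourier \<sigma> \<xi>))\<^sup>2)
     = (\<Sum>i<n. \<Sum>j<n. of_real (a i * a j) * (exp (- (norm \<xi>)\<^sup>2 / (4 * t)) *\<^sub>R (F i \<xi> * cnj (F j \<xi>))))" for \<xi>
    unfolding of_real_mult c by (simp add: sum_distrib_left scaleR_conv_of_real mult_ac)
  have "integrable lborel (\<lambda>\<xi>. complex_of_real (exp (- (norm \<xi>)\<^sup>2 / (4 * t)) * (cmod (fourier \<sigma> \<xi>))\<^sup>2))"
    unfolding e by (intro Bochner_Integration.integrable_sum integrable_mult_right G) auto
  thus "integrable lborel (\<lambda>\<xi>. exp (- (norm \<xi>)\<^sup>2 / (4 * t)) * (cmod (fourier \<sigma> \<xi>))\<^sup>2)"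
    using integrable_Re by fastforce
  have "complex_of_real (\<integral>\<xi>. exp (- (norm \<xi>)\<^sup>2 / (4 * t)) * (cmod (fourier \<sigma> \<xi>))\<^sup>2 \<partial>lborel)
     = (\<integral>\<xi>. complex_of_real (exp (- (norm \<xi>)\<^sup>2 / (4 * t)) * (cmod (fourier \<sigma> \<xi>))\<^sup>2) \<partial>lborel)"
    by (rule integral_complex_of_real[symmetric])
  also have "\<dots> = (\<Sum>i<n. \<Sum>j<n. of_real (a i * a j) * of_real (sqrt (4 * pi * t) ^ DIM('a) * (\<integral>z. exp (- t * (norm (fst z - snd z))\<^sup>2) \<partial>(m i \<Otimes>\<^sub>M m j))))"
    unfolding e by (subst integral_double_sum) (auto simp only: lessThan_iff integral_mult_right_zero
        intro!: integrable_mult_right sum.cong arg_cong2[where f = "(*)"] G)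
  also have "\<dots> = of_real (sqrt (4 * pi * t) ^ DIM('a) * energy (\<lambda>x. exp (- t * (norm x)\<^sup>2)) \<sigma>)"
    unfolding energy_nth by (simp add: sum_distrib_left mult_ac flip: a_def m_def n_def)
  finally show "(\<integral>\<xi>. exp (- (norm \<xi>)\<^sup>2 / (4 * t)) * (cmod (fourier \<sigma> \<xi>))\<^sup>2 \<partial>lborel)
      = sqrt (4 * pi * t) ^ DIM('a) * energy (\<lambda>x. exp (- t * (norm x)\<^sup>2)) \<sigma>"
    by (simp only: of_real_eq_iff)
qed

text \<open>Averaging the formula for the logarithm over each pair leaves exp (- t) times a product
  of masses. Over all pairs these products sum to the square of the total mass, which is 0, so only
  Gaussian energies remain; the shift by \<open>\<epsilon>\<close> becomes the factor exp (- t
  \<epsilon>).\<close>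

lemma energy_log_frullani:
  fixes \<sigma> :: "'a::euclidean_space signed_measure"
  assumes \<sigma>: "finite_borel \<sigma>" and mass: "total_mass \<sigma> = 0" and eps: "\<epsilon> \<ge> 0"
    and pos: "\<And>\<mu> \<nu>. \<mu> \<in> snd ` set \<sigma> \<Longrightarrow> \<nu> \<in> snd ` set \<sigma> \<Longrightarrow>
      AE z in \<mu> \<Otimes>\<^sub>M \<nu>. 0 < (norm (fst z - snd z))\<^sup>2 + \<epsilon>"
    and int: "pairs_integrable (\<lambda>x. ln ((norm x)\<^sup>2 + \<epsilon>)) \<sigma>"
  defines "h \<equiv> \<lambda>t. indicator {0<..} t * (exp (- t * \<epsilon>) * energy (\<lambda>x. exp (- t * (norm x)\<^sup>2)) \<sigma> / t)"
  shows "integrable lborel h" "(\<integral>t. h t \<partial>lborel) = energy (\<lambda>x. - ln ((norm x)\<^sup>2 + \<epsilon>)) \<sigma>"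
proof -
  define n where "n = length \<sigma>"
  define a where "a i = fst (\<sigma> ! i)" for i
  define m where "m i = snd (\<sigma> ! i)" for i
  have mem: "m i \<in> snd ` set \<sigma>" if "i < n" for i using that by (auto simp: m_def n_def)
  have m: "finite_measure (m i)" "sets (m i) = sets borel" if "i < n" for i
    using \<sigma> mem[OF that] by (auto simp: finite_borel_def)
  define L where "L i j t = indicator {0<..} t * (((\<integral>z. exp (- t * ((norm (fst z - snd z))\<^sup>2 + \<epsilon>)) \<partial>(m i \<Otimes>\<^sub>M m j))
     - exp (- t) * measure (m i \<Otimes>\<^sub>M m j) (space (m i \<Otimes>\<^sub>M m j))) / t)" for i j and t :: real
  have L: "integrable lborel (L i j)"
    "(\<integral>t. L i j t \<partial>lborel) = (\<integral>z. - ln ((norm (fst z - snd z))\<^sup>2 + \<epsilon>) \<partial>(m i \<Otimes>\<^sub>M m j))"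
    if ij: "i < n" "j < n" for i j
  proof -
    note [measurable_cong] = m(2)[OF ij(1)] m(2)[OF ij(2)]
    have fm: "finite_measure (m i \<Otimes>\<^sub>M m j)"
      using m ij by (intro finite_measure_pair_measure) auto
    have me: "(\<lambda>z. (norm (fst z - snd z))\<^sup>2 + \<epsilon>) \<in> borel_measurable (m i \<Otimes>\<^sub>M m j)" by measurable
    note * = frullani_average[OF fm pos[OF mem[OF ij(1)] mem[OF ij(2)]] _ me]
    have "integrable (m i \<Otimes>\<^sub>M m j) (\<lambda>z. ln ((norm (fst z - snd z))\<^sup>2 + \<epsilon>))"
      using int mem[OF ij(1)] mem[OF ij(2)] unfolding pairs_integrable_def by blast
    from *[OF this] show "integrable lborel (L i j)"
      "(\<integral>t. L i j t \<partial>lborel) = (\<integral>z. - ln ((norm (fst z - snd z))\<^sup>2 + \<epsilon>) \<partial>(m i \<Otimes>\<^sub>M m j))"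
      unfolding L_def .
  qed
  have prod: "measure (m i \<Otimes>\<^sub>M m j) (space (m i \<Otimes>\<^sub>M m j)) = measure (m i) (space (m i)) * measure (m j) (space (m j))"
    if ij: "i < n" "j < n" for i j
  proof -
    interpret mj: finite_measure "m j" using m ij by auto
    show ?thesis unfolding space_pair_measure
      by (simp add: measure_def mj.emeasure_pair_measure_Times enn2real_mult)
  qed
  have "(\<Sum>i<n. \<Sum>j<n. a i * a j * measure (m i \<Otimes>\<^sub>M m j) (space (m i \<Otimes>\<^sub>M m j))) = (total_mass \<sigma>)\<^sup>2"
    unfolding total_mass_def sum_list_case_prod_nth power2_eq_square sum_product a_def m_def n_def
    using prod by (intro sum.cong refl) (simp add: m_def n_def mult_ac)
  hence z: "(\<Sum>i<n. \<Sum>j<n. a i * a j * measure (m i \<Otimes>\<^sub>M m j) (space (m i \<Otimes>\<^sub>M m j))) = 0" using mass by simp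
  have h: "h t = (\<Sum>i<n. \<Sum>j<n. a i * a j * L i j t)" for t
  proof -
    define E where "E i j = (\<integral>z. exp (- t * (norm (fst z - snd z))\<^sup>2) \<partial>(m i \<Otimes>\<^sub>M m j))" for i j
    define V where "V i j = measure (m i \<Otimes>\<^sub>M m j) (space (m i \<Otimes>\<^sub>M m j))" for i j
    have 1: "(\<integral>z. exp (- t * ((norm (fst z - snd z))\<^sup>2 + \<epsilon>)) \<partial>(m i \<Otimes>\<^sub>M m j)) = exp (- t * \<epsilon>) * E i j" for i j
      unfolding E_def Bochner_Integration.integral_mult_right_zero[symmetric]
      by (intro Bochner_Integration.integral_cong refl) (simp add: ring_distribs flip: exp_add)
    have "(\<Sum>i<n. \<Sum>j<n. a i * a j * L i j t) = indicator {0<..} t / t *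
       (exp (- t * \<epsilon>) * (\<Sum>i<n. \<Sum>j<n. a i * a j * E i j) - exp (- t) * (\<Sum>i<n. \<Sum>j<n. a i * a j * V i j))"
      unfolding L_def 1 V_def[symmetric] sum_distrib_left sum_subtractf[symmetric]
      by (intro sum.cong refl) (simp add: algebra_simps diff_divide_distrib)
    also have "\<dots> = h t"
      using z unfolding h_def energy_nth V_def E_def n_def a_def m_def by simp
    finally show ?thesis ..
  qed
  show "integrable lborel h"
    unfolding h by (intro Bochner_Integration.integrable_sum integrable_mult_right L) auto
  show "(\<integral>t. h t \<partial>lborel) = energy (\<lambda>x. - ln ((norm x)\<^sup>2 + \<epsilon>)) \<sigma>"
    unfolding h energy_nth using L
    by (subst integral_double_sum) (auto simp flip: a_def m_def n_def)
qed

lemma borel_measurable_fourier: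
  assumes "finite_borel \<sigma>" shows "fourier \<sigma> \<in> borel_measurable borel"
proof -
  have "(\<lambda>\<xi>. complex_of_real a * (\<integral>x. cis (- (x \<bullet> \<xi>)) \<partial>\<mu>)) \<in> borel_measurable borel" if "(a, \<mu>) \<in> set \<sigma>" for a \<mu>
  proof -
    have m: "finite_measure \<mu>" "sets \<mu> = sets borel" using that assms by (force simp: finite_borel_def)+
    interpret finite_measure \<mu> by fact
    note [measurable_cong] = m(2)
    show ?thesis by measurable
  qed
  thus ?thesis unfolding fourier_def[abs_def] sum_list_case_prod_nth
    by (intro borel_measurable_sum) (metis lessThan_iff nth_mem prod.collapse)
qed

text \<open>For positive \<open>\<epsilon>\<close> the integral is a modified Bessel function of the
  second kind. Restricting it to t between c and 2 c is enough: there exp (- c / t) is at least exp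
  (- 1), the other two factors are smallest at t = 2 c, and the interval has length c.\<close>

lemma bessel_weight_lower_bound:
  assumes c: "c > 0" and eps: "\<epsilon> \<ge> 0"
  shows "ennreal (exp (- 1) * exp (- 2 * \<epsilon> * c) / (4 * c))
    \<le> (\<integral>\<^sup>+t. ennreal (indicator {0<..} t * (exp (- t * \<epsilon>) * exp (- c / t) / t\<^sup>2)) \<partial>lborel)"
proof -
  have "ennreal (exp (- 1) * exp (- 2 * \<epsilon> * c) / (4 * c)) = ennreal (exp (- 1) * exp (- 2 * \<epsilon> * c) / (4 * c\<^sup>2)) * emeasure lborel {c..2 * c}"
    using c by (simp add: ennreal_mult[symmetric] power2_eq_square)
  also have "\<dots> = (\<integral>\<^sup>+t. ennreal (exp (- 1) * exp (- 2 * \<epsilon> * c) / (4 * c\<^sup>2)) * indicator {c..2 * c} t \<partial>lborel)"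
    by (simp add: nn_integral_cmult_indicator)
  also have "\<dots> \<le> (\<integral>\<^sup>+t. ennreal (indicator {0<..} t * (exp (- t * \<epsilon>) * exp (- c / t) / t\<^sup>2)) \<partial>lborel)"
  proof (rule nn_integral_mono)
    fix t :: real
    show "ennreal (exp (- 1) * exp (- 2 * \<epsilon> * c) / (4 * c\<^sup>2)) * indicator {c..2 * c} t
      \<le> ennreal (indicator {0<..} t * (exp (- t * \<epsilon>) * exp (- c / t) / t\<^sup>2))"
    proof (cases "t \<in> {c..2*c}")
      case True
      hence t: "t > 0" "t \<ge> c" "t \<le> 2 * c" using c by auto
      have "t\<^sup>2 \<le> (2 * c)\<^sup>2" using t by (intro power_mono) auto
      moreover have "t * \<epsilon> \<le> 2 * \<epsilon> * c" using mult_right_mono[OF t(3) eps] by (simp add: mult_ac)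
      ultimately
      have "exp (- 1) * exp (- 2 * \<epsilon> * c) / (4 * c\<^sup>2) \<le> exp (- c / t) * exp (- t * \<epsilon>) / t\<^sup>2"
        using t c eps by (intro frac_le mult_mono) (auto simp: power_mult_distrib mult_right_mono)
      thus ?thesis using t True by (auto intro!: ennreal_leI simp: mult.commute)
    qed auto
  qed
  finally show ?thesis .
qed

text \<open>In the plane the Gaussian normalisation is 1 / (4 pi t); with the 1 / t of the formula
  for the logarithm this produces the weight of \<open>bessel_weight_lower_bound\<close> at c =
  |\<xi>|^2 / 4. The constant combines 4 pi from the normalisation with exp 1 from that lower bound.
  The case \<open>\<epsilon> = 0\<close> serves differences of densities.\<close>

theorem energy_log_lower_bound:
  fixes \<sigma> :: "(real^2) signed_measure"
  assumes \<sigma>: "finite_borel \<sigma>" and mass: "total_mass \<sigma> = 0" and eps: "\<epsilon> \<ge> 0"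
    and pos: "\<And>\<mu> \<nu>. \<mu> \<in> snd ` set \<sigma> \<Longrightarrow> \<nu> \<in> snd ` set \<sigma> \<Longrightarrow>
      AE z in \<mu> \<Otimes>\<^sub>M \<nu>. 0 < (norm (fst z - snd z))\<^sup>2 + \<epsilon>"
    and int: "pairs_integrable (\<lambda>x. ln ((norm x)\<^sup>2 + \<epsilon>)) \<sigma>"
  defines "E \<equiv> energy (\<lambda>x. - ln ((norm x)\<^sup>2 + \<epsilon>)) \<sigma>"
  shows "0 \<le> E" "(\<integral>\<^sup>+\<xi>. ennreal (exp (- \<epsilon> * (norm \<xi>)\<^sup>2 / 2) * (cmod (fourier \<sigma> \<xi>))\<^sup>2 / (norm \<xi>)\<^sup>2) \<partial>lborel)
    \<le> ennreal (4 * pi * exp 1 * E)"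
proof -
  note [measurable] = borel_measurable_fourier[OF \<sigma>]
  define e where "e t = energy (\<lambda>x::real^2. exp (- t * (norm x)\<^sup>2)) \<sigma>" for t
  have e: "e t = 1 / (4 * pi * t) * (\<integral>\<xi>. exp (- (norm \<xi>)\<^sup>2 / (4 * t)) * (cmod (fourier \<sigma> \<xi>))\<^sup>2 \<partial>lborel)" if "t > 0" for t
    using energy_gauss(2)[OF that \<sigma>] that by (simp add: e_def real_sqrt_mult[symmetric] power_mult_distrib)
  define h where "h t = indicator {0<..} t * (exp (- t * \<epsilon>) * e t / t)" for t
  have h0: "h t \<ge> 0" for t
    unfolding h_def by (cases "t > 0") (auto simp: e)
  have h: "integrable lborel h" "(\<integral>t. h t \<partial>lborel) = E"
    using energy_log_frullani[OF \<sigma> mass eps pos int] unfolding h_def e_def E_def by auto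
  show "0 \<le> E" unfolding h(2)[symmetric] by (intro integral_nonneg_AE) (simp add: h0)
  define w where "w \<xi> t = indicator {0<..} t * (exp (- t * \<epsilon>) * exp (- ((norm \<xi>)\<^sup>2 / 4) / t) / t\<^sup>2)" for \<xi> :: "real^2" and t
  have [measurable]: "(\<lambda>(\<xi>, t). w \<xi> t) \<in> borel_measurable (borel \<Otimes>\<^sub>M borel)" unfolding w_def by measurable
  have hn: "ennreal (4 * pi * h t) = (\<integral>\<^sup>+\<xi>. ennreal ((cmod (fourier \<sigma> \<xi>))\<^sup>2) * ennreal (w \<xi> t) \<partial>lborel)" for t
  proof (cases "t > 0")
    case True
    define I where "I = (\<integral>\<xi>. exp (- (norm \<xi>)\<^sup>2 / (4 * t)) * (cmod (fourier \<sigma> \<xi>))\<^sup>2 \<partial>lborel)"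
    have "(\<integral>\<^sup>+\<xi>. ennreal ((cmod (fourier \<sigma> \<xi>))\<^sup>2) * ennreal (w \<xi> t) \<partial>lborel) =
       (\<integral>\<^sup>+\<xi>. ennreal (exp (- t * \<epsilon>) / t\<^sup>2) * ennreal (exp (- (norm \<xi>)\<^sup>2 / (4 * t)) * (cmod (fourier \<sigma> \<xi>))\<^sup>2) \<partial>lborel)"
      using True by (intro nn_integral_cong) (simp add: ennreal_mult[symmetric] w_def mult_ac)
    also have "\<dots> = ennreal (exp (- t * \<epsilon>) / t\<^sup>2) * ennreal I"
      unfolding I_def using energy_gauss(1)[OF True \<sigma>]
      by (subst nn_integral_cmult) (auto simp: nn_integral_eq_integral)
    also have "\<dots> = ennreal (exp (- t * \<epsilon>) / t\<^sup>2 * I)"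
      using ennreal_mult'[of I "exp (- t * \<epsilon>) / t\<^sup>2"] by (simp add: I_def mult.commute)
    also have "exp (- t * \<epsilon>) / t\<^sup>2 * I = 4 * pi * h t"
      using True e[OF True] by (simp add: h_def I_def power2_eq_square)
    finally show ?thesis ..
  qed (simp add: h_def w_def)
  have "(\<integral>\<^sup>+\<xi>. ennreal (exp (- \<epsilon> * (norm \<xi>)\<^sup>2 / 2) * (cmod (fourier \<sigma> \<xi>))\<^sup>2 / (norm \<xi>)\<^sup>2) \<partial>lborel)
     \<le> (\<integral>\<^sup>+\<xi>. ennreal (exp 1) * (ennreal ((cmod (fourier \<sigma> \<xi>))\<^sup>2) * (\<integral>\<^sup>+t. ennreal (w \<xi> t) \<partial>lborel)) \<partial>lborel)"
  proof (rule nn_integral_mono)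
    fix \<xi> :: "real^2"
    show "ennreal (exp (- \<epsilon> * (norm \<xi>)\<^sup>2 / 2) * (cmod (fourier \<sigma> \<xi>))\<^sup>2 / (norm \<xi>)\<^sup>2)
       \<le> ennreal (exp 1) * (ennreal ((cmod (fourier \<sigma> \<xi>))\<^sup>2) * (\<integral>\<^sup>+t. ennreal (w \<xi> t) \<partial>lborel))"
    \<comment> \<open>At the origin the left side is 0, because division by zero gives 0.\<close>
    proof (cases "\<xi> = 0")
      case False
      define c where "c = (norm \<xi>)\<^sup>2 / 4"
      have c: "c > 0" "(norm \<xi>)\<^sup>2 = 4 * c" using False by (auto simp: c_def)
      have "ennreal (exp (- \<epsilon> * (norm \<xi>)\<^sup>2 / 2) * (cmod (fourier \<sigma> \<xi>))\<^sup>2 / (norm \<xi>)\<^sup>2)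
         = ennreal (exp 1) * (ennreal ((cmod (fourier \<sigma> \<xi>))\<^sup>2) * ennreal (exp (- 1) * exp (- 2 * \<epsilon> * c) / (4 * c)))"
        using c by (simp add: ennreal_mult[symmetric] exp_minus field_simps)
      also have "\<dots> \<le> ennreal (exp 1) * (ennreal ((cmod (fourier \<sigma> \<xi>))\<^sup>2) * (\<integral>\<^sup>+t. ennreal (w \<xi> t) \<partial>lborel))"
        unfolding w_def c_def[symmetric]
        by (intro mult_left_mono bessel_weight_lower_bound c eps) auto
      finally show ?thesis .
    qed simp
  qed
  also have "\<dots> = ennreal (exp 1) * (\<integral>\<^sup>+\<xi>. (\<integral>\<^sup>+t. ennreal ((cmod (fourier \<sigma> \<xi>))\<^sup>2) * ennreal (w \<xi> t) \<partial>lborel) \<partial>lborel)"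
    by (simp add: nn_integral_cmult)
  also have "(\<integral>\<^sup>+\<xi>. (\<integral>\<^sup>+t. ennreal ((cmod (fourier \<sigma> \<xi>))\<^sup>2) * ennreal (w \<xi> t) \<partial>lborel) \<partial>lborel)
     = (\<integral>\<^sup>+t. (\<integral>\<^sup>+\<xi>. ennreal ((cmod (fourier \<sigma> \<xi>))\<^sup>2) * ennreal (w \<xi> t) \<partial>lborel) \<partial>lborel)"
    by (rule lborel_pair.Fubini') simp
  also have "\<dots> = (\<integral>\<^sup>+t. ennreal (4 * pi * h t) \<partial>lborel)"
    unfolding hn ..
  also have "\<dots> = ennreal (4 * pi * E)"
    using h h0 by (subst nn_integral_eq_integral) auto
  also have "ennreal (exp 1) * \<dots> = ennreal (4 * pi * exp 1 * E)"
    using \<open>0 \<le> E\<close> by (simp add: ennreal_mult[symmetric] mult_ac)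
  finally show "(\<integral>\<^sup>+\<xi>. ennreal (exp (- \<epsilon> * (norm \<xi>)\<^sup>2 / 2) * (cmod (fourier \<sigma> \<xi>))\<^sup>2 / (norm \<xi>)\<^sup>2) \<partial>lborel)
    \<le> ennreal (4 * pi * exp 1 * E)" .
qed

section \<open>Pairing with Lipschitz functions\<close>

lemma lborel_distr_reflect:
  fixes t :: "'a::euclidean_space"
  shows "distr lborel borel (\<lambda>x. t - x) = lborel"
  by (subst (2) lborel_affine[of "-1" t]) (auto simp: density_1)

lemma lborel_distr_translate:
  fixes t :: "'a::euclidean_space"
  shows "distr lborel borel (\<lambda>x. x + t) = lborel"
  by (subst (2) lborel_affine[of 1 t]) (auto simp: density_1 add.commute)

lemma integrable_continuous_bounded_support:
  fixes f :: "'a::euclidean_space \<Rightarrow> real"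
  assumes f: "continuous_on UNIV f" and supp: "\<And>x. x \<notin> cball 0 R \<Longrightarrow> f x = 0"
  shows "integrable lborel f"
proof -
  have "set_integrable lborel (cball 0 R) f"
    unfolding set_integrable_def by (intro borel_integrable_compact continuous_on_subset[OF f]) auto
  moreover have "(\<lambda>x. indicator (cball 0 R) x *\<^sub>R f x) = f"
    using supp by (auto simp: fun_eq_iff indicator_def)
  ultimately show ?thesis unfolding set_integrable_def by simp
qed

lemma fourier_translate:
  fixes f :: "'a::euclidean_space \<Rightarrow> real"
  assumes [measurable]: "f \<in> borel_measurable borel"
  shows "(\<integral>x. f (x + h) *\<^sub>R cis (- (x \<bullet> \<xi>)) \<partial>lborel) = cis (h \<bullet> \<xi>) * (\<integral>x. f x *\<^sub>R cis (- (x \<bullet> \<xi>)) \<partial>lborel)"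
proof -
  have "(\<integral>x. f x *\<^sub>R cis (- (x \<bullet> \<xi>)) \<partial>lborel) = (\<integral>x. f x *\<^sub>R cis (- (x \<bullet> \<xi>)) \<partial>distr lborel borel (\<lambda>x. x + h))"
    unfolding lborel_distr_translate ..
  also have "\<dots> = (\<integral>x. f (x + h) *\<^sub>R cis (- ((x + h) \<bullet> \<xi>)) \<partial>lborel)"
    by (rule integral_distr) measurable
  also have "\<dots> = (\<integral>x. cis (- (h \<bullet> \<xi>)) * (f (x + h) *\<^sub>R cis (- (x \<bullet> \<xi>))) \<partial>lborel)"
    by (intro Bochner_Integration.integral_cong) (auto simp: cis_mult inner_add_left add.commute)
  also have "\<dots> = cis (- (h \<bullet> \<xi>)) * (\<integral>x. f (x + h) *\<^sub>R cis (- (x \<bullet> \<xi>)) \<partial>lborel)"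
    by (rule Bochner_Integration.integral_mult_right_zero)
  finally show ?thesis by (simp add: mult.assoc[symmetric] cis_mult)
qed

text \<open>A Schur-type estimate: one factor is bounded by \<open>L\<close>, and the Gaussian is
  integrated in that variable. The power of pi / t is the one that cancels the normalisation in
  \<open>gaussian_pairing\<close>, so the resulting Fourier bound is uniform in
  \<open>t\<close>.\<close>

lemma gaussian_pairing_bound:
  fixes D :: "'a::euclidean_space \<Rightarrow> real"
  assumes t: "t > 0" and D: "integrable lborel D" "\<And>x. \<bar>D x\<bar> \<le> L"
  shows "(\<integral>z. D (fst z) * D (snd z) * exp (- t * (norm (fst z - snd z))\<^sup>2) \<partial>(lborel \<Otimes>\<^sub>M lborel))
    \<le> L * sqrt (pi / t) ^ DIM('a) * (\<integral>x. \<bar>D x\<bar> \<partial>lborel)"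
proof -
  have [measurable]: "D \<in> borel_measurable borel" using D by auto
  have L: "L \<ge> 0" using D(2)[of undefined] by linarith
  have g: "(\<integral>\<^sup>+y. ennreal (exp (- t * (norm (x - y))\<^sup>2)) \<partial>lborel) = ennreal (sqrt (pi / t) ^ DIM('a))" for x :: 'a
  proof -
    have "(\<integral>\<^sup>+y. ennreal (exp (- t * (norm (x - y))\<^sup>2)) \<partial>lborel)
      = (\<integral>\<^sup>+y. ennreal (exp (- t * (norm y)\<^sup>2)) \<partial>distr lborel borel (\<lambda>y. x - y))"
      by (subst nn_integral_distr) auto
    also have "\<dots> = ennreal (sqrt (pi / t) ^ DIM('a))"
      unfolding lborel_distr_reflect using gaussian_integral[OF t, where 'a='a]
      by (subst nn_integral_eq_integral) auto
    finally show ?thesis .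
  qed
  have "ennreal \<bar>\<integral>z. D (fst z) * D (snd z) * exp (- t * (norm (fst z - snd z))\<^sup>2) \<partial>(lborel \<Otimes>\<^sub>M lborel)\<bar>
     \<le> (\<integral>\<^sup>+z. ennreal (norm (D (fst z) * D (snd z) * exp (- t * (norm (fst z - snd z))\<^sup>2))) \<partial>(lborel \<Otimes>\<^sub>M lborel))"
    unfolding real_norm_def[symmetric]
    by (rule integral_norm_bound_ennreal, rule gaussian_pairing(2)[OF t]) (auto intro: D lborel.sigma_finite_measure_axioms)
  also have "\<dots> \<le> (\<integral>\<^sup>+z. ennreal (L * \<bar>D (fst z)\<bar>) * ennreal (exp (- t * (norm (fst z - snd z))\<^sup>2)) \<partial>(lborel \<Otimes>\<^sub>M lborel))"
  proof (rule nn_integral_mono)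
    fix z :: "'a \<times> 'a"
    have "\<bar>D (fst z)\<bar> * \<bar>D (snd z)\<bar> \<le> \<bar>D (fst z)\<bar> * L" by (intro mult_left_mono D) auto
    thus "ennreal (norm (D (fst z) * D (snd z) * exp (- t * (norm (fst z - snd z))\<^sup>2)))
      \<le> ennreal (L * \<bar>D (fst z)\<bar>) * ennreal (exp (- t * (norm (fst z - snd z))\<^sup>2))"
      using L by (subst ennreal_mult[symmetric]) (auto simp: abs_mult mult.commute[of L] intro!: ennreal_leI mult_right_mono)
  qed
  also have "\<dots> = (\<integral>\<^sup>+x. ennreal (L * \<bar>D x\<bar>) * (\<integral>\<^sup>+y. ennreal (exp (- t * (norm (x - y))\<^sup>2)) \<partial>lborel) \<partial>lborel)"
    by (subst lborel.nn_integral_fst[symmetric]) (auto simp: nn_integral_cmult)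
  also have "\<dots> = (\<integral>\<^sup>+x. ennreal (L * sqrt (pi / t) ^ DIM('a) * \<bar>D x\<bar>) \<partial>lborel)"
    unfolding g using L t by (intro nn_integral_cong) (subst ennreal_mult[symmetric], auto simp: mult_ac)
  also have "\<dots> = ennreal (L * sqrt (pi / t) ^ DIM('a) * (\<integral>x. \<bar>D x\<bar> \<partial>lborel))"
    using D(1) L t by (subst nn_integral_eq_integral) auto
  finally show ?thesis using L t
    by (subst (asm) ennreal_le_iff) auto
qed

text \<open>One inequality of Plancherel for the gradient, obtained without differentiating
  \<open>f\<close>. Difference quotients with step 1 / t are bounded by \<open>L\<close>, and on the
  Fourier side they multiply by t (cis (\<xi> \<bullet> b / t) - 1). A Gaussian weight makes their
  L2 bound accessible uniformly in t, and Fatou's lemma passes to the limit.\<close>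

lemma lipschitz_fourier_gradient:
  fixes f :: "'a::euclidean_space \<Rightarrow> real"
  assumes f: "L-lipschitz_on UNIV f" and supp: "\<And>x. x \<notin> cball 0 R \<Longrightarrow> f x = 0" and b: "b \<in> Basis"
  shows "(\<integral>\<^sup>+\<xi>. ennreal ((\<xi> \<bullet> b)\<^sup>2 * (cmod (\<integral>x. f x *\<^sub>R cis (- (x \<bullet> \<xi>)) \<partial>lborel))\<^sup>2) \<partial>lborel)
    \<le> ennreal ((2 * pi) ^ DIM('a) * L\<^sup>2 * measure lborel (cball (0::'a) (R + 1)))"
proof -
  define B where "B = (2 * pi) ^ DIM('a) * L\<^sup>2 * measure lborel (cball (0::'a) (R + 1))"
  define F where "F \<xi> = (\<integral>x. f x *\<^sub>R cis (- (x \<bullet> \<xi>)) \<partial>lborel)" for \<xi>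
  have fc: "continuous_on UNIV f" using f by (rule lipschitz_on_continuous_on)
  have [measurable]: "f \<in> borel_measurable borel" using fc by (rule borel_measurable_continuous_onI)
  have [measurable]: "F \<in> borel_measurable borel" unfolding F_def by measurable
  have fi: "integrable lborel f" by (rule integrable_continuous_bounded_support[OF fc supp])
  have L: "L \<ge> 0" using f by (rule lipschitz_on_nonneg)
  \<comment> \<open>The same parameter governs the difference step and the Gaussian width, so a
    single limit turns the multiplier into the coordinate of \<xi> and removes the weight.\<close>
  define u where "u n \<xi> = exp (- (norm \<xi>)\<^sup>2 / (4 * real (Suc n))) * ((real (Suc n))\<^sup>2 * (2 - 2 * cos (\<xi> \<bullet> b / real (Suc n))) * (cmod (F \<xi>))\<^sup>2)" for n \<xi>
  have bound: "(\<integral>\<^sup>+\<xi>. ennreal (u n \<xi>) \<partial>lborel) \<le> ennreal B" for n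
  proof -
    define t where "t = real (Suc n)"
    have t: "t > 0" "t \<ge> 1" by (auto simp: t_def)
    define D where "D x = t * (f (x + b /\<^sub>R t) - f x)" for x
    have fs: "integrable lborel (\<lambda>x. f (x + b /\<^sub>R t))"
      using integrable_distr[of "\<lambda>x. x + b /\<^sub>R t" lborel borel f] fi by (simp add: lborel_distr_translate)
    hence Di: "integrable lborel D" unfolding D_def using fi by (intro integrable_mult_right Bochner_Integration.integrable_diff)
    have nb: "norm (b /\<^sub>R t) = 1 / t" using b t by (simp add: divide_inverse)
    have DL: "\<bar>D x\<bar> \<le> L" for x
    proof -
      have "\<bar>f (x + b /\<^sub>R t) - f x\<bar> \<le> L * norm ((x + b /\<^sub>R t) - x)"
        using lipschitz_on_normD[OF f, of "x + b /\<^sub>R t" x] by (simp only: real_norm_def) simp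
      hence "t * \<bar>f (x + b /\<^sub>R t) - f x\<bar> \<le> t * (L * (1 / t))" using t nb by (intro mult_left_mono) simp_all
      thus ?thesis using t by (simp only: D_def abs_mult) simp
    qed
    \<comment> \<open>The translation has length 1 / t, at most 1, which explains the radius R +
      1.\<close>
    have Ds: "D x = 0" if "x \<notin> cball 0 (R + 1)" for x
    proof -
      have "norm x \<le> norm (x + b /\<^sub>R t) + norm (b /\<^sub>R t)" using norm_triangle_ineq4[of "x + b /\<^sub>R t" "b /\<^sub>R t"] by simp
      moreover have "1 / t \<le> 1" using t by simp
      ultimately have "norm (x + b /\<^sub>R t) > R" "norm x > R" using that nb by auto
      thus ?thesis using supp by (simp add: D_def)
    qed
    have "(\<integral>x. \<bar>D x\<bar> \<partial>lborel) \<le> (\<integral>x. L * indicator (cball (0::'a) (R + 1)) x \<partial>lborel)"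
    proof (rule Bochner_Integration.integral_mono)
      show "integrable lborel (\<lambda>x. L * indicator (cball (0::'a) (R + 1)) x)"
        by (intro integrable_mult_right integrable_real_indicator) (use emeasure_bounded_finite[OF bounded_cball, of "0::'a" "R + 1"] in auto)
      show "\<bar>D x\<bar> \<le> L * indicator (cball 0 (R + 1)) x" for x
        using DL[of x] Ds[of x] by (auto simp: indicator_def)
    qed (use Di in simp)
    hence Dn: "(\<integral>x. \<bar>D x\<bar> \<partial>lborel) \<le> L * measure lborel (cball (0::'a) (R + 1))" by simp
    have FD: "(\<integral>x. D x *\<^sub>R cis (- (x \<bullet> \<xi>)) \<partial>lborel) = of_real t * (cis (\<xi> \<bullet> b / t) - 1) * F \<xi>" for \<xi>
    proof -
      have "integrable lborel (\<lambda>x. f (x + b /\<^sub>R t) *\<^sub>R cis (- (x \<bullet> \<xi>)))" "integrable lborel (\<lambda>x. f x *\<^sub>R cis (- (x \<bullet> \<xi>)))"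
        using fs fi by (auto intro: Bochner_Integration.integrable_bound)
      hence "(\<integral>x. of_real t * (f (x + b /\<^sub>R t) *\<^sub>R cis (- (x \<bullet> \<xi>)) - f x *\<^sub>R cis (- (x \<bullet> \<xi>))) \<partial>lborel) = of_real t *
         ((\<integral>x. f (x + b /\<^sub>R t) *\<^sub>R cis (- (x \<bullet> \<xi>)) \<partial>lborel) - F \<xi>)"
        unfolding F_def Bochner_Integration.integral_mult_right_zero
        by (subst Bochner_Integration.integral_diff) simp_all
      moreover have "D x *\<^sub>R cis (- (x \<bullet> \<xi>)) = of_real t * (f (x + b /\<^sub>R t) *\<^sub>R cis (- (x \<bullet> \<xi>)) - f x *\<^sub>R cis (- (x \<bullet> \<xi>)))" for x
        unfolding D_def by (simp add: scaleR_conv_of_real left_diff_distrib)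
      ultimately have "(\<integral>x. D x *\<^sub>R cis (- (x \<bullet> \<xi>)) \<partial>lborel) = of_real t *
         ((\<integral>x. f (x + b /\<^sub>R t) *\<^sub>R cis (- (x \<bullet> \<xi>)) \<partial>lborel) - F \<xi>)" by simp
      thus ?thesis unfolding fourier_translate[OF \<open>f \<in> borel_measurable borel\<close>] F_def[symmetric]
        by (simp add: algebra_simps inner_commute divide_inverse)
    qed
    have cn: "(cmod (\<integral>x. D x *\<^sub>R cis (- (x \<bullet> \<xi>)) \<partial>lborel))\<^sup>2 = t\<^sup>2 * (2 - 2 * cos (\<xi> \<bullet> b / t)) * (cmod (F \<xi>))\<^sup>2" for \<xi>
    proof -
      have "(cmod (cis \<theta> - 1))\<^sup>2 = 2 - 2 * cos \<theta>" for \<theta>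
      proof -
        have "(cmod (cis \<theta> - 1))\<^sup>2 = (cos \<theta> - 1)\<^sup>2 + (sin \<theta>)\<^sup>2" by (simp add: cmod_power2)
        also have "\<dots> = (sin \<theta>)\<^sup>2 + (cos \<theta>)\<^sup>2 + 1 - 2 * cos \<theta>" by (simp add: power2_eq_square algebra_simps)
        finally show ?thesis by simp
      qed
      thus ?thesis unfolding FD norm_mult power_mult_distrib using t by simp
    qed
    define h where "h \<xi> = exp (- (norm \<xi>)\<^sup>2 / (4 * t)) *\<^sub>R
      ((\<integral>x. D x *\<^sub>R cis (- (x \<bullet> \<xi>)) \<partial>lborel) * cnj (\<integral>x. D x *\<^sub>R cis (- (x \<bullet> \<xi>)) \<partial>lborel))" for \<xi>
    note gp = gaussian_pairing[OF t(1) lborel.sigma_finite_measure_axioms lborel.sigma_finite_measure_axioms sets_lborel sets_lborel Di Di, folded h_def]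
    have hu: "h \<xi> = of_real (u n \<xi>)" for \<xi>
      unfolding h_def complex_norm_square[symmetric] cn u_def t_def[symmetric] by (simp add: scaleR_conv_of_real)
    have ui: "integrable lborel (u n)"
      using integrable_Re[OF gp(1)] unfolding hu by simp
    have "(\<integral>\<xi>. u n \<xi> \<partial>lborel) = sqrt (4 * pi * t) ^ DIM('a) *
        (\<integral>z. D (fst z) * D (snd z) * exp (- t * (norm (fst z - snd z))\<^sup>2) \<partial>(lborel \<Otimes>\<^sub>M lborel))"
      using gp(3) unfolding hu integral_complex_of_real of_real_eq_iff .
    also have "\<dots> \<le> sqrt (4 * pi * t) ^ DIM('a) * (L * sqrt (pi / t) ^ DIM('a) * (\<integral>x. \<bar>D x\<bar> \<partial>lborel))"
      using t by (intro mult_left_mono gaussian_pairing_bound Di DL) auto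
    also have "\<dots> \<le> sqrt (4 * pi * t) ^ DIM('a) * (L * sqrt (pi / t) ^ DIM('a) * (L * measure lborel (cball (0::'a) (R + 1))))"
      using t L by (intro mult_left_mono Dn) auto
    also have "\<dots> = (sqrt (4 * pi * t) * sqrt (pi / t)) ^ DIM('a) * L\<^sup>2 * measure lborel (cball (0::'a) (R + 1))"
      by (simp add: power_mult_distrib power2_eq_square)
    also have "sqrt (4 * pi * t) * sqrt (pi / t) = sqrt ((2 * pi)\<^sup>2)"
      using t by (simp add: real_sqrt_mult[symmetric] power2_eq_square)
    also have "\<dots> = 2 * pi" by (subst real_sqrt_abs) simp
    finally have "(\<integral>\<xi>. u n \<xi> \<partial>lborel) \<le> B" unfolding B_def .
    moreover have "u n \<xi> \<ge> 0" for \<xi> unfolding u_def by (intro mult_nonneg_nonneg) auto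
    ultimately show ?thesis using ui by (simp add: nn_integral_eq_integral ennreal_leI)
  qed
  have lim: "(\<lambda>n. ennreal (u n \<xi>)) \<longlonglongrightarrow> ennreal ((\<xi> \<bullet> b)\<^sup>2 * (cmod (F \<xi>))\<^sup>2)" for \<xi>
  proof -
    have 1: "(\<lambda>n. (real (Suc n))\<^sup>2 * (2 - 2 * cos (s / real (Suc n)))) \<longlonglongrightarrow> s\<^sup>2" for s
      by real_asymp (simp add: power2_eq_square)
    have 2: "(\<lambda>n. exp (- (norm \<xi>)\<^sup>2 / (4 * real (Suc n)))) \<longlonglongrightarrow> 1"
      by real_asymp
    have "(\<lambda>n. u n \<xi>) \<longlonglongrightarrow> 1 * ((\<xi> \<bullet> b)\<^sup>2 * (cmod (F \<xi>))\<^sup>2)"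
      unfolding u_def by (intro tendsto_mult 1 2 tendsto_const)
    thus ?thesis by (intro tendsto_ennrealI) simp
  qed
  have "(\<integral>\<^sup>+\<xi>. ennreal ((\<xi> \<bullet> b)\<^sup>2 * (cmod (F \<xi>))\<^sup>2) \<partial>lborel) = (\<integral>\<^sup>+\<xi>. liminf (\<lambda>n. ennreal (u n \<xi>)) \<partial>lborel)"
    using lim_imp_Liminf[OF _ lim] by simp
  also have "\<dots> \<le> liminf (\<lambda>n. \<integral>\<^sup>+\<xi>. ennreal (u n \<xi>) \<partial>lborel)"
    by (rule nn_integral_liminf) (simp add: u_def)
  also have "\<dots> \<le> ennreal B"
    by (rule order_trans[OF Liminf_le_Limsup Limsup_bounded]) (auto simp: bound)
  finally show ?thesis unfolding F_def B_def .
qed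

definition pairing :: "'a::euclidean_space signed_measure \<Rightarrow> ('a \<Rightarrow> real) \<Rightarrow> real" where
  "pairing \<sigma> f = (\<Sum>(a, \<mu>)\<leftarrow>\<sigma>. a * (\<integral>x. f x \<partial>\<mu>))"

definition abs_mass :: "'a::euclidean_space signed_measure \<Rightarrow> real" where
  "abs_mass \<sigma> = (\<Sum>(a, \<mu>)\<leftarrow>\<sigma>. \<bar>a\<bar> * measure \<mu> (space \<mu>))"

lemma pairing_bounded:
  assumes \<sigma>: "finite_borel \<sigma>" and f: "f \<in> borel_measurable borel" "\<And>x. \<bar>f x\<bar> \<le> c"
  shows "\<bar>pairing \<sigma> f\<bar> \<le> c * abs_mass \<sigma>"
  using \<sigma> unfolding pairing_def abs_mass_def
proof (induction \<sigma>)
  case (Cons p \<sigma>)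
  obtain a \<mu> where p: "p = (a, \<mu>)" by fastforce
  have m: "finite_measure \<mu>" "sets \<mu> = sets borel" using Cons.prems by (auto simp: p finite_borel_def)
  interpret finite_measure \<mu> by fact
  note [measurable_cong] = m(2)
  note [measurable] = f(1)
  have "\<bar>\<integral>x. f x \<partial>\<mu>\<bar> \<le> (\<integral>x. \<bar>f x\<bar> \<partial>\<mu>)" by (rule integral_abs_bound)
  also have "\<dots> \<le> (\<integral>x. c \<partial>\<mu>)"
    using f(2) order_trans[OF abs_ge_zero f(2)] by (intro integral_mono integrable_const_bound[where B = c]) auto
  finally have "\<bar>a * (\<integral>x. f x \<partial>\<mu>)\<bar> \<le> \<bar>a\<bar> * (c * measure \<mu> (space \<mu>))"
    unfolding abs_mult by (intro mult_left_mono) (auto simp: mult.commute)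
  moreover have "\<bar>\<Sum>(a, \<mu>)\<leftarrow>\<sigma>. a * (\<integral>x. f x \<partial>\<mu>)\<bar> \<le> c * (\<Sum>(a, \<mu>)\<leftarrow>\<sigma>. \<bar>a\<bar> * measure \<mu> (space \<mu>))"
    using Cons by (auto simp: finite_borel_def)
  ultimately show ?case by (simp add: p algebra_simps)
qed simp

lemma pairing_diff:
  assumes \<sigma>: "finite_borel \<sigma>" and f: "f \<in> borel_measurable borel" "\<And>x. \<bar>f x\<bar> \<le> c"
    and g: "g \<in> borel_measurable borel" "\<And>x. \<bar>g x\<bar> \<le> d"
  shows "pairing \<sigma> (\<lambda>x. f x - g x) = pairing \<sigma> f - pairing \<sigma> g"
  using \<sigma> unfolding pairing_def
proof (induction \<sigma>)
  case (Cons p \<sigma>)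
  obtain a \<mu> where p: "p = (a, \<mu>)" by fastforce
  have m: "finite_measure \<mu>" "sets \<mu> = sets borel" using Cons.prems by (auto simp: p finite_borel_def)
  interpret finite_measure \<mu> by fact
  note [measurable_cong] = m(2)
  note [measurable] = f(1) g(1)
  have "integrable \<mu> f" "integrable \<mu> g"
    using f(2) g(2) by (auto intro: integrable_const_bound[where B = c] integrable_const_bound[where B = d])
  thus ?case using Cons by (simp add: p finite_borel_def algebra_simps)
qed simp

text \<open>Convolution with the normalised Gaussian, that is, the heat semigroup at time 1 / (4 s).
  Its Fourier multiplier is exp (- |\<xi>|^2 / (4 s)).\<close>

definition heat_average :: "real \<Rightarrow> ('a::euclidean_space \<Rightarrow> real) \<Rightarrow> 'a \<Rightarrow> real" where
  "heat_average s f x = (\<integral>y. f y * exp (- s * (norm (x - y))\<^sup>2) \<partial>lborel) / sqrt (pi / s) ^ DIM('a)"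

lemma heat_average_close:
  fixes f :: "real^2 \<Rightarrow> real"
  assumes s: "s > 0" and f: "L-lipschitz_on UNIV f" "integrable lborel f"
  shows "\<bar>f x - heat_average s f x\<bar> \<le> 2 * L / sqrt s"
proof -
  have fc: "continuous_on UNIV f" using f(1) by (rule lipschitz_on_continuous_on)
  have [measurable]: "f \<in> borel_measurable borel" using fc by (rule borel_measurable_continuous_onI)
  have L: "L \<ge> 0" using f(1) by (rule lipschitz_on_nonneg)
  have g: "integrable lborel (\<lambda>y. exp (- t * (norm (x - y))\<^sup>2))"
     "(\<integral>y. exp (- t * (norm (x - y))\<^sup>2) \<partial>lborel) = pi / t" if t: "t > 0" for t
  proof -
    have "integrable (distr lborel borel (\<lambda>y. x - y)) (\<lambda>y. exp (- t * (norm y)\<^sup>2))"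
      unfolding lborel_distr_reflect by (rule gaussian_integral t)+
    thus "integrable lborel (\<lambda>y. exp (- t * (norm (x - y))\<^sup>2))" by (subst (asm) integrable_distr_eq) auto
    have "(\<integral>y. exp (- t * (norm y)\<^sup>2) \<partial>distr lborel borel (\<lambda>y. x - y)) = pi / t"
      unfolding lborel_distr_reflect using gaussian_integral(2)[OF t, where 'a = "real^2"] t by simp
    thus "(\<integral>y. exp (- t * (norm (x - y))\<^sup>2) \<partial>lborel) = pi / t" by (subst (asm) integral_distr) auto
  qed
  have fi: "integrable lborel (\<lambda>y. f y * exp (- s * (norm (x - y))\<^sup>2))"
    using f(2) by (rule Bochner_Integration.integrable_bound) (use s in \<open>auto simp: abs_mult intro!: mult_left_le\<close>)
  have pt: "\<bar>(f x - f y) * exp (- s * (norm (x - y))\<^sup>2)\<bar> \<le> L / sqrt s * exp (- (s / 2) * (norm (x - y))\<^sup>2)" for y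
  proof -
    define r where "r = norm (x - y)"
    have 1: "\<bar>f x - f y\<bar> \<le> L * r" using lipschitz_on_normD[OF f(1), of x y] by (simp add: r_def)
    \<comment> \<open>The linear factor r is paid for with half of the Gaussian exponent. The
      Gaussian that remains has parameter s / 2 and mass 2 pi / s, whence the factor 2 in the
      bound.\<close>
    have "sqrt s * r \<le> 1 + (s * r\<^sup>2) / 2"
    proof -
      have "0 \<le> (sqrt s * r - 1)\<^sup>2" by simp
      thus ?thesis using s by (simp add: power2_diff power_mult_distrib)
    qed
    also have "\<dots> \<le> exp (s * r\<^sup>2 / 2)" by (rule exp_ge_add_one_self)
    finally have "r \<le> exp (s * r\<^sup>2 / 2) / sqrt s" using s by (simp add: field_simps)
    hence "L * r * exp (- s * r\<^sup>2) \<le> L * (exp (s * r\<^sup>2 / 2) / sqrt s) * exp (- s * r\<^sup>2)"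
      using L by (intro mult_left_mono mult_right_mono) auto
    also have "\<dots> = L / sqrt s * exp (s * r\<^sup>2 / 2 + - s * r\<^sup>2)" unfolding exp_add by simp
    also have "s * r\<^sup>2 / 2 + - s * r\<^sup>2 = - (s / 2) * r\<^sup>2" by (simp add: field_simps)
    finally have "L * r * exp (- s * r\<^sup>2) \<le> L / sqrt s * exp (- (s / 2) * r\<^sup>2)" .
    moreover have "\<bar>f x - f y\<bar> * exp (- s * r\<^sup>2) \<le> L * r * exp (- s * r\<^sup>2)" using 1 by (intro mult_right_mono) auto
    ultimately have "\<bar>f x - f y\<bar> * exp (- s * r\<^sup>2) \<le> L / sqrt s * exp (- (s / 2) * r\<^sup>2)" by linarith
    thus ?thesis by (simp only: abs_mult r_def abs_exp_cancel)
  qed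
  have "f x - heat_average s f x = (s / pi) * (\<integral>y. (f x - f y) * exp (- s * (norm (x - y))\<^sup>2) \<partial>lborel)"
  proof -
    have "(\<integral>y. (f x - f y) * exp (- s * (norm (x - y))\<^sup>2) \<partial>lborel) =
      f x * (pi / s) - (\<integral>y. f y * exp (- s * (norm (x - y))\<^sup>2) \<partial>lborel)"
      unfolding left_diff_distrib using fi g[OF s]
      by (subst Bochner_Integration.integral_diff) (auto intro!: integrable_mult_right)
    thus ?thesis using s by (simp add: heat_average_def field_simps)
  qed
  also have "\<bar>\<dots>\<bar> \<le> (s / pi) * (\<integral>y. L / sqrt s * exp (- (s / 2) * (norm (x - y))\<^sup>2) \<partial>lborel)"
  proof -
    have "\<bar>\<integral>y. (f x - f y) * exp (- s * (norm (x - y))\<^sup>2) \<partial>lborel\<bar> \<le> (\<integral>y. \<bar>(f x - f y) * exp (- s * (norm (x - y))\<^sup>2)\<bar> \<partial>lborel)"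
      by (rule integral_abs_bound)
    also have "\<dots> \<le> (\<integral>y. L / sqrt s * exp (- (s / 2) * (norm (x - y))\<^sup>2) \<partial>lborel)"
      using fi g[OF s] g[of "s / 2"] s unfolding left_diff_distrib
      by (intro integral_mono pt[unfolded left_diff_distrib] integrable_mult_right Bochner_Integration.integrable_diff integrable_abs) auto
    finally show ?thesis unfolding abs_mult using s by (intro mult_mono) auto
  qed
  also have "\<dots> = 2 * L / sqrt s" using g[of "s / 2"] s by (simp add: field_simps)
  finally show ?thesis .
qed

text \<open>Smoothing puts a Gaussian on the Fourier side, so the pairing is an absolutely
  convergent integral given by \<open>gaussian_pairing\<close>. The factor 4 pi^2 is the product of
  4 pi s and pi / s.\<close>

lemma pairing_heat_average:
  fixes f :: "real^2 \<Rightarrow> real"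
  assumes s: "s > 0" and \<sigma>: "finite_borel \<sigma>" and f: "integrable lborel f"
  defines "h \<equiv> \<lambda>\<xi>. exp (- (norm \<xi>)\<^sup>2 / (4 * s)) *\<^sub>R (fourier \<sigma> \<xi> * cnj (\<integral>x. f x *\<^sub>R cis (- (x \<bullet> \<xi>)) \<partial>lborel))"
  shows "integrable lborel h" "(\<integral>\<xi>. h \<xi> \<partial>lborel) = of_real (4 * pi\<^sup>2 * pairing \<sigma> (heat_average s f))"
proof -
  have "integrable lborel h \<and> (\<integral>\<xi>. h \<xi> \<partial>lborel) = of_real (4 * pi\<^sup>2 * pairing \<sigma> (heat_average s f))"
    using \<sigma> unfolding h_def
  proof (induction \<sigma>)
    case Nil
    show ?case by (simp add: fourier_def pairing_def)
  next
    case (Cons p \<sigma>)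
    obtain a \<mu> where p: "p = (a, \<mu>)" by fastforce
    have m: "finite_measure \<mu>" "sets \<mu> = sets borel" using Cons.prems by (auto simp: p finite_borel_def)
    interpret finite_measure \<mu> by fact
    interpret P: pair_sigma_finite \<mu> "lborel :: (real^2) measure" ..
    define F where "F \<xi> = (\<integral>x. f x *\<^sub>R cis (- (x \<bullet> \<xi>)) \<partial>lborel)" for \<xi>
    define G where "G \<xi> = exp (- (norm \<xi>)\<^sup>2 / (4 * s)) *\<^sub>R ((\<integral>x. 1 *\<^sub>R cis (- (x \<bullet> \<xi>)) \<partial>\<mu>) * cnj (F \<xi>))" for \<xi>
    have i1: "integrable \<mu> (\<lambda>_. 1::real)" by simp
    note gp = gaussian_pairing[OF s sigma_finite_measure_axioms lborel.sigma_finite_measure_axioms m(2) sets_lborel i1 f, folded F_def, folded G_def]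
    have "(\<integral>z. 1 * f (snd z) * exp (- s * (norm (fst z - snd z))\<^sup>2) \<partial>(\<mu> \<Otimes>\<^sub>M lborel)) = (\<integral>x. (pi / s) * heat_average s f x \<partial>\<mu>)"
      using s by (subst P.integral_fst'[OF gp(2), symmetric]) (auto simp: heat_average_def)
    hence G: "integrable lborel G" "(\<integral>\<xi>. G \<xi> \<partial>lborel) = of_real (4 * pi\<^sup>2 * (\<integral>x. heat_average s f x \<partial>\<mu>))"
      using gp(1,3) s by (auto simp: power2_eq_square)
    have eq: "exp (- (norm \<xi>)\<^sup>2 / (4 * s)) *\<^sub>R (fourier (p # \<sigma>) \<xi> * cnj (F \<xi>)) =
       of_real a * G \<xi> + exp (- (norm \<xi>)\<^sup>2 / (4 * s)) *\<^sub>R (fourier \<sigma> \<xi> * cnj (F \<xi>))" for \<xi>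
      by (simp add: fourier_def p G_def scaleR_conv_of_real algebra_simps)
    have IH: "integrable lborel (\<lambda>\<xi>. exp (- (norm \<xi>)\<^sup>2 / (4 * s)) *\<^sub>R (fourier \<sigma> \<xi> * cnj (F \<xi>)))"
      "(\<integral>\<xi>. exp (- (norm \<xi>)\<^sup>2 / (4 * s)) *\<^sub>R (fourier \<sigma> \<xi> * cnj (F \<xi>)) \<partial>lborel) = of_real (4 * pi\<^sup>2 * pairing \<sigma> (heat_average s f))"
      using Cons unfolding F_def by (auto simp: finite_borel_def)
    show ?case
      unfolding F_def[symmetric] eq using G IH
      by (auto simp: pairing_def p algebra_simps)
  qed
  thus "integrable lborel h" "(\<integral>\<xi>. h \<xi> \<partial>lborel) = of_real (4 * pi\<^sup>2 * pairing \<sigma> (heat_average s f))" by auto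
qed

lemma borel_measurable_heat_average:
  assumes [measurable]: "f \<in> borel_measurable borel"
  shows "heat_average s f \<in> borel_measurable borel"
  unfolding heat_average_def[abs_def] by measurable

text \<open>The first term is the error of replacing \<open>f\<close> by its heat average. The
  smoothed pairing is handled by Cauchy-Schwarz between the weighted energy integral and the
  gradient bound. The scale s = 1 / \<epsilon> makes the heat multiplier the square root of the
  energy weight.\<close>

theorem pairing_lipschitz_bound:
  fixes f :: "real^2 \<Rightarrow> real"
  assumes \<sigma>: "finite_borel \<sigma>" and eps: "\<epsilon> > 0" and J: "J \<ge> 0"
    and I: "(\<integral>\<^sup>+\<xi>. ennreal (exp (- \<epsilon> * (norm \<xi>)\<^sup>2 / 2) * (cmod (fourier \<sigma> \<xi>))\<^sup>2 / (norm \<xi>)\<^sup>2) \<partial>lborel) \<le> ennreal J"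
    and f: "L-lipschitz_on UNIV f" and supp: "\<And>x. x \<notin> cball 0 R \<Longrightarrow> f x = 0" and c: "\<And>x. \<bar>f x\<bar> \<le> c"
  defines "V \<equiv> measure lborel (cball (0::real^2) (R + 1))"
  shows "\<bar>pairing \<sigma> f\<bar> \<le> 2 * L * sqrt \<epsilon> * abs_mass \<sigma> + L * sqrt (2 * V * J)"
proof -
  define s where "s = 1 / \<epsilon>"
  have s: "s > 0" using eps by (simp add: s_def)
  have fc: "continuous_on UNIV f" using f(1) by (rule lipschitz_on_continuous_on)
  have [measurable]: "f \<in> borel_measurable borel" using fc by (rule borel_measurable_continuous_onI)
  have L: "L \<ge> 0" using f(1) by (rule lipschitz_on_nonneg)
  have fi: "integrable lborel f" by (rule integrable_continuous_bounded_support[OF fc supp])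
  note [measurable] = borel_measurable_heat_average borel_measurable_fourier[OF \<sigma>]
  define F where "F \<xi> = (\<integral>x. f x *\<^sub>R cis (- (x \<bullet> \<xi>)) \<partial>lborel)" for \<xi>
  have [measurable]: "F \<in> borel_measurable borel" unfolding F_def by measurable
  have close: "\<bar>f x - heat_average s f x\<bar> \<le> 2 * L * sqrt \<epsilon>" for x
    using heat_average_close[OF s f fi, of x] eps by (simp add: s_def real_sqrt_divide)
  have hb: "\<bar>heat_average s f x\<bar> \<le> c + 2 * L * sqrt \<epsilon>" for x
    using close[of x] c[of x] by linarith
  have 1: "\<bar>pairing \<sigma> f - pairing \<sigma> (heat_average s f)\<bar> \<le> 2 * L * sqrt \<epsilon> * abs_mass \<sigma>"
    unfolding pairing_diff[OF \<sigma> \<open>f \<in> borel_measurable borel\<close> c borel_measurable_heat_average[OF \<open>f \<in> borel_measurable borel\<close>] hb, symmetric]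
    by (intro pairing_bounded \<sigma> close) measurable
  define A where "A \<xi> = exp (- \<epsilon> * (norm \<xi>)\<^sup>2 / 4) * cmod (fourier \<sigma> \<xi>) / norm \<xi>" for \<xi>
  define G where "G \<xi> = norm \<xi> * cmod (F \<xi>)" for \<xi>
  have [measurable]: "A \<in> borel_measurable borel" "G \<in> borel_measurable borel" unfolding A_def G_def by measurable
  have A2: "(\<integral>\<^sup>+\<xi>. (ennreal (A \<xi>))\<^sup>2 \<partial>lborel) \<le> ennreal J"
  proof -
    have "(ennreal (A \<xi>))\<^sup>2 = ennreal (exp (- \<epsilon> * (norm \<xi>)\<^sup>2 / 2) * (cmod (fourier \<sigma> \<xi>))\<^sup>2 / (norm \<xi>)\<^sup>2)" for \<xi>
      by (subst ennreal_power) (auto simp: A_def power_mult_distrib power_divide exp_double[symmetric] simp flip: exp_double)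
    thus ?thesis using I by simp
  qed
  \<comment> \<open>The leading factor 2 is the dimension: the gradient bound is summed over the
    coordinates.\<close>
  have G2: "(\<integral>\<^sup>+\<xi>. (ennreal (G \<xi>))\<^sup>2 \<partial>lborel) \<le> ennreal (2 * ((2 * pi)\<^sup>2 * L\<^sup>2 * V))"
  proof -
    have *: "(ennreal (G \<xi>))\<^sup>2 = (\<Sum>b\<in>Basis. ennreal ((\<xi> \<bullet> b)\<^sup>2 * (cmod (F \<xi>))\<^sup>2))" for \<xi>
      by (subst sum_ennreal) (simp_all add: ennreal_power G_def power_mult_distrib sum_distrib_right[symmetric] flip: norm_square_Basis)
    have "(\<integral>\<^sup>+\<xi>. (ennreal (G \<xi>))\<^sup>2 \<partial>lborel) = (\<Sum>b\<in>Basis. \<integral>\<^sup>+\<xi>. ennreal ((\<xi> \<bullet> b)\<^sup>2 * (cmod (F \<xi>))\<^sup>2) \<partial>lborel)"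
      unfolding * by (rule nn_integral_sum) measurable
    also have "\<dots> \<le> (\<Sum>b\<in>(Basis::(real^2) set). ennreal ((2 * pi) ^ DIM(real^2) * L\<^sup>2 * V))"
      unfolding V_def F_def by (intro sum_mono lipschitz_fourier_gradient[OF f supp]) auto
    also have "\<dots> = ennreal (2 * ((2 * pi)\<^sup>2 * L\<^sup>2 * V))"
      by (subst sum_ennreal) (auto simp: V_def)
    finally show ?thesis .
  qed
  define T where "T = (\<integral>\<^sup>+\<xi>. ennreal (A \<xi>) * ennreal (G \<xi>) \<partial>lborel)"
  have "T\<^sup>2 \<le> ennreal J * ennreal (2 * ((2 * pi)\<^sup>2 * L\<^sup>2 * V))"
    unfolding T_def by (rule order_trans[OF Cauchy_Schwarz_nn_integral mult_mono[OF A2 G2]]) auto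
  also have "\<dots> = ennreal ((2 * pi * L * sqrt (2 * V * J))\<^sup>2)"
    using J by (simp add: ennreal_mult[symmetric] power_mult_distrib V_def mult_ac)
  finally have T2: "T\<^sup>2 \<le> (ennreal (2 * pi * L * sqrt (2 * V * J)))\<^sup>2"
    using L J by (simp add: ennreal_power V_def)
  have "T \<noteq> \<top>" using T2 by (auto simp: power2_eq_square ennreal_mult_eq_top_iff top_unique)
  then obtain r where r: "T = ennreal r" "r \<ge> 0" by (cases T) auto
  have nn: "2 * pi * L * sqrt (2 * V * J) \<ge> 0" using L J by (simp add: V_def)
  have "r\<^sup>2 \<le> (2 * pi * L * sqrt (2 * V * J))\<^sup>2"
    using T2 r nn by (simp add: ennreal_power del: real_sqrt_mult)
  hence T: "T \<le> ennreal (2 * pi * L * sqrt (2 * V * J))"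
    using power2_le_imp_le[OF _ nn] r by (simp add: ennreal_leI)
  define h where "h \<xi> = exp (- (norm \<xi>)\<^sup>2 / (4 * s)) *\<^sub>R (fourier \<sigma> \<xi> * cnj (F \<xi>))" for \<xi>
  note ph = pairing_heat_average[OF s \<sigma> fi, folded F_def, folded h_def]
  have "ennreal (norm (\<integral>\<xi>. h \<xi> \<partial>lborel)) \<le> (\<integral>\<^sup>+\<xi>. ennreal (norm (h \<xi>)) \<partial>lborel)"
    by (rule integral_norm_bound_ennreal[OF ph(1)])
  also have "\<dots> = T"
    unfolding T_def
  \<comment> \<open>The norm of \<xi> cancels between \<open>A\<close> and \<open>G\<close> only
    away from the origin, a null set.\<close>
  proof (intro nn_integral_cong_AE, use AE_lborel_singleton[of "0::real^2"] in eventually_elim)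
    fix \<xi> :: "real^2" assume "\<xi> \<noteq> 0"
    thus "ennreal (norm (h \<xi>)) = ennreal (A \<xi>) * ennreal (G \<xi>)"
      by (simp add: ennreal_mult[symmetric] h_def A_def G_def norm_mult s_def mult_ac)
  qed
  also note T
  finally have "norm (\<integral>\<xi>. h \<xi> \<partial>lborel) \<le> 2 * pi * L * sqrt (2 * V * J)"
    using L J by (subst (asm) ennreal_le_iff) (auto simp: V_def)
  hence "4 * pi\<^sup>2 * \<bar>pairing \<sigma> (heat_average s f)\<bar> \<le> 2 * pi * L * sqrt (2 * V * J)"
    unfolding ph(2) by (simp add: norm_mult norm_power)
  hence "2 * pi * \<bar>pairing \<sigma> (heat_average s f)\<bar> \<le> L * sqrt (2 * V * J)"
    by (simp add: power2_eq_square)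
  moreover have "\<bar>pairing \<sigma> (heat_average s f)\<bar> \<le> 2 * pi * \<bar>pairing \<sigma> (heat_average s f)\<bar>"
    using pi_ge_two by (simp add: mult_le_cancel_right1)
  ultimately show ?thesis using 1 by linarith
qed

section \<open>Densities and empirical measures\<close>

text \<open>The complement of the essential support is a union of possibly uncountably many open
  sets; the Lindelof property extracts a countable subfamily, and countably many exceptional null
  sets are harmless.\<close>

lemma AE_zero_outside_ess_support: "AE x in lborel. x \<notin> ess_support f \<longrightarrow> f x = 0"
proof -
  define \<U> where "\<U> = {U. open U \<and> (AE x in lborel. x \<in> U \<longrightarrow> f x = 0)}"
  obtain \<V> where \<V>: "\<V> \<subseteq> \<U>" "countable \<V>" "\<Union>\<V> = \<Union>\<U>"
    using Lindelof_openin[of \<U> UNIV] by (auto simp: \<U>_def)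
  have "AE x in lborel. \<forall>U\<in>\<V>. x \<in> U \<longrightarrow> f x = 0"
    using \<V> by (subst AE_ball_countable) (auto simp: \<U>_def)
  thus ?thesis
    by eventually_elim (use \<V> in \<open>auto simp: ess_support_def \<U>_def[symmetric]\<close>)
qed

lemma compact_ess_support_bound:
  assumes "compact (ess_support f)"
  obtains R where "R \<ge> 0" "AE x in lborel. R < norm x \<longrightarrow> f x = 0"
proof -
  obtain R where R: "R > 0" "\<forall>x\<in>ess_support f. norm x \<le> R"
    using compact_imp_bounded[OF assms] bounded_pos by blast
  have "AE x in lborel. R < norm x \<longrightarrow> f x = 0"
    using AE_zero_outside_ess_support[of f] by eventually_elim (use R in fastforce)
  thus ?thesis using R that[of R] by simp
qed

lemma Linf_norm_AE_bound:
  fixes f :: "'a::euclidean_space \<Rightarrow> 'b::real_normed_vector"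
  assumes "Linf_norm f \<le> ereal M"
  shows "AE x in lborel. norm (f x) \<le> M"
  using esssup_AE[where M = lborel and f = "\<lambda>x. ereal (norm (f x))"]
  by eventually_elim (use assms in \<open>auto simp: Linf_norm_def dest: order_trans\<close>)

lemma Linf_norm_nonneg: "0 \<le> Linf_norm (f :: 'a::euclidean_space \<Rightarrow> 'b::real_normed_vector)"
proof (cases "(\<lambda>x. ereal (norm (f x))) \<in> borel_measurable lborel")
  case True
  have "esssup lborel (\<lambda>x::'a. 0::ereal) \<le> Linf_norm f"
    unfolding Linf_norm_def by (rule esssup_mono) auto
  moreover have "esssup lborel (\<lambda>x::'a. 0::ereal) = 0"
    by (rule esssup_const) simp
  ultimately show ?thesis by simp
qed (auto simp: Linf_norm_def esssup_non_measurable)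

text \<open>The bound \<open>M\<close> is explicit because the constants depend on it and it must be
  uniform in N. The radius is existential because the supports of the \<omega>_N need not be
  uniformly bounded.\<close>

definition regular_density :: "real \<Rightarrow> ('a::euclidean_space \<Rightarrow> real) \<Rightarrow> bool" where
  "regular_density M f \<longleftrightarrow> f \<in> borel_measurable borel \<and> prob_density f \<and> (AE x in lborel. \<bar>f x\<bar> \<le> M) \<and>
     (\<exists>R. AE x in lborel. R < norm x \<longrightarrow> f x = 0)"

definition "bounded_support \<mu> \<longleftrightarrow> (\<exists>R. AE x in \<mu>. norm (x::'a::euclidean_space) \<le> R)"

text \<open>The potential bound is the form in which boundedness of a density enters the interaction
  estimates. Atoms are excluded separately: since 1 / 0 is 0, the integral would not see an atom at
  \<open>x\<close>.\<close>

definition diffuse :: "real \<Rightarrow> (real^2) measure \<Rightarrow> bool" where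
  "diffuse K \<mu> \<longleftrightarrow> (\<forall>x. (AE y in \<mu>. y \<noteq> x) \<and> (\<integral>\<^sup>+y. ennreal (1 / norm (x - y)) \<partial>\<mu>) \<le> ennreal K)"

definition prob_borel :: "'a::euclidean_space measure \<Rightarrow> bool" where
  "prob_borel \<mu> \<longleftrightarrow> prob_space \<mu> \<and> sets \<mu> = sets borel"

context
  fixes f :: "'a::euclidean_space \<Rightarrow> real"
  assumes f: "f \<in> borel_measurable borel" "prob_density f"
begin

lemma nn_integral_prob_density: "(\<integral>\<^sup>+x. ennreal (f x) \<partial>lborel) = 1"
  using f(2) by (subst nn_integral_eq_integral) (auto simp: prob_density_def)

lemma prob_borel_ac_measure: "prob_borel (ac_measure f)"
proof -
  note [measurable] = f(1)
  show ?thesis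
    using nn_integral_prob_density by (auto simp: prob_borel_def ac_measure_def emeasure_density intro!: prob_spaceI)
qed

lemma integral_ac_measure:
  fixes g :: "'a \<Rightarrow> 'b::{banach, second_countable_topology}"
  assumes [measurable]: "g \<in> borel_measurable borel"
  shows "(\<integral>x. g x \<partial>ac_measure f) = (\<integral>x. f x *\<^sub>R g x \<partial>lborel)"
    and "integrable (ac_measure f) g \<longleftrightarrow> integrable lborel (\<lambda>x. f x *\<^sub>R g x)"
  using f unfolding ac_measure_def prob_density_def
  by (auto intro!: integral_density simp: integrable_density)

lemma AE_ac_measureI: "AE x in lborel. P x \<Longrightarrow> AE x in ac_measure f. P x"
  using f(1) unfolding ac_measure_def by (subst AE_density) auto

end

lemma regular_densityD:
  assumes "regular_density M f"
  shows "f \<in> borel_measurable borel" "prob_density f" "prob_borel (ac_measure f)" "bounded_support (ac_measure f)"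
proof -
  show f: "f \<in> borel_measurable borel" "prob_density f" using assms by (auto simp: regular_density_def)
  show "prob_borel (ac_measure f)" by (rule prob_borel_ac_measure[OF f])
  obtain R where R: "AE x in lborel. R < norm x \<longrightarrow> f x = 0" using assms by (auto simp: regular_density_def)
  hence "AE x in ac_measure f. norm x \<le> R"
    using f(1) unfolding ac_measure_def by (subst AE_density) (auto elim!: eventually_mono simp: not_le[symmetric])
  thus "bounded_support (ac_measure f)" by (auto simp: bounded_support_def)
qed

section \<open>Local integrability of the inverse norm in the plane\<close>

lemma nn_integral_inverse_sqrt: "(\<integral>\<^sup>+s. ennreal (indicator {-1..1} s * \<bar>s\<bar> powr (-1/2)) \<partial>lborel) < \<infinity>"
proof -
  have i: "((\<lambda>x. x powr (-1/2)) has_integral 2) {0..(1::real)}"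
    using has_integral_powr_from_0[of "-1/2" 1] by simp
  have "((\<lambda>x. if x \<in> {0..1} then x powr (-1/2) else 0) has_integral 2) (UNIV :: real set)"
    using i by (subst has_integral_restrict_UNIV)
  moreover have "(\<lambda>x. if x \<in> {0..1} then x powr (-1/2) else 0) = (\<lambda>s::real. indicator {0..1} s * \<bar>s\<bar> powr (-1/2))"
    by (auto simp: fun_eq_iff)
  ultimately have 1: "(\<integral>\<^sup>+s. ennreal (indicator {0..1} s * \<bar>s\<bar> powr (-1/2)) \<partial>lborel) = ennreal 2"
    by (intro nn_integral_has_integral_lborel) auto
  have "(\<integral>\<^sup>+s. ennreal (indicator {0..1} s * \<bar>s\<bar> powr (-1/2)) \<partial>lborel)
     = (\<integral>\<^sup>+s. ennreal (indicator {0..1} s * \<bar>s\<bar> powr (-1/2)) \<partial>distr lborel borel uminus)"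
    by (simp add: lborel_distr_uminus)
  also have "\<dots> = (\<integral>\<^sup>+s. ennreal (indicator {0..1} (-s) * \<bar>s\<bar> powr (-1/2)) \<partial>lborel)"
    by (subst nn_integral_distr) auto
  finally have 2: "(\<integral>\<^sup>+s. ennreal (indicator {0..1} (-s) * \<bar>s\<bar> powr (-1/2)) \<partial>lborel) = ennreal 2"
    using 1 by simp
  have "(\<integral>\<^sup>+s. ennreal (indicator {-1..1} s * \<bar>s\<bar> powr (-1/2)) \<partial>lborel)
     \<le> (\<integral>\<^sup>+s. ennreal (indicator {0..1} s * \<bar>s\<bar> powr (-1/2)) + ennreal (indicator {0..1} (-s) * \<bar>s\<bar> powr (-1/2)) \<partial>lborel)"
    by (intro nn_integral_mono) (auto simp: indicator_def)
  also have "\<dots> = ennreal 2 + ennreal 2" by (subst nn_integral_add) (auto simp only: 1 2, measurable)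
  also have "\<dots> < \<infinity>" by (simp add: less_top[symmetric])
  finally show ?thesis .
qed

text \<open>In the plane 1 / |y| is a product of two copies of |y| powr (- 1/2), and each coordinate
  is at most |y|. This reduces integrability near the origin to dimension one, in place of polar
  coordinates.\<close>

lemma inverse_norm_le_prod:
  fixes y :: "real^2"
  assumes "\<And>b. b \<in> Basis \<Longrightarrow> y \<bullet> b \<noteq> 0"
  shows "1 / norm y \<le> (\<Prod>b\<in>Basis. \<bar>y \<bullet> b\<bar> powr (-1/2))"
proof -
  have y: "y \<noteq> 0" using assms[OF SOME_Basis] by auto
  have "(\<Prod>b\<in>(Basis::(real^2) set). norm y powr (-1/2)) \<le> (\<Prod>b\<in>Basis. \<bar>y \<bullet> b\<bar> powr (-1/2))"
    using assms by (intro prod_mono) (auto simp: Basis_le_norm intro!: powr_mono2')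
  moreover have "(\<Prod>b\<in>(Basis::(real^2) set). norm y powr (-1/2)) = 1 / norm y"
    using y by (simp add: power2_eq_square powr_add[symmetric] powr_minus_divide)
  ultimately show ?thesis by simp
qed

lemma borel_measurable_indicator_cball [measurable]:
  "(indicator (cball a r) :: 'a::euclidean_space \<Rightarrow> real) \<in> borel_measurable borel"
  by (intro borel_measurable_indicator) auto

lemma integrable_inverse_norm_local:
  "integrable lborel (\<lambda>y::real^2. indicator (cball 0 1) y / norm y)"
proof (rule integrableI_nonneg)
  have "(\<integral>\<^sup>+(y::real^2). ennreal (indicator (cball 0 1) y / norm y) \<partial>lborel)
     \<le> (\<integral>\<^sup>+(y::real^2). (\<Prod>b\<in>Basis. ennreal (indicator {-1..1} (y \<bullet> b) * \<bar>y \<bullet> b\<bar> powr (-1/2))) \<partial>lborel)"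
  proof (rule nn_integral_mono_AE)
    have "AE y in lborel. \<forall>b\<in>(Basis::(real^2) set). y \<bullet> b \<noteq> 0"
      by (subst AE_ball_countable) (auto simp: AE_lborel_inner_neq countable_finite)
    thus "AE y in lborel. ennreal (indicator (cball 0 1) y / norm y) \<le>
       (\<Prod>b\<in>(Basis::(real^2) set). ennreal (indicator {-1..1} (y \<bullet> b) * \<bar>y \<bullet> b\<bar> powr (-1/2)))"
    proof eventually_elim
      case (elim y)
      show ?case
      proof (cases "y \<in> cball 0 1")
        case True
        have "y \<bullet> b \<in> {-1..1}" if "b \<in> Basis" for b
          using Basis_le_norm[OF that, of y] True by auto
        hence "(\<Prod>b\<in>Basis. ennreal (indicator {-1..1} (y \<bullet> b) * \<bar>y \<bullet> b\<bar> powr (-1/2))) = ennreal (\<Prod>b\<in>Basis. \<bar>y \<bullet> b\<bar> powr (-1/2))"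
          by (subst prod_ennreal[symmetric]) (auto intro!: prod.cong)
        thus ?thesis using True inverse_norm_le_prod[of y] elim by (auto intro!: ennreal_leI)
      qed simp
    qed
  qed
  also have "\<dots> = (\<Prod>b\<in>(Basis::(real^2) set). (\<integral>\<^sup>+s. ennreal (indicator {-1..1} s * \<bar>s\<bar> powr (-1/2)) \<partial>lborel))"
    by (rule nn_integral_lborel_prod) auto
  also have "\<dots> < \<infinity>" using nn_integral_inverse_sqrt by (simp add: power2_eq_square ennreal_mult_less_top)
  finally show "(\<integral>\<^sup>+(y::real^2). ennreal (indicator (cball 0 1) y / norm y) \<partial>lborel) < \<infinity>" .
qed auto

text \<open>In polar coordinates the value is 2 pi, but only its finiteness and its sign are
  used.\<close>

definition "inverse_norm_mass = (\<integral>y. indicator (cball 0 1) y / norm (y::real^2) \<partial>lborel)"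

lemma inverse_norm_mass_nonneg: "0 \<le> inverse_norm_mass"
  unfolding inverse_norm_mass_def by (intro integral_nonneg_AE) auto

text \<open>Split at distance 1 from \<open>x\<close>: inside, the density is at most
  \<open>M\<close> and the inverse norm is integrable; outside, the inverse norm is at most 1 and
  the total mass is 1.\<close>

lemma diffuse_ac_measure:
  assumes f: "regular_density M f" and M: "M \<ge> 0"
  shows "diffuse (M * inverse_norm_mass + 1) (ac_measure f)"
  unfolding diffuse_def
proof (intro allI conjI)
  fix x :: "real^2"
  note [measurable] = regular_densityD(1)[OF f]
  show "AE y in ac_measure f. y \<noteq> x"
    using regular_densityD(1,2)[OF f] AE_lborel_singleton by (rule AE_ac_measureI)
  have "(\<integral>\<^sup>+y. ennreal (indicator (cball 0 1) (x - y) / norm (x - y)) \<partial>lborel) =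
     (\<integral>\<^sup>+y. ennreal (indicator (cball 0 1) y / norm y) \<partial>distr lborel borel (\<lambda>y. x - y))"
    by (subst nn_integral_distr) auto
  also have "\<dots> = ennreal inverse_norm_mass"
    unfolding lborel_distr_reflect inverse_norm_mass_def
    by (rule nn_integral_eq_integral[OF integrable_inverse_norm_local]) auto
  finally have 1: "(\<integral>\<^sup>+y. ennreal (indicator (cball 0 1) (x - y) / norm (x - y)) \<partial>lborel) = ennreal inverse_norm_mass" .
  have "(\<integral>\<^sup>+y. ennreal (1 / norm (x - y)) \<partial>ac_measure f) = (\<integral>\<^sup>+y. ennreal (f y) * ennreal (1 / norm (x - y)) \<partial>lborel)"
    unfolding ac_measure_def by (subst nn_integral_density) auto
  also have "\<dots> \<le> (\<integral>\<^sup>+y. ennreal M * ennreal (indicator (cball 0 1) (x - y) / norm (x - y)) + ennreal (f y) \<partial>lborel)"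
  proof (rule nn_integral_mono_AE)
    have "AE y in lborel. \<bar>f y\<bar> \<le> M" using f by (auto simp: regular_density_def)
    thus "AE y in lborel. ennreal (f y) * ennreal (1 / norm (x - y)) \<le> ennreal M * ennreal (indicator (cball 0 1) (x - y) / norm (x - y)) + ennreal (f y)"
    proof eventually_elim
      case (elim y)
      show ?case
      proof (cases "norm (x - y) \<le> 1")
        case True
        have "ennreal (f y) * ennreal (1 / norm (x - y)) \<le> ennreal M * ennreal (1 / norm (x - y))"
          using elim by (intro mult_right_mono ennreal_leI) auto
        thus ?thesis using True by (simp add: add_increasing2)
      next
        case False
        have "ennreal (f y) * ennreal (1 / norm (x - y)) \<le> ennreal (f y) * ennreal 1"
          using False by (intro mult_left_mono ennreal_leI) (auto simp: divide_simps)
        thus ?thesis by (simp add: add_increasing)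
      qed
    qed
  qed
  also have "\<dots> = ennreal (M * inverse_norm_mass + 1)"
    using 1 M inverse_norm_mass_nonneg nn_integral_prob_density[OF regular_densityD(1,2)[OF f]]
    by (subst nn_integral_add) (simp_all add: nn_integral_cmult ennreal_mult)
  finally show "(\<integral>\<^sup>+y. ennreal (1 / norm (x - y)) \<partial>ac_measure f) \<le> ennreal (M * inverse_norm_mass + 1)" .
qed

section \<open>Empirical measures\<close>

lemma measurable_uniform_count_measure [measurable]:
  "z \<in> uniform_count_measure A \<rightarrow>\<^sub>M (borel :: 'a::topological_space measure)"
  by (auto simp: measurable_def sets_uniform_count_measure space_uniform_count_measure)

lemma empirical_measure:
  fixes z :: "nat \<Rightarrow> 'a::euclidean_space"
  assumes N: "N \<ge> 1"
  shows prob_borel_empirical: "prob_borel (empirical_measure N z)"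
    and nn_integral_empirical: "g \<in> borel_measurable borel \<Longrightarrow>
      (\<integral>\<^sup>+x. g x \<partial>empirical_measure N z) = (\<Sum>i=1..N. ennreal (1 / real N) * g (z i))"
    and bounded_support_empirical: "bounded_support (empirical_measure N z)"
proof -
  have "prob_space (uniform_count_measure {1..N})" using N by (intro prob_space_uniform_count_measure) auto
  thus "prob_borel (empirical_measure N z)"
    unfolding empirical_measure_def prob_borel_def by (auto intro!: prob_space.prob_space_distr)
  show "(\<integral>\<^sup>+x. g x \<partial>empirical_measure N z) = (\<Sum>i=1..N. ennreal (1 / real N) * g (z i))" if [measurable]: "g \<in> borel_measurable borel" for g
    unfolding empirical_measure_def
    by (subst nn_integral_distr) (auto simp: uniform_count_measure_def nn_integral_point_measure_finite)
  have "AE x in empirical_measure N z. norm x \<le> Max ((\<lambda>i. norm (z i)) ` {1..N})"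
    unfolding empirical_measure_def
    by (subst AE_distr_iff) (auto intro!: AE_I2 simp: space_uniform_count_measure)
  thus "bounded_support (empirical_measure N z)" by (auto simp: bounded_support_def)
qed

lemma integral_empirical:
  fixes z :: "nat \<Rightarrow> 'a::euclidean_space" and g :: "'a \<Rightarrow> 'b::{banach, second_countable_topology}"
  assumes [measurable]: "g \<in> borel_measurable borel"
  shows "(\<integral>x. g x \<partial>empirical_measure N z) = (1 / real N) *\<^sub>R (\<Sum>i=1..N. g (z i))"
  unfolding empirical_measure_def
  by (subst integral_distr) (auto simp: uniform_count_measure_def lebesgue_integral_point_measure_finite scaleR_sum_right)

lemma prob_borelD:
  assumes "prob_borel \<mu>"
  shows "prob_space \<mu>" "finite_measure \<mu>" "sigma_finite_measure \<mu>" "sets \<mu> = sets borel" "measure \<mu> (space \<mu>) = 1"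
  using assms prob_space.finite_measure[of \<mu>] prob_space.prob_space[of \<mu>]
  by (auto simp: prob_borel_def finite_measure_def)

text \<open>Against finitely many point masses every measurable function is integrable. The double
  sum keeps the terms with i = j, so the value of a kernel at the origin counts.\<close>

lemma integrable_empirical_pair:
  fixes h :: "'a::euclidean_space \<times> 'a \<Rightarrow> real" and z :: "nat \<Rightarrow> 'a"
  assumes N: "N \<ge> 1" and [measurable]: "h \<in> borel_measurable (borel \<Otimes>\<^sub>M borel)"
  defines "\<mu> \<equiv> empirical_measure N z"
  shows "integrable (\<mu> \<Otimes>\<^sub>M \<mu>) h" "(\<integral>p. h p \<partial>(\<mu> \<Otimes>\<^sub>M \<mu>)) = (\<Sum>i=1..N. \<Sum>j=1..N. h (z i, z j)) / (real N)\<^sup>2"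
proof -
  note \<mu> = prob_borelD[OF prob_borel_empirical[OF N, of z], folded \<mu>_def]
  interpret M: sigma_finite_measure \<mu> by (rule \<mu>(3))
  interpret P: pair_sigma_finite \<mu> \<mu> ..
  note [measurable_cong] = \<mu>(4)
  show i: "integrable (\<mu> \<Otimes>\<^sub>M \<mu>) h"
  proof (rule integrableI_bounded)
    have "(\<integral>\<^sup>+p. ennreal (norm (h p)) \<partial>(\<mu> \<Otimes>\<^sub>M \<mu>)) = (\<integral>\<^sup>+x. (\<integral>\<^sup>+y. ennreal (norm (h (x, y))) \<partial>\<mu>) \<partial>\<mu>)"
      by (subst M.nn_integral_fst) auto
    also have "\<dots> < \<infinity>"
      unfolding \<mu>_def by (simp add: nn_integral_empirical[OF N] less_top[symmetric] ennreal_mult_eq_top_iff)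
    finally show "(\<integral>\<^sup>+p. ennreal (norm (h p)) \<partial>(\<mu> \<Otimes>\<^sub>M \<mu>)) < \<infinity>" .
  qed measurable
  have "(\<integral>p. h p \<partial>(\<mu> \<Otimes>\<^sub>M \<mu>)) = (\<integral>x. (\<integral>y. h (x, y) \<partial>\<mu>) \<partial>\<mu>)"
    by (rule P.integral_fst'[OF i, symmetric])
  also have "\<dots> = (\<Sum>i=1..N. \<Sum>j=1..N. h (z i, z j)) / (real N)\<^sup>2"
    unfolding \<mu>_def by (simp add: integral_empirical power2_eq_square sum_divide_distrib)
  finally show "(\<integral>p. h p \<partial>(\<mu> \<Otimes>\<^sub>M \<mu>)) = (\<Sum>i=1..N. \<Sum>j=1..N. h (z i, z j)) / (real N)\<^sup>2" .
qed

section \<open>Regularizing the logarithmic kernel\<close>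

text \<open>Since \<open>ln 0 = 0\<close>, the value at the origin is \<open>ln \<epsilon>\<close>: this is the cost of the diagonal in the energy
  of an empirical measure.\<close>

definition log_defect :: "real \<Rightarrow> 'a::euclidean_space \<Rightarrow> real" where
  "log_defect \<epsilon> x = ln ((norm x)\<^sup>2 + \<epsilon>) - ln ((norm x)\<^sup>2)"

text \<open>With u = sqrt \<epsilon> / |x| the defect is ln (1 + u^2), at most 2 ln (1 + u), hence
  at most 2 u. The simpler bound u^2 would be singular like |x|^(-2), which is not locally
  integrable in the plane; half of the rate in \<open>\<epsilon>\<close> is given up for an
  integrable singularity.\<close>

lemma log_defect_bounds:
  assumes "\<epsilon> > 0" "x \<noteq> 0"
  shows "0 \<le> log_defect \<epsilon> x" "log_defect \<epsilon> x \<le> 2 * sqrt \<epsilon> / norm x"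
proof -
  have n: "norm x > 0" using assms by simp
  show "0 \<le> log_defect \<epsilon> x" using n assms by (auto simp: log_defect_def intro!: ln_mono add_pos_pos)
  define u where "u = sqrt \<epsilon> / norm x"
  have u: "u > 0" using n assms by (simp add: u_def)
  have "(norm x)\<^sup>2 + \<epsilon> = (norm x)\<^sup>2 * (1 + u\<^sup>2)"
    using n assms by (simp add: u_def power_divide field_simps)
  hence "log_defect \<epsilon> x = ln (1 + u\<^sup>2)"
    using n add_pos_nonneg[OF zero_less_one, of "u\<^sup>2"] by (simp add: log_defect_def ln_mult_pos)
  also have "\<dots> \<le> ln ((1 + u)\<^sup>2)" using u by (intro ln_mono) (auto simp: power2_sum add_pos_pos)
  also have "\<dots> = 2 * ln (1 + u)" using u by (simp add: ln_realpow)
  also have "\<dots> \<le> 2 * u" using u by (simp add: ln_add_one_self_le_self)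
  finally show "log_defect \<epsilon> x \<le> 2 * sqrt \<epsilon> / norm x" by (simp add: u_def)
qed

lemma log_defect_minus: "log_defect \<epsilon> (y - x) = log_defect \<epsilon> (x - y)"
  by (simp add: log_defect_def norm_minus_commute)

lemma borel_measurable_log_defect [measurable]: "log_defect \<epsilon> \<in> borel_measurable borel"
  unfolding log_defect_def[abs_def] by measurable

text \<open>Integrating the pointwise bound first in the second variable uses the potential of
  \<open>\<nu>\<close> alone, so \<open>\<mu>\<close> may be an empirical measure.\<close>

lemma log_defect_diffuse:
  assumes \<mu>: "prob_borel \<mu>" and \<nu>: "prob_borel \<nu>" "diffuse K \<nu>" and K: "K \<ge> 0" and eps: "\<epsilon> > 0"
  shows "AE z in \<mu> \<Otimes>\<^sub>M \<nu>. fst z \<noteq> snd z"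
    and "integrable (\<mu> \<Otimes>\<^sub>M \<nu>) (\<lambda>z. log_defect \<epsilon> (fst z - snd z))"
    and "0 \<le> (\<integral>z. log_defect \<epsilon> (fst z - snd z) \<partial>(\<mu> \<Otimes>\<^sub>M \<nu>))"
    and "(\<integral>z. log_defect \<epsilon> (fst z - snd z) \<partial>(\<mu> \<Otimes>\<^sub>M \<nu>)) \<le> 2 * sqrt \<epsilon> * K"
proof -
  note m = prob_borelD[OF \<mu>] and n = prob_borelD[OF \<nu>(1)]
  interpret M: prob_space \<mu> by (rule m)
  interpret N: prob_space \<nu> by (rule n)
  interpret P: pair_sigma_finite \<mu> \<nu> ..
  note [measurable_cong] = m(4) n(4)
  show ae: "AE z in \<mu> \<Otimes>\<^sub>M \<nu>. fst z \<noteq> snd z"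
  proof (rule P.AE_pair_measure)
    have "AE y in \<nu>. fst (x, y) \<noteq> snd (x, y)" for x
    proof -
      have "AE y in \<nu>. y \<noteq> x" using \<nu>(2) unfolding diffuse_def by blast
      thus ?thesis by eventually_elim auto
    qed
    thus "AE x in \<mu>. AE y in \<nu>. fst (x, y) \<noteq> snd (x, y)" by (intro AE_I2[of \<mu>])
  qed measurable
  have "(\<integral>\<^sup>+z. ennreal (norm (log_defect \<epsilon> (fst z - snd z))) \<partial>(\<mu> \<Otimes>\<^sub>M \<nu>))
     \<le> (\<integral>\<^sup>+z. ennreal (2 * sqrt \<epsilon>) * ennreal (1 / norm (fst z - snd z)) \<partial>(\<mu> \<Otimes>\<^sub>M \<nu>))"
  proof (rule nn_integral_mono_AE)
    show "AE z in \<mu> \<Otimes>\<^sub>M \<nu>. ennreal (norm (log_defect \<epsilon> (fst z - snd z))) \<le> ennreal (2 * sqrt \<epsilon>) * ennreal (1 / norm (fst z - snd z))"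
      using ae
    proof eventually_elim
      case (elim z)
      thus ?case
        using log_defect_bounds[OF eps, of "fst z - snd z"] eps
        by (subst ennreal_mult[symmetric]) (auto intro!: ennreal_leI)
    qed
  qed
  also have "\<dots> = ennreal (2 * sqrt \<epsilon>) * (\<integral>\<^sup>+z. ennreal (1 / norm (fst z - snd z)) \<partial>(\<mu> \<Otimes>\<^sub>M \<nu>))"
    by (rule nn_integral_cmult) measurable
  also have "\<dots> = ennreal (2 * sqrt \<epsilon>) * (\<integral>\<^sup>+x. (\<integral>\<^sup>+y. ennreal (1 / norm (x - y)) \<partial>\<nu>) \<partial>\<mu>)"
    using N.nn_integral_fst[of "\<lambda>z. ennreal (1 / norm (fst z - snd z))" \<mu>] by simp
  also have "\<dots> \<le> ennreal (2 * sqrt \<epsilon>) * (\<integral>\<^sup>+x. ennreal K \<partial>\<mu>)"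
    using \<nu>(2) by (intro mult_left_mono nn_integral_mono) (auto simp: diffuse_def)
  also have "\<dots> = ennreal (2 * sqrt \<epsilon> * K)"
    using K eps by (simp add: M.emeasure_space_1 ennreal_mult)
  finally have b: "(\<integral>\<^sup>+z. ennreal (norm (log_defect \<epsilon> (fst z - snd z))) \<partial>(\<mu> \<Otimes>\<^sub>M \<nu>)) \<le> ennreal (2 * sqrt \<epsilon> * K)" .
  show i: "integrable (\<mu> \<Otimes>\<^sub>M \<nu>) (\<lambda>z. log_defect \<epsilon> (fst z - snd z))"
  proof (rule integrableI_bounded)
    show "(\<integral>\<^sup>+z. ennreal (norm (log_defect \<epsilon> (fst z - snd z))) \<partial>(\<mu> \<Otimes>\<^sub>M \<nu>)) < \<infinity>"
      by (rule le_less_trans[OF b]) simp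
  qed measurable
  show "0 \<le> (\<integral>z. log_defect \<epsilon> (fst z - snd z) \<partial>(\<mu> \<Otimes>\<^sub>M \<nu>))"
  proof (rule integral_nonneg_AE)
    show "AE z in \<mu> \<Otimes>\<^sub>M \<nu>. 0 \<le> log_defect \<epsilon> (fst z - snd z)"
      using ae by eventually_elim (simp add: log_defect_bounds(1)[OF eps])
  qed
  have "ennreal (norm (\<integral>z. log_defect \<epsilon> (fst z - snd z) \<partial>(\<mu> \<Otimes>\<^sub>M \<nu>))) \<le> ennreal (2 * sqrt \<epsilon> * K)"
    by (rule order_trans[OF integral_norm_bound_ennreal[OF i] b])
  thus "(\<integral>z. log_defect \<epsilon> (fst z - snd z) \<partial>(\<mu> \<Otimes>\<^sub>M \<nu>)) \<le> 2 * sqrt \<epsilon> * K"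
    using K eps by (subst (asm) ennreal_le_iff) auto
qed

text \<open>The defect is even, so the diffuse measure may occupy either slot. This covers the pairs
  whose second component is the empirical measure.\<close>

lemma log_defect_diffuse_swap:
  assumes \<mu>: "prob_borel \<mu>" "diffuse K \<mu>" and \<nu>: "prob_borel \<nu>" and K: "K \<ge> 0" and eps: "\<epsilon> > 0"
  shows "integrable (\<mu> \<Otimes>\<^sub>M \<nu>) (\<lambda>z. log_defect \<epsilon> (fst z - snd z))"
    and "(\<integral>z. log_defect \<epsilon> (fst z - snd z) \<partial>(\<mu> \<Otimes>\<^sub>M \<nu>)) = (\<integral>z. log_defect \<epsilon> (fst z - snd z) \<partial>(\<nu> \<Otimes>\<^sub>M \<mu>))"
proof -
  note m = prob_borelD[OF \<mu>(1)] and n = prob_borelD[OF \<nu>]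
  interpret M: prob_space \<mu> by (rule m)
  interpret N: prob_space \<nu> by (rule n)
  interpret P: pair_sigma_finite \<nu> \<mu> ..
  note [measurable_cong] = m(4) n(4)
  note d = log_defect_diffuse(2)[OF \<nu> \<mu> K eps]
  show "integrable (\<mu> \<Otimes>\<^sub>M \<nu>) (\<lambda>z. log_defect \<epsilon> (fst z - snd z))"
    using P.integrable_product_swap[OF d] by (simp add: case_prod_unfold log_defect_minus)
  show "(\<integral>z. log_defect \<epsilon> (fst z - snd z) \<partial>(\<mu> \<Otimes>\<^sub>M \<nu>)) = (\<integral>z. log_defect \<epsilon> (fst z - snd z) \<partial>(\<nu> \<Otimes>\<^sub>M \<mu>))"
    using P.integral_product_swap[of "\<lambda>z. log_defect \<epsilon> (fst z - snd z)"] d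
    by (simp add: case_prod_unfold log_defect_minus)
qed

text \<open>Distinct particles contribute nonnegative terms, and each of the N self-pairs
  contributes ln \<epsilon>. An upper bound uniform in the configuration is impossible, since two
  particles may be arbitrarily close; the sign with which this pair enters makes the lower bound
  sufficient.\<close>

lemma log_defect_empirical:
  fixes z :: "nat \<Rightarrow> 'a::euclidean_space"
  assumes N: "N \<ge> 1" and inj: "inj_on z {1..N}" and eps: "\<epsilon> > 0"
  defines "\<mu> \<equiv> empirical_measure N z"
  shows "integrable (\<mu> \<Otimes>\<^sub>M \<mu>) (\<lambda>p. log_defect \<epsilon> (fst p - snd p))"
    and "ln \<epsilon> / real N \<le> (\<integral>p. log_defect \<epsilon> (fst p - snd p) \<partial>(\<mu> \<Otimes>\<^sub>M \<mu>))"
proof -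
  have m: "(\<lambda>p. log_defect \<epsilon> (fst p - snd p)) \<in> borel_measurable (borel \<Otimes>\<^sub>M borel)" by measurable
  note e = integrable_empirical_pair[OF N m, of z, folded \<mu>_def]
  show "integrable (\<mu> \<Otimes>\<^sub>M \<mu>) (\<lambda>p. log_defect \<epsilon> (fst p - snd p))" by (rule e)
  have "ln \<epsilon> \<le> (\<Sum>j=1..N. log_defect \<epsilon> (z i - z j))" if i: "i \<in> {1..N}" for i
  proof -
    have "0 \<le> (\<Sum>j\<in>{1..N}-{i}. log_defect \<epsilon> (z i - z j))"
      using inj i by (intro sum_nonneg log_defect_bounds[OF eps]) (auto dest: inj_onD)
    moreover have "(\<Sum>j=1..N. log_defect \<epsilon> (z i - z j)) = log_defect \<epsilon> (z i - z i) + (\<Sum>j\<in>{1..N}-{i}. log_defect \<epsilon> (z i - z j))"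
      using i by (intro sum.remove) auto
    ultimately show ?thesis by (simp add: log_defect_def)
  qed
  hence "(\<Sum>i=1..N. ln \<epsilon>) \<le> (\<Sum>i=1..N. \<Sum>j=1..N. log_defect \<epsilon> (z i - z j))"
    by (rule sum_mono)
  hence "real N * ln \<epsilon> / (real N)\<^sup>2 \<le> (\<Sum>i=1..N. \<Sum>j=1..N. log_defect \<epsilon> (z i - z j)) / (real N)\<^sup>2"
    by (intro divide_right_mono) auto
  thus "ln \<epsilon> / real N \<le> (\<integral>p. log_defect \<epsilon> (fst p - snd p) \<partial>(\<mu> \<Otimes>\<^sub>M \<mu>))"
    unfolding e(2) using N by (simp add: power2_eq_square)
qed

text \<open>The shift bounds the logarithm from below and the bounded supports bound it from above,
  so a constant dominates.\<close>

lemma integrable_log_shifted: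
  fixes \<mu> \<nu> :: "'a::euclidean_space measure"
  assumes \<mu>: "prob_borel \<mu>" "bounded_support \<mu>" and \<nu>: "prob_borel \<nu>" "bounded_support \<nu>" and eps: "\<epsilon> > 0"
  shows "integrable (\<mu> \<Otimes>\<^sub>M \<nu>) (\<lambda>z. ln ((norm (fst z - snd z))\<^sup>2 + \<epsilon>))"
proof -
  note m = prob_borelD[OF \<mu>(1)] and n = prob_borelD[OF \<nu>(1)]
  interpret M: prob_space \<mu> by (rule m)
  interpret N: prob_space \<nu> by (rule n)
  interpret P: pair_prob_space \<mu> \<nu> ..
  note [measurable_cong] = m(4) n(4)
  obtain R S where R: "AE x in \<mu>. norm x \<le> R" "AE x in \<nu>. norm x \<le> S"
    using \<mu> \<nu> by (auto simp: bounded_support_def)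
  have "AE z in \<mu> \<Otimes>\<^sub>M \<nu>. norm (fst z) \<le> R \<and> norm (snd z) \<le> S"
  proof (rule P.AE_pair_measure)
    show "AE x in \<mu>. AE y in \<nu>. norm (fst (x, y)) \<le> R \<and> norm (snd (x, y)) \<le> S"
      using R(1) by eventually_elim (use R(2) in auto)
  qed measurable
  hence "AE z in \<mu> \<Otimes>\<^sub>M \<nu>. norm (ln ((norm (fst z - snd z))\<^sup>2 + \<epsilon>)) \<le> \<bar>ln \<epsilon>\<bar> + \<bar>ln ((R + S)\<^sup>2 + \<epsilon>)\<bar>"
  proof eventually_elim
    case (elim z)
    have "norm (fst z - snd z) \<le> R + S" using elim norm_triangle_ineq4[of "fst z" "snd z"] by linarith
    hence "(norm (fst z - snd z))\<^sup>2 \<le> (R + S)\<^sup>2" by (intro power_mono) auto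
    hence "ln ((norm (fst z - snd z))\<^sup>2 + \<epsilon>) \<le> ln ((R + S)\<^sup>2 + \<epsilon>)" using eps by (intro ln_mono) (auto intro: add_nonneg_pos)
    moreover have "ln \<epsilon> \<le> ln ((norm (fst z - snd z))\<^sup>2 + \<epsilon>)" using eps by (intro ln_mono) (auto intro: add_nonneg_pos)
    ultimately show ?case by auto
  qed
  thus ?thesis by (rule P.P.integrable_const_bound) measurable
qed

lemma energy_linear:
  assumes "pairs_integrable k1 \<sigma>" "pairs_integrable k2 \<sigma>"
  shows "energy (\<lambda>x. c * (k1 x + k2 x)) \<sigma> = c * (energy k1 \<sigma> + energy k2 \<sigma>)"
proof -
  have "(\<integral>z. c * (k1 (fst z - snd z) + k2 (fst z - snd z)) \<partial>(snd (\<sigma> ! i) \<Otimes>\<^sub>M snd (\<sigma> ! j)))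
     = c * ((\<integral>z. k1 (fst z - snd z) \<partial>(snd (\<sigma> ! i) \<Otimes>\<^sub>M snd (\<sigma> ! j))) + (\<integral>z. k2 (fst z - snd z) \<partial>(snd (\<sigma> ! i) \<Otimes>\<^sub>M snd (\<sigma> ! j))))"
    if "i < length \<sigma>" "j < length \<sigma>" for i j
  proof -
    have "snd (\<sigma> ! i) \<in> snd ` set \<sigma>" "snd (\<sigma> ! j) \<in> snd ` set \<sigma>" using that by auto
    hence "integrable (snd (\<sigma> ! i) \<Otimes>\<^sub>M snd (\<sigma> ! j)) (\<lambda>z. k1 (fst z - snd z))"
      "integrable (snd (\<sigma> ! i) \<Otimes>\<^sub>M snd (\<sigma> ! j)) (\<lambda>z. k2 (fst z - snd z))"
      using assms unfolding pairs_integrable_def by blast+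
    thus ?thesis by simp
  qed
  thus ?thesis
    unfolding energy_nth sum.distrib[symmetric] sum_distrib_left
    by (intro sum.cong refl) (simp add: ring_distribs mult.left_commute)
qed

lemma log_kernel_eq: "log_kernel x = 1 / (4 * pi) * - ln ((norm x)\<^sup>2)"
  by (cases "x = 0") (auto simp: log_kernel_def ln_realpow)

text \<open>The convention \<open>ln 0 = 0\<close> makes \<open>log_kernel\<close> vanish on the diagonal.\<close>

lemma offdiag_energy_eq: "offdiag_energy \<sigma> = energy log_kernel \<sigma>"
proof -
  have "indicator (- diagonal) z *\<^sub>R log_kernel (fst z - snd z) = log_kernel (fst z - snd z)" for z
    by (cases "z \<in> diagonal") (auto simp: diagonal_def log_kernel_def)
  thus ?thesis unfolding offdiag_energy_def energy_def set_lebesgue_integral_def by (simp only:)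
qed

text \<open>The decomposition of the kernel also holds at the origin, where ln \<epsilon> cancels
  against the defect. Full energies can thus be compared without cutting out the diagonal.\<close>

lemma energy_log_kernel_shift:
  assumes "pairs_integrable (\<lambda>x. ln ((norm x)\<^sup>2 + \<epsilon>)) \<sigma>" "pairs_integrable (log_defect \<epsilon>) \<sigma>"
  shows "4 * pi * energy log_kernel \<sigma> = energy (\<lambda>x. - ln ((norm x)\<^sup>2 + \<epsilon>)) \<sigma> + energy (log_defect \<epsilon>) \<sigma>"
proof -
  have lk: "log_kernel = (\<lambda>x. 1 / (4 * pi) * (- ln ((norm x)\<^sup>2 + \<epsilon>) + log_defect \<epsilon> x))"
    by (auto simp: log_kernel_eq log_defect_def)
  have "pairs_integrable (\<lambda>x. - ln ((norm x)\<^sup>2 + \<epsilon>)) \<sigma>" using assms(1) by (auto simp: pairs_integrable_def)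
  from energy_linear[OF this assms(2), of "1 / (4 * pi)"] show ?thesis
    unfolding lk by simp
qed

text \<open>Bounding the regularized energy from above takes only a lower bound on the energy of
  \<open>log_defect\<close>. With \<open>\<epsilon> = 1 / N\<close> both errors vanish in the limit:
  the self-pairs, and the interactions of order sqrt \<epsilon> with densities.\<close>

theorem offdiag_energy_lower_bound:
  fixes q :: "nat \<Rightarrow> real^2"
  assumes N: "N \<ge> 1" and inj: "inj_on q {1..N}" and K: "K \<ge> 0"
    and A: "prob_borel A" "bounded_support A" "diffuse K A"
    and B: "prob_borel B" "bounded_support B" "diffuse K B"
    and D: "prob_borel D" "bounded_support D" "diffuse K D"
  defines "\<sigma> \<equiv> [(1, A), (1, B), (-1, empirical_measure N q), (-1, D)]" and "\<epsilon> \<equiv> 1 / real N"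
  shows "finite_borel \<sigma>" "total_mass \<sigma> = 0" "abs_mass \<sigma> = 4"
    and "pairs_integrable (\<lambda>x. ln ((norm x)\<^sup>2 + \<epsilon>)) \<sigma>"
    and "energy (\<lambda>x. - ln ((norm x)\<^sup>2 + \<epsilon>)) \<sigma> \<le> 4 * pi * offdiag_energy \<sigma> + ln (real N) / real N + 30 * K / sqrt (real N)"
proof -
  define E where "E = empirical_measure N q"
  have E: "prob_borel E" "bounded_support E" unfolding E_def by (intro prob_borel_empirical bounded_support_empirical N)+
  have eps: "\<epsilon> > 0" using N by (simp add: \<epsilon>_def)
  have \<sigma>: "\<sigma> = [(1, A), (1, B), (-1, E), (-1, D)]" by (simp add: \<sigma>_def E_def)
  note pb = prob_borelD[OF A(1)] prob_borelD[OF B(1)] prob_borelD[OF E(1)] prob_borelD[OF D(1)]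
  show "finite_borel \<sigma>" using pb unfolding \<sigma> finite_borel_def by simp
  show "total_mass \<sigma> = 0" "abs_mass \<sigma> = 4" using pb unfolding \<sigma> total_mass_def abs_mass_def by simp_all
  show i1: "pairs_integrable (\<lambda>x. ln ((norm x)\<^sup>2 + \<epsilon>)) \<sigma>"
    unfolding pairs_integrable_def \<sigma> using A B D E by (simp add: integrable_log_shifted eps)
  define J where "J \<mu> \<nu> = (\<integral>z. log_defect \<epsilon> (fst z - snd z) \<partial>(\<mu> \<Otimes>\<^sub>M \<nu>))" for \<mu> \<nu> :: "(real^2) measure"
  define b where "b = 2 * sqrt \<epsilon> * K"
  have J1: "integrable (\<mu> \<Otimes>\<^sub>M \<nu>) (\<lambda>z. log_defect \<epsilon> (fst z - snd z))" "0 \<le> J \<mu> \<nu>" "J \<mu> \<nu> \<le> b"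
    if "prob_borel \<mu>" "prob_borel \<nu>" "diffuse K \<nu>" for \<mu> \<nu>
    using log_defect_diffuse(2-)[OF that K eps] by (auto simp: J_def b_def)
  have J2: "integrable (\<mu> \<Otimes>\<^sub>M \<nu>) (\<lambda>z. log_defect \<epsilon> (fst z - snd z))" "0 \<le> J \<mu> \<nu>" "J \<mu> \<nu> \<le> b"
    if "prob_borel \<mu>" "diffuse K \<mu>" "prob_borel \<nu>" for \<mu> \<nu>
    using log_defect_diffuse_swap[OF that K eps] J1[OF that(3) that(1,2)] by (auto simp: J_def)
  note JE = log_defect_empirical[OF N inj eps, folded E_def, folded J_def]
  have i2: "pairs_integrable (log_defect \<epsilon>) \<sigma>"
    unfolding pairs_integrable_def \<sigma> using A B D E JE(1) by (simp add: J1(1) J2(1))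
  \<comment> \<open>Of the sixteen ordered pairs, fifteen contain a density and lie between 0 and
    \<open>b\<close> up to sign; counting all of them at - b is crude but sufficient. The remaining
    pair is the empirical measure with itself, with coefficient 1. As b = 2 K / sqrt N, the fifteen
    give the constant 30.\<close>
  have "energy (log_defect \<epsilon>) \<sigma> \<ge> ln \<epsilon> / real N - 15 * b"
    unfolding energy_def \<sigma> J_def[symmetric] using JE(2)
      J1(2,3)[OF A(1) A(1,3)] J1(2,3)[OF A(1) B(1,3)] J1(2,3)[OF A(1) D(1,3)] J2(2,3)[OF A(1,3) E(1)]
      J1(2,3)[OF B(1) A(1,3)] J1(2,3)[OF B(1) B(1,3)] J1(2,3)[OF B(1) D(1,3)] J2(2,3)[OF B(1,3) E(1)]
      J1(2,3)[OF D(1) A(1,3)] J1(2,3)[OF D(1) B(1,3)] J1(2,3)[OF D(1) D(1,3)] J2(2,3)[OF D(1,3) E(1)]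
      J1(2,3)[OF E(1) A(1,3)] J1(2,3)[OF E(1) B(1,3)] J1(2,3)[OF E(1) D(1,3)]
    by simp
  moreover have "15 * b = 30 * K / sqrt (real N)" by (simp add: b_def \<epsilon>_def real_sqrt_divide)
  moreover have "ln \<epsilon> = - ln (real N)" using N by (simp add: \<epsilon>_def ln_div)
  ultimately show "energy (\<lambda>x. - ln ((norm x)\<^sup>2 + \<epsilon>)) \<sigma> \<le> 4 * pi * offdiag_energy \<sigma> + ln (real N) / real N + 30 * K / sqrt (real N)"
    unfolding offdiag_energy_eq energy_log_kernel_shift[OF i1 i2] by simp
qed

text \<open>Diffuse measures do not charge the diagonal, so the Fourier lower bound applies at
  \<open>\<epsilon> = 0\<close> and controls the full homogeneous H^(-1) norm. Integrability of ln
  (|x|^2) comes from splitting it as the logarithm shifted by 1 minus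
  \<open>log_defect 1\<close>.\<close>

theorem energy_log_kernel_densities:
  assumes K: "K \<ge> 0"
    and A: "prob_borel A" "bounded_support A" "diffuse K A"
    and D: "prob_borel D" "bounded_support D" "diffuse K D"
  defines "\<sigma> \<equiv> [(1, A), (-1, D)]"
  shows "0 \<le> energy log_kernel \<sigma>"
    and "pairs_integrable log_kernel \<sigma>"
    and "(\<integral>\<^sup>+\<xi>. ennreal ((cmod (fourier \<sigma> \<xi>))\<^sup>2 / (norm \<xi>)\<^sup>2) \<partial>lborel) \<le> ennreal (16 * pi\<^sup>2 * exp 1 * energy log_kernel \<sigma>)"
proof -
  note pb = prob_borelD[OF A(1)] prob_borelD[OF D(1)]
  have fb: "finite_borel \<sigma>" using pb unfolding \<sigma>_def finite_borel_def by simp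
  have tm: "total_mass \<sigma> = 0" using pb unfolding \<sigma>_def total_mass_def by simp
  have i1: "pairs_integrable (\<lambda>x. ln ((norm x)\<^sup>2 + 1)) \<sigma>"
    unfolding pairs_integrable_def \<sigma>_def using A D by (simp add: integrable_log_shifted)
  have i2: "pairs_integrable (log_defect 1) \<sigma>"
    unfolding pairs_integrable_def \<sigma>_def using A D K by (simp add: log_defect_diffuse(2))
  have eq: "ln ((norm x)\<^sup>2 + 0) = ln ((norm x)\<^sup>2 + 1) - log_defect 1 x" for x :: "real^2"
    by (simp add: log_defect_def)
  have i: "pairs_integrable (\<lambda>x. ln ((norm x)\<^sup>2 + 0)) \<sigma>"
    using i1 i2 unfolding pairs_integrable_def eq by simp
  have ae: "AE z in \<mu> \<Otimes>\<^sub>M \<nu>. 0 < (norm (fst z - snd z))\<^sup>2 + 0" if "\<mu> \<in> snd ` set \<sigma>" "\<nu> \<in> snd ` set \<sigma>" for \<mu> \<nu>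
  proof -
    have "AE z in \<mu> \<Otimes>\<^sub>M \<nu>. fst z \<noteq> snd z"
      using that A D unfolding \<sigma>_def by (intro log_defect_diffuse(1)[OF _ _ _ K zero_less_one]) auto
    thus ?thesis by eventually_elim auto
  qed
  have lk: "log_kernel = (\<lambda>x. 1 / (4 * pi) * (- ln ((norm x)\<^sup>2 + 0)))"
    by (simp add: fun_eq_iff log_kernel_eq)
  show "pairs_integrable log_kernel \<sigma>" using i unfolding lk pairs_integrable_def by simp
  have en: "energy (\<lambda>x. - ln ((norm x)\<^sup>2 + 0)) \<sigma> = 4 * pi * energy log_kernel \<sigma>"
  proof -
    have "pairs_integrable (\<lambda>x::real^2. - ln ((norm x)\<^sup>2 + 0)) \<sigma>" "pairs_integrable (\<lambda>_::real^2. 0) \<sigma>"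
      using i by (auto simp: pairs_integrable_def)
    from energy_linear[OF this, of "1 / (4 * pi)"] show ?thesis
      unfolding lk by (simp add: energy_def[of "\<lambda>_. 0"] case_prod_unfold)
  qed
  note lb = energy_log_lower_bound[OF fb tm order_refl ae i, unfolded en]
  show "0 \<le> energy log_kernel \<sigma>" using lb(1) pi_gt_zero by (simp add: zero_le_mult_iff not_le)
  show "(\<integral>\<^sup>+\<xi>. ennreal ((cmod (fourier \<sigma> \<xi>))\<^sup>2 / (norm \<xi>)\<^sup>2) \<partial>lborel) \<le> ennreal (16 * pi\<^sup>2 * exp 1 * energy log_kernel \<sigma>)"
    using lb(2) by (simp add: power2_eq_square mult_ac)
qed

text \<open>Identifies the double integral in the modulated energy with the energy of a signed
  measure. Multiplying out the integrand is legitimate only because all four products are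
  integrable.\<close>

lemma interaction_energy_ac_difference:
  fixes f g :: "real^2 \<Rightarrow> real"
  assumes f: "f \<in> borel_measurable borel" "prob_density f" and g: "g \<in> borel_measurable borel" "prob_density g"
  defines "\<sigma> \<equiv> [(1, ac_measure f), (-1, ac_measure g)]"
  assumes i: "pairs_integrable log_kernel \<sigma>"
  shows "(\<integral>z. log_kernel (fst z - snd z) * (f (fst z) - g (fst z)) * (f (snd z) - g (snd z)) \<partial>(lborel \<Otimes>\<^sub>M lborel))
    = energy log_kernel \<sigma>"
proof -
  have [measurable]: "f \<in> borel_measurable borel" "g \<in> borel_measurable borel" by fact+
  have [measurable]: "log_kernel \<in> borel_measurable borel" unfolding log_kernel_def[abs_def] by measurable
  have key: "integrable (ac_measure u \<Otimes>\<^sub>M ac_measure w) (\<lambda>z. log_kernel (fst z - snd z)) \<longleftrightarrow>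
       integrable (lborel \<Otimes>\<^sub>M lborel) (\<lambda>z. log_kernel (fst z - snd z) * (u (fst z) * w (snd z)))"
     "(\<integral>z. log_kernel (fst z - snd z) \<partial>(ac_measure u \<Otimes>\<^sub>M ac_measure w)) =
       (\<integral>z. log_kernel (fst z - snd z) * (u (fst z) * w (snd z)) \<partial>(lborel \<Otimes>\<^sub>M lborel))"
    if [measurable]: "u \<in> borel_measurable borel" "w \<in> borel_measurable borel" and p: "prob_density u" "prob_density w" for u w
  proof -
    have ae: "AE z in lborel \<Otimes>\<^sub>M lborel. 0 \<le> u (fst z) \<and> 0 \<le> w (snd z)"
    proof (rule lborel_pair.AE_pair_measure)
      show "AE x in lborel. AE y in lborel. 0 \<le> u (fst (x, y)) \<and> 0 \<le> w (snd (x, y))"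
        using p unfolding prob_density_def by (auto elim!: eventually_mono)
    qed measurable
    have "sigma_finite_measure (ac_measure w)" by (rule prob_borelD(3)[OF prob_borel_ac_measure[OF that(2,4)]])
    hence "ac_measure u \<Otimes>\<^sub>M ac_measure w = density (lborel \<Otimes>\<^sub>M lborel) (\<lambda>(x, y). ennreal (u x) * ennreal (w y))"
      unfolding ac_measure_def by (intro pair_measure_density lborel.sigma_finite_measure_axioms) auto
    \<comment> \<open>Merging the two \<open>ennreal\<close> factors requires almost everywhere
      nonnegativity: truncation at 0 would lose a positive product of two negative values.\<close>
    also have "\<dots> = density (lborel \<Otimes>\<^sub>M lborel) (\<lambda>z. ennreal (u (fst z) * w (snd z)))"
      using ae by (intro density_cong, simp, simp, eventually_elim) (simp add: case_prod_unfold ennreal_mult)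
    finally have d: "ac_measure u \<Otimes>\<^sub>M ac_measure w = density (lborel \<Otimes>\<^sub>M lborel) (\<lambda>z. ennreal (u (fst z) * w (snd z)))" .
    have ae': "AE z in lborel \<Otimes>\<^sub>M lborel. 0 \<le> u (fst z) * w (snd z)" using ae by eventually_elim simp
    show "integrable (ac_measure u \<Otimes>\<^sub>M ac_measure w) (\<lambda>z. log_kernel (fst z - snd z)) \<longleftrightarrow>
       integrable (lborel \<Otimes>\<^sub>M lborel) (\<lambda>z. log_kernel (fst z - snd z) * (u (fst z) * w (snd z)))"
      unfolding d using ae' by (subst integrable_density) (auto simp: mult.commute)
    show "(\<integral>z. log_kernel (fst z - snd z) \<partial>(ac_measure u \<Otimes>\<^sub>M ac_measure w)) =
       (\<integral>z. log_kernel (fst z - snd z) * (u (fst z) * w (snd z)) \<partial>(lborel \<Otimes>\<^sub>M lborel))"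
      unfolding d using ae' by (subst integral_density) (auto simp: mult.commute)
  qed
  have ii: "integrable (lborel \<Otimes>\<^sub>M lborel) (\<lambda>z. log_kernel (fst z - snd z) * (u (fst z) * w (snd z)))"
    if "u \<in> {f, g}" "w \<in> {f, g}" for u w
    using i that f g unfolding pairs_integrable_def \<sigma>_def by (subst key(1)[symmetric]) auto
  define I where "I u w = (\<integral>z. log_kernel (fst z - snd z) * (u (fst z) * w (snd z)) \<partial>(lborel \<Otimes>\<^sub>M lborel))" for u w :: "real^2 \<Rightarrow> real"
  have "energy log_kernel \<sigma> = I f f - I f g - I g f + I g g"
    unfolding \<sigma>_def energy_def I_def by (simp add: key(2) f g)
  also have "\<dots> = (\<integral>z. log_kernel (fst z - snd z) * (f (fst z) * f (snd z)) - log_kernel (fst z - snd z) * (f (fst z) * g (snd z))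
     - log_kernel (fst z - snd z) * (g (fst z) * f (snd z)) + log_kernel (fst z - snd z) * (g (fst z) * g (snd z)) \<partial>(lborel \<Otimes>\<^sub>M lborel))"
    unfolding I_def using ii[of f f] ii[of f g] ii[of g f] ii[of g g]
    by (simp del: of_real_mult)
  also have "\<dots> = (\<integral>z. log_kernel (fst z - snd z) * (f (fst z) - g (fst z)) * (f (snd z) - g (snd z)) \<partial>(lborel \<Otimes>\<^sub>M lborel))"
    by (intro Bochner_Integration.integral_cong refl) (simp add: algebra_simps)
  finally show ?thesis ..
qed

section \<open>Lipschitz bounds from weak derivatives\<close>

text \<open>The classical smooth function exp (- 1 / s) with a negative power of s attached.
  Derivatives are linear combinations of members of the same family, so smoothness follows by an
  induction that treats all \<open>m\<close> at once.\<close>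

definition bump_profile :: "nat \<Rightarrow> real \<Rightarrow> real" where
  "bump_profile m s = (if s > 0 then exp (- 1 / s) / s ^ m else 0)"

lemma bump_profile_nonneg: "0 \<le> bump_profile m s"
  by (simp add: bump_profile_def)

lemma bump_profile_tendsto_0: "(bump_profile m \<longlongrightarrow> 0) (at_right 0)"
proof -
  have "((\<lambda>s. (inverse s) ^ m / exp (inverse s)) \<longlongrightarrow> 0) (at_right (0::real))"
    by (rule filterlim_compose[OF tendsto_power_div_exp_0 filterlim_inverse_at_top_right])
  moreover have "eventually (\<lambda>s. (inverse s) ^ m / exp (inverse s) = bump_profile m s) (at_right (0::real))"
    unfolding eventually_at_right_field
    by (auto intro!: exI[of _ 1] simp: bump_profile_def exp_minus inverse_eq_divide power_one_over)
  ultimately show ?thesis by (rule Lim_transform_eventually)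
qed

lemma bump_profile_has_derivative:
  "(bump_profile m has_real_derivative bump_profile (m + 2) s - real m * bump_profile (m + 1) s) (at s)"
proof -
  consider "s > 0" | "s < 0" | "s = 0" by linarith
  thus ?thesis
  proof cases
    case 1
    have "((\<lambda>s. exp (- 1 / s) / s ^ m) has_real_derivative bump_profile (m + 2) s - real m * bump_profile (m + 1) s) (at s)"
      using 1 by (auto intro!: derivative_eq_intros simp: bump_profile_def field_simps power2_eq_square)
        (cases m; simp add: field_simps)
    thus ?thesis
      by (rule has_field_derivative_transform_within_open[of _ _ _ "{0<..}"]) (use 1 in \<open>auto simp: bump_profile_def\<close>)
  next
    case 2
    have "((\<lambda>s. 0) has_real_derivative 0) (at s)" by simp
    hence "(bump_profile m has_real_derivative 0) (at s)"
      by (rule has_field_derivative_transform_within_open[of _ _ _ "{..<0}"]) (use 2 in \<open>auto simp: bump_profile_def\<close>)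
    thus ?thesis using 2 by (simp add: bump_profile_def)
  next
    case 3
    have "((\<lambda>h. (bump_profile m (0 + h) - bump_profile m 0) / h) \<longlongrightarrow> 0) (at 0)"
    proof (rule filterlim_split_at)
      show "((\<lambda>h. (bump_profile m (0 + h) - bump_profile m 0) / h) \<longlongrightarrow> 0) (at_left 0)"
        by (rule Lim_transform_eventually[OF tendsto_const])
          (auto simp: eventually_at_left_field bump_profile_def intro!: exI[of _ "-1"])
      \<comment> \<open>For positive h the difference quotient is again a profile, of index
        \<open>Suc m\<close>.\<close>
      show "((\<lambda>h. (bump_profile m (0 + h) - bump_profile m 0) / h) \<longlongrightarrow> 0) (at_right 0)"
        by (rule Lim_transform_eventually[OF bump_profile_tendsto_0[of "Suc m"]])
          (auto simp: eventually_at_right_field bump_profile_def intro!: exI[of _ 1])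
    qed
    thus ?thesis using 3 by (simp add: bump_profile_def DERIV_def)
  qed
qed

lemma continuous_on_bump_profile [continuous_intros]:
  "continuous_on A f \<Longrightarrow> continuous_on A (\<lambda>x. bump_profile m (f x))"
  using continuous_on_compose2[of UNIV "bump_profile m" A f]
    DERIV_isCont[OF bump_profile_has_derivative]
  by (simp add: continuous_at_imp_continuous_on)

lemma partial_deriv_eq:
  assumes "(f has_derivative f') (at x)"
  shows "partial_deriv b f x = f' b"
  unfolding partial_deriv_def frechet_derivative_at[OF assms, symmetric] ..

lemma cont_diff_lower: "cont_diff (Suc k) f \<Longrightarrow> cont_diff k f"
proof (induction k arbitrary: f)
  case 0
  thus ?case by (auto intro!: continuous_at_imp_continuous_on differentiable_imp_continuous_within)
qed auto

lemma cont_diff_add: "cont_diff k f \<Longrightarrow> cont_diff k g \<Longrightarrow> cont_diff k (\<lambda>x. f x + g x)"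
proof (induction k arbitrary: f g)
  case (Suc k)
  have "partial_deriv b (\<lambda>x. f x + g x) = (\<lambda>x. partial_deriv b f x + partial_deriv b g x)" for b
  proof
    fix x
    have "((\<lambda>x. f x + g x) has_derivative (\<lambda>h. frechet_derivative f (at x) h + frechet_derivative g (at x) h)) (at x)"
      using Suc.prems by (intro has_derivative_add) (auto simp: frechet_derivative_works)
    thus "partial_deriv b (\<lambda>x. f x + g x) x = partial_deriv b f x + partial_deriv b g x"
      by (subst partial_deriv_eq) (auto simp: partial_deriv_def)
  qed
  thus ?case using Suc by auto
qed (auto intro: continuous_intros)

lemma cont_diff_cmult: "cont_diff k f \<Longrightarrow> cont_diff k (\<lambda>x. c * f x)"
proof (induction k arbitrary: f)
  case (Suc k)
  have "partial_deriv b (\<lambda>x. c * f x) = (\<lambda>x. c * partial_deriv b f x)" for b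
  proof
    fix x
    have "((\<lambda>x. c * f x) has_derivative (\<lambda>h. c * frechet_derivative f (at x) h)) (at x)"
      using Suc.prems by (intro has_derivative_mult_right) (auto simp: frechet_derivative_works)
    thus "partial_deriv b (\<lambda>x. c * f x) x = c * partial_deriv b f x"
      by (subst partial_deriv_eq) (auto simp: partial_deriv_def)
  qed
  thus ?case using Suc by auto
qed (auto intro: continuous_intros)

text \<open>Partial derivatives of a bump are linear functions times bumps of higher index, so this
  special case of the product rule is enough. The term in which \<open>f\<close> is not
  differentiated is handled by \<open>cont_diff_lower\<close>.\<close>

lemma cont_diff_mult_inner: "cont_diff k f \<Longrightarrow> cont_diff k (\<lambda>x. ((x - z) \<bullet> c) * f x)"
proof (induction k arbitrary: f)
  case (Suc k)
  have d: "((\<lambda>x. ((x - z) \<bullet> c) * f x) has_derivative (\<lambda>h. ((x - z) \<bullet> c) * frechet_derivative f (at x) h + (h \<bullet> c) * f x)) (at x)" for x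
  proof -
    have "(f has_derivative frechet_derivative f (at x)) (at x)"
      using Suc.prems by (auto simp: frechet_derivative_works[symmetric])
    moreover have "((\<lambda>x. (x - z) \<bullet> c) has_derivative (\<lambda>h. h \<bullet> c)) (at x)"
      by (auto intro!: derivative_eq_intros)
    ultimately show ?thesis by (rule has_derivative_mult[rotated])
  qed
  have "partial_deriv b (\<lambda>x. ((x - z) \<bullet> c) * f x) = (\<lambda>x. ((x - z) \<bullet> c) * partial_deriv b f x + (b \<bullet> c) * f x)" for b
    using partial_deriv_eq[OF d] by (auto simp: partial_deriv_def)
  moreover have "(\<lambda>x. ((x - z) \<bullet> c) * f x) differentiable at x" for x
    using d by (auto simp: differentiable_def)
  moreover have "cont_diff k (\<lambda>x. ((x - z) \<bullet> c) * partial_deriv b f x + (b \<bullet> c) * f x)" if "b \<in> Basis" for b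
    using Suc.prems that by (intro cont_diff_add cont_diff_cmult Suc.IH cont_diff_lower[OF Suc.prems]) auto
  ultimately show ?case by simp
qed (auto intro!: continuous_intros)

text \<open>The distance enters squared, as a polynomial in \<open>y\<close>, so the function is
  smooth also at its centre.\<close>

definition bump :: "'a::euclidean_space \<Rightarrow> real \<Rightarrow> nat \<Rightarrow> 'a \<Rightarrow> real" where
  "bump z d m y = bump_profile m (d\<^sup>2 - (y - z) \<bullet> (y - z))"

lemma bump_has_derivative:
  "(bump z d m has_derivative (\<lambda>h. (bump z d (m + 2) y - real m * bump z d (m + 1) y) * (- 2 * ((y - z) \<bullet> h)))) (at y)"
proof -
  have "((\<lambda>y. d\<^sup>2 - (y - z) \<bullet> (y - z)) has_derivative (\<lambda>h. - 2 * ((y - z) \<bullet> h))) (at y)"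
    by (auto intro!: derivative_eq_intros simp: inner_commute)
  from DERIV_compose_FDERIV[OF bump_profile_has_derivative this] show ?thesis
    unfolding bump_def[abs_def] by (simp add: mult_ac)
qed

lemma partial_deriv_bump: "partial_deriv b (bump z d m) y
    = (bump z d (m + 2) y - real m * bump z d (m + 1) y) * (- 2 * ((y - z) \<bullet> b))"
  by (rule partial_deriv_eq[OF bump_has_derivative])

lemma cont_diff_bump: "cont_diff k (bump z d m)"
proof (induction k arbitrary: m)
  case 0
  show ?case unfolding cont_diff.simps bump_def[abs_def] by (intro continuous_intros)
next
  case (Suc k)
  have eq: "partial_deriv b (bump z d m) =
     (\<lambda>y. ((y - z) \<bullet> b) * (- 2 * bump z d (m + 2) y) + ((y - z) \<bullet> b) * (2 * real m * bump z d (m + 1) y))" for b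
    by (simp add: fun_eq_iff partial_deriv_bump algebra_simps)
  have "bump z d m differentiable at y" for y
    unfolding differentiable_def using bump_has_derivative by blast
  moreover have "cont_diff k (partial_deriv b (bump z d m))" for b
    unfolding eq by (intro cont_diff_add cont_diff_mult_inner cont_diff_cmult Suc.IH)
  ultimately show ?case by simp
qed

lemma bump_eq_0: "d > 0 \<Longrightarrow> d \<le> norm (y - z) \<Longrightarrow> bump z d m y = 0"
  using power_mono[of d "norm (y - z)" 2] by (simp add: bump_def bump_profile_def power2_norm_eq_inner)

lemma bump_nonneg: "0 \<le> bump z d m y"
  by (simp add: bump_def bump_profile_nonneg)

lemma test_function_bump:
  assumes "d > 0" shows "test_function (bump z d m)"
proof -
  have "{y. bump z d m y \<noteq> 0} \<subseteq> cball z d"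
    using bump_eq_0[OF assms, of _ z m] by (force simp: dist_norm norm_minus_commute)
  hence "bounded {y. bump z d m y \<noteq> 0}" using bounded_cball bounded_subset by blast
  thus ?thesis unfolding test_function_def by (auto simp: cont_diff_bump compact_closure)
qed

text \<open>The integral is positive and independent of the centre, so one normalising constant
  serves all translates of the mollifier.\<close>

lemma bump_integral:
  fixes z :: "'a::euclidean_space"
  assumes d: "d > 0"
  shows "integrable lborel (bump z d m)" "(\<integral>y. bump z d m y \<partial>lborel) = (\<integral>y. bump (0::'a) d m y \<partial>lborel)"
    "0 < (\<integral>y. bump z d m y \<partial>lborel)"
proof -
  have c: "continuous_on UNIV (bump w d m)" for w :: 'a using cont_diff_bump[of 0 w d m] by simp
  have bm: "bump w d m \<in> borel_measurable borel" for w :: 'a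
    by (rule borel_measurable_continuous_onI[OF c])
  show i: "integrable lborel (bump z d m)" for z :: 'a
  proof (rule integrable_continuous_bounded_support[OF c])
    fix x :: 'a assume "x \<notin> cball 0 (norm z + d)"
    moreover have "norm x \<le> norm z + norm (x - z)" using norm_triangle_ineq[of z "x - z"] by simp
    ultimately show "bump z d m x = 0" using d by (intro bump_eq_0) auto
  qed
  have "(\<integral>y. bump (0::'a) d m y \<partial>lborel) = (\<integral>y. bump (0::'a) d m y \<partial>distr lborel borel (\<lambda>y. y + (- z)))"
    unfolding lborel_distr_translate ..
  also have "\<dots> = (\<integral>y. bump 0 d m (y + (- z)) \<partial>lborel)"
    by (rule integral_distr[OF _ bm]) simp
  also have "\<dots> = (\<integral>y. bump z d m y \<partial>lborel)"
    by (simp add: bump_def[abs_def])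
  finally show "(\<integral>y. bump z d m y \<partial>lborel) = (\<integral>y. bump (0::'a) d m y \<partial>lborel)" ..
  show "0 < (\<integral>y. bump z d m y \<partial>lborel)"
  proof (rule ccontr)
    assume "\<not> ?thesis"
    moreover have "0 \<le> (\<integral>y. bump z d m y \<partial>lborel)" by (intro integral_nonneg_AE) (simp add: bump_nonneg)
    ultimately have "(\<integral>y. bump z d m y \<partial>lborel) = 0" by simp
    hence "AE y in lborel. bump z d m y = 0"
      by (subst (asm) integral_nonneg_eq_0_iff_AE[OF i AE_I2[OF bump_nonneg]])
    moreover have "bump z d m y \<noteq> 0" if "y \<in> ball z d" for y
    proof -
      have "norm (y - z) < d" using that by (simp add: dist_norm norm_minus_commute)
      hence "(norm (y - z))\<^sup>2 < d\<^sup>2" by (intro power_strict_mono) auto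
      thus ?thesis by (simp add: bump_def bump_profile_def power2_norm_eq_inner)
    qed
    ultimately have "AE y in lborel. y \<notin> ball z d" by (auto elim: eventually_mono)
    hence "emeasure lborel (ball z d) = 0"
      by (subst (asm) AE_iff_measurable[of "ball z d"]) auto
    thus False using content_ball_pos[OF d, of z] by (simp add: measure_def)
  qed
qed

section \<open>Mollification and increments along coordinate directions\<close>

lemma integral_mollify_close:
  fixes v :: "'a::euclidean_space \<Rightarrow> 'b::euclidean_space"
  assumes d: "d > 0" and v: "continuous_on UNIV v" and e: "\<And>y. norm (y - z) < d \<Longrightarrow> norm (v y - v z) \<le> e"
  shows "integrable lborel (\<lambda>y. bump z d 0 y *\<^sub>R v y)"
    and "norm ((\<integral>y. bump z d 0 y *\<^sub>R v y \<partial>lborel) - (\<integral>y. bump z d 0 y \<partial>lborel) *\<^sub>R v z) \<le> e * (\<integral>y. bump z d 0 y \<partial>lborel)"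
proof -
  have [measurable]: "v \<in> borel_measurable borel" using v by (rule borel_measurable_continuous_onI)
  have [measurable]: "bump z d 0 \<in> borel_measurable borel"
    using cont_diff_bump[of 0 z d 0] by (auto intro: borel_measurable_continuous_onI)
  note bi = bump_integral(1)[OF d, of z 0]
  have b: "norm (bump z d 0 y *\<^sub>R (v y - v z)) \<le> e * bump z d 0 y" for y
  proof (cases "norm (y - z) < d")
    case True
    thus ?thesis using mult_right_mono[OF e[OF True] bump_nonneg[of z d 0 y]] bump_nonneg[of z d 0 y] by (simp add: mult.commute)
  qed (simp add: bump_eq_0 d)
  have i1: "integrable lborel (\<lambda>y. bump z d 0 y *\<^sub>R (v y - v z))"
    by (rule Bochner_Integration.integrable_bound[of _ "\<lambda>y. e * bump z d 0 y"])
      (use bi b order_trans[OF norm_ge_zero b] in auto)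
  have i2: "integrable lborel (\<lambda>y. bump z d 0 y *\<^sub>R v z)" using bi by (rule integrable_scaleR_left)
  have eq: "bump z d 0 y *\<^sub>R v y = bump z d 0 y *\<^sub>R (v y - v z) + bump z d 0 y *\<^sub>R v z" for y
    by (simp add: algebra_simps)
  show "integrable lborel (\<lambda>y. bump z d 0 y *\<^sub>R v y)"
    unfolding eq using i1 i2 by (rule Bochner_Integration.integrable_add)
  have "(\<integral>y. bump z d 0 y *\<^sub>R v y \<partial>lborel) - (\<integral>y. bump z d 0 y \<partial>lborel) *\<^sub>R v z = (\<integral>y. bump z d 0 y *\<^sub>R (v y - v z) \<partial>lborel)"
    unfolding eq using i1 i2 bi by simp
  also have "norm \<dots> \<le> (\<integral>y. norm (bump z d 0 y *\<^sub>R (v y - v z)) \<partial>lborel)"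
    by (rule integral_norm_bound)
  also have "\<dots> \<le> (\<integral>y. e * bump z d 0 y \<partial>lborel)"
    by (rule Bochner_Integration.integral_mono[OF integrable_norm[OF i1] integrable_mult_right[OF bi] b])
  finally show "norm ((\<integral>y. bump z d 0 y *\<^sub>R v y \<partial>lborel) - (\<integral>y. bump z d 0 y \<partial>lborel) *\<^sub>R v z) \<le> e * (\<integral>y. bump z d 0 y \<partial>lborel)"
    by simp
qed

text \<open>Move the centre of the mollifier along \<open>b\<close> and differentiate under the
  integral. The derivative falls on the bump, a test function, so the weak derivative transfers it
  to \<open>h\<close>, which is bounded by \<open>M\<close>; the mean value inequality
  concludes.\<close>

lemma mollified_increment_bound:
  fixes v :: "'a::euclidean_space \<Rightarrow> 'b::euclidean_space" and x :: 'a
  assumes d: "d > 0" and v: "continuous_on UNIV v" and w: "is_weak_partial b v h" and b: "b \<in> Basis"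
    and M: "AE y in lborel. norm (h y) \<le> M" and t: "t \<ge> 0"
  defines "W \<equiv> \<lambda>s. (\<integral>y. bump (x + s *\<^sub>R b) d 0 y *\<^sub>R v y \<partial>lborel)"
  shows "norm (W t - W 0) \<le> M * (\<integral>y. bump (0::'a) d 0 y \<partial>lborel) * t"
proof -
  define c where "c = (\<integral>y. bump (0::'a) d 0 y \<partial>lborel)"
  define z where "z s = x + s *\<^sub>R b" for s
  define f where "f s y = bump (z s) d 0 y *\<^sub>R v y" for s y
  define D where "D s y = (bump (z s) d 2 y * (2 * ((y - z s) \<bullet> b))) *\<^sub>R v y" for s y
  \<comment> \<open>One box contains the supports of all translates with 0 \<le> s \<le> t, so the
    Leibniz rule on a compact box applies.\<close>
  obtain a where a: "cball x (d + t) \<subseteq> cbox (- a) a"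
    using bounded_subset_cbox_symmetric[OF bounded_cball] by blast
  have supp: "y \<in> cbox (- a) a" if "s \<in> {0..t}" "bump (z s) d m y \<noteq> 0" for s y m
  proof -
    have "norm (y - z s) < d" using that(2) bump_eq_0[OF d, of y "z s" m] by force
    moreover have "norm (z s - x) \<le> t" using that(1) b by (simp add: z_def)
    moreover have "norm (y - x) \<le> norm (y - z s) + norm (z s - x)" using norm_triangle_ineq[of "y - z s" "z s - x"] by simp
    ultimately have "y \<in> cball x (d + t)" by (simp add: dist_norm norm_minus_commute)
    thus ?thesis using a by auto
  qed
  have fD: "((\<lambda>s. f s y) has_vector_derivative D s y) (at s within S)" for s y S
  proof -
    have "((\<lambda>s. d\<^sup>2 - (y - z s) \<bullet> (y - z s)) has_real_derivative 2 * ((y - z s) \<bullet> b)) (at s within S)"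
      unfolding z_def has_field_derivative_def
      by (auto intro!: derivative_eq_intros simp: fun_eq_iff inner_commute algebra_simps)
    from DERIV_chain2[OF bump_profile_has_derivative[of 0] this]
    have "((\<lambda>s. bump (z s) d 0 y) has_real_derivative bump (z s) d 2 y * (2 * ((y - z s) \<bullet> b))) (at s within S)"
      unfolding bump_def by (simp add: eval_nat_numeral)
    thus ?thesis unfolding f_def D_def by (auto intro!: derivative_eq_intros)
  qed
  have cD: "continuous_on UNIV (\<lambda>(s, y). D s y)"
    unfolding D_def bump_def z_def case_prod_unfold by (intro continuous_intros continuous_on_compose2[OF v]) auto
  have cf: "continuous_on UNIV (f s)" for s
    unfolding f_def bump_def z_def by (intro continuous_intros v)
  have cDs: "continuous_on UNIV (D s)" for s
    unfolding D_def bump_def z_def by (intro continuous_intros v)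
  have to_lborel: "integral (cbox (- a) a) g = (\<integral>y. g y \<partial>lborel)"
    if g: "continuous_on UNIV g" "\<And>y. g y \<noteq> 0 \<Longrightarrow> y \<in> cbox (- a) a" for g :: "'a \<Rightarrow> 'b"
  proof -
    have "set_integrable lborel (cbox (- a) a) g"
      unfolding set_integrable_def by (intro borel_integrable_compact continuous_on_subset[OF g(1)]) auto
    hence "integral (cbox (- a) a) g = (LINT y:cbox (- a) a|lborel. g y)"
      by (rule set_borel_integral_eq_integral(2)[symmetric])
    also have "\<dots> = (\<integral>y. g y \<partial>lborel)"
      unfolding set_lebesgue_integral_def using g(2) by (intro Bochner_Integration.integral_cong) (auto simp: indicator_def)
    finally show ?thesis .
  qed
  have W: "W s = integral (cbox (- a) a) (f s)" if "s \<in> {0..t}" for s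
    unfolding W_def f_def z_def[symmetric]
    by (rule to_lborel[OF cf[unfolded f_def], symmetric]) (use supp[OF that] in auto)
  have deriv: "(W has_vector_derivative (\<integral>y. D s y \<partial>lborel)) (at s within {0..t})" if s: "s \<in> {0..t}" for s
  proof -
    have "((\<lambda>s. integral (cbox (- a) a) (f s)) has_vector_derivative integral (cbox (- a) a) (D s)) (at s within {0..t})"
      by (rule leibniz_rule_vector_derivative)
        (use s in \<open>auto intro!: fD integrable_continuous continuous_on_subset[OF cf] continuous_on_subset[OF cD]\<close>)
    hence "(W has_vector_derivative integral (cbox (- a) a) (D s)) (at s within {0..t})"
      by (rule has_vector_derivative_transform[rotated 2]) (use s W in auto)
    also have "integral (cbox (- a) a) (D s) = (\<integral>y. D s y \<partial>lborel)"
      by (rule to_lborel[OF cDs]) (use supp[OF s, of 2] in \<open>auto simp: D_def\<close>)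
    finally show ?thesis .
  qed
  have bound: "norm (\<integral>y. D s y \<partial>lborel) \<le> M * c" for s
  proof -
    \<comment> \<open>Moving the centre along \<open>b\<close> is minus differentiating in y; this
      sign cancels the one in the definition of the weak derivative.\<close>
    have "D s y = - (partial_deriv b (bump (z s) d 0) y *\<^sub>R v y)" for y
      by (simp add: D_def partial_deriv_bump eval_nat_numeral)
    hence "(\<integral>y. D s y \<partial>lborel) = - (\<integral>y. partial_deriv b (bump (z s) d 0) y *\<^sub>R v y \<partial>lborel)" by simp
    also have "\<dots> = (\<integral>y. bump (z s) d 0 y *\<^sub>R h y \<partial>lborel)"
      using w test_function_bump[OF d, of "z s" 0] by (simp add: is_weak_partial_def)
    also have "norm \<dots> \<le> (\<integral>y. M * bump (z s) d 0 y \<partial>lborel)"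
    proof -
      have [measurable]: "h \<in> borel_measurable borel" using w by (simp add: is_weak_partial_def locally_integrable_def)
      have [measurable]: "bump (z s) d 0 \<in> borel_measurable borel"
        using cont_diff_bump[of 0 "z s" d 0] by (auto intro: borel_measurable_continuous_onI)
      have Mb: "integrable lborel (\<lambda>y. M * bump (z s) d 0 y)" using bump_integral(1)[OF d, of "z s" 0] by simp
      have ae: "AE y in lborel. norm (bump (z s) d 0 y *\<^sub>R h y) \<le> M * bump (z s) d 0 y"
        using M
      proof eventually_elim
        case (elim y)
        thus ?case using mult_left_mono[OF elim bump_nonneg[of "z s" d 0 y]] bump_nonneg[of "z s" d 0 y] by (simp add: mult.commute)
      qed
      have "AE y in lborel. norm (bump (z s) d 0 y *\<^sub>R h y) \<le> norm (M * bump (z s) d 0 y)"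
        using ae by eventually_elim auto
      hence i: "integrable lborel (\<lambda>y. bump (z s) d 0 y *\<^sub>R h y)"
        by (intro Bochner_Integration.integrable_bound[OF Mb]) auto
      show ?thesis
        by (rule order_trans[OF integral_norm_bound integral_mono_AE[OF integrable_norm[OF i] Mb ae]])
    qed
    also have "\<dots> = M * c" using bump_integral(2)[OF d, of "z s" 0] by (simp add: c_def)
    finally show ?thesis .
  qed
  have "norm (W t - W 0) \<le> (M * c) * norm (t - 0)"
  proof (rule differentiable_bound[of "{0..t}" W "\<lambda>s h. h *\<^sub>R (\<integral>y. D s y \<partial>lborel)"])
    show "(W has_derivative (\<lambda>h. h *\<^sub>R (\<integral>y. D s y \<partial>lborel))) (at s within {0..t})" if "s \<in> {0..t}" for s
      using deriv[OF that] by (simp add: has_vector_derivative_def)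
    show "onorm (\<lambda>h. h *\<^sub>R (\<integral>y. D s y \<partial>lborel)) \<le> M * c" for s
      by (rule onorm_bound) (use bound[of s] order_trans[OF norm_ge_zero bound[of s]] in \<open>auto simp: mult.commute intro!: mult_left_mono\<close>)
  qed (use t in auto)
  thus ?thesis using t by (simp add: c_def)
qed

text \<open>The mollified increment, divided by the mass of the bump, is bounded by M t for every
  radius. Continuity of \<open>v\<close> allows a radius at which mollification changes the two
  endpoint values by at most e / 2 each, and e is arbitrary.\<close>

lemma directional_lipschitz:
  fixes v :: "'a::euclidean_space \<Rightarrow> 'b::euclidean_space"
  assumes v: "continuous_on UNIV v" and w: "is_weak_partial b v h" and b: "b \<in> Basis"
    and M: "AE y in lborel. norm (h y) \<le> M"
  shows "norm (v (x + t *\<^sub>R b) - v x) \<le> M * \<bar>t\<bar>"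
proof -
  have pos: "norm (v (x + t *\<^sub>R b) - v x) \<le> M * t" if t: "t \<ge> 0" for t x
  proof (rule field_le_epsilon)
    fix e :: real assume e: "e > 0"
    have "isCont v y" for y using v by (simp add: continuous_on_eq_continuous_at)
    hence "\<exists>d>0. \<forall>y'. norm (y' - y) < d \<longrightarrow> norm (v y' - v y) \<le> e / 2" for y
      using e unfolding continuous_at_eps_delta dist_norm by (meson half_gt_zero less_imp_le)
    then obtain d0 d1 where d01: "d0 > 0" "d1 > 0" "\<And>y. norm (y - x) < d0 \<Longrightarrow> norm (v y - v x) \<le> e / 2"
      "\<And>y. norm (y - (x + t *\<^sub>R b)) < d1 \<Longrightarrow> norm (v y - v (x + t *\<^sub>R b)) \<le> e / 2"
      by metis
    define d where "d = min d0 d1"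
    have d: "d > 0" using d01 by (simp add: d_def)
    define c where "c = (\<integral>y. bump (0::'a) d 0 y \<partial>lborel)"
    have c: "c > 0" "(\<integral>y. bump z d 0 y \<partial>lborel) = c" for z :: 'a
      using bump_integral[OF d] by (simp_all add: c_def)
    define I where "I s = (\<integral>y. bump (x + s *\<^sub>R b) d 0 y *\<^sub>R v y \<partial>lborel)" for s
    have 1: "norm (I t - I 0) \<le> M * c * t"
      unfolding I_def c_def by (rule mollified_increment_bound[OF d v w b M t])
    have 2: "norm (I 0 - c *\<^sub>R v x) \<le> e / 2 * c"
      using integral_mollify_close(2)[OF d v, of x "e / 2"] d01(3) unfolding c I_def by (simp add: d_def)
    have 3: "norm (I t - c *\<^sub>R v (x + t *\<^sub>R b)) \<le> e / 2 * c"
      using integral_mollify_close(2)[OF d v, of "x + t *\<^sub>R b" "e / 2"] d01(4) unfolding c I_def by (simp add: d_def)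
    have eq: "c *\<^sub>R (v (x + t *\<^sub>R b) - v x) = (I t - I 0) - (I t - c *\<^sub>R v (x + t *\<^sub>R b)) + (I 0 - c *\<^sub>R v x)"
      by (simp add: algebra_simps)
    have "c * norm (v (x + t *\<^sub>R b) - v x) = norm (c *\<^sub>R (v (x + t *\<^sub>R b) - v x))" using c(1) by simp
    hence "c * norm (v (x + t *\<^sub>R b) - v x) \<le> norm (I t - I 0) + norm (I t - c *\<^sub>R v (x + t *\<^sub>R b)) + norm (I 0 - c *\<^sub>R v x)"
      unfolding eq using norm_triangle_ineq[of "(I t - I 0) - (I t - c *\<^sub>R v (x + t *\<^sub>R b))" "I 0 - c *\<^sub>R v x"]
        norm_triangle_ineq4[of "I t - I 0" "I t - c *\<^sub>R v (x + t *\<^sub>R b)"]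
      by linarith
    also have "\<dots> \<le> c * (M * t + e)" using 1 2 3 by (simp add: algebra_simps)
    finally show "norm (v (x + t *\<^sub>R b) - v x) \<le> M * t + e" using c(1) by simp
  qed
  show ?thesis
  proof (cases "t \<ge> 0")
    case False
    thus ?thesis using pos[of "- t" "x + t *\<^sub>R b"] by (simp add: norm_minus_commute)
  qed (simp add: pos)
qed

text \<open>The path from x to y follows one coordinate axis at a time, so the directional constants
  add up.\<close>

theorem lipschitz_of_bounded_weak_partials:
  fixes v :: "'a::euclidean_space \<Rightarrow> 'b::euclidean_space"
  assumes v: "continuous_on UNIV v" and h: "\<And>b. b \<in> Basis \<Longrightarrow> \<exists>h. is_weak_partial b v h \<and> in_Linf h"
  obtains L where "L-lipschitz_on UNIV v"
proof -
  have "\<exists>M\<ge>0. \<forall>x t. norm (v (x + t *\<^sub>R b) - v x) \<le> M * \<bar>t\<bar>" if b: "b \<in> Basis" for b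
  proof -
    obtain h where w: "is_weak_partial b v h" and h: "in_Linf h" using assms(2)[OF b] by blast
    obtain M where M: "Linf_norm h = ereal M" "M \<ge> 0"
      using h Linf_norm_nonneg[of h] by (cases "Linf_norm h") (auto simp: in_Linf_def)
    have "AE y in lborel. norm (h y) \<le> M" by (rule Linf_norm_AE_bound) (simp add: M)
    thus ?thesis using directional_lipschitz[OF v w b] M(2) by blast
  qed
  then obtain M where M: "\<And>b. b \<in> Basis \<Longrightarrow> M b \<ge> 0" "\<And>b x t. b \<in> Basis \<Longrightarrow> norm (v (x + t *\<^sub>R b) - v x) \<le> M b * \<bar>t\<bar>"
    by metis
  have step: "norm (v (x + (\<Sum>b\<in>A. c b *\<^sub>R b)) - v x) \<le> (\<Sum>b\<in>A. M b * \<bar>c b\<bar>)" if "finite A" "A \<subseteq> Basis" for A c x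
    using that
  proof (induction A)
    case (insert b A)
    have "norm (v (x + (\<Sum>b\<in>insert b A. c b *\<^sub>R b)) - v (x + (\<Sum>b\<in>A. c b *\<^sub>R b))) \<le> M b * \<bar>c b\<bar>"
      using M(2)[of b "x + (\<Sum>b\<in>A. c b *\<^sub>R b)" "c b"] insert by (simp add: algebra_simps)
    moreover have "norm (v (x + (\<Sum>b\<in>A. c b *\<^sub>R b)) - v x) \<le> (\<Sum>b\<in>A. M b * \<bar>c b\<bar>)" using insert by simp
    ultimately show ?case
      using norm_triangle_ineq[of "v (x + (\<Sum>b\<in>insert b A. c b *\<^sub>R b)) - v (x + (\<Sum>b\<in>A. c b *\<^sub>R b))" "v (x + (\<Sum>b\<in>A. c b *\<^sub>R b)) - v x"] insert
      by simp
  qed simp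
  have "(sum M Basis)-lipschitz_on UNIV v"
  proof (rule lipschitz_onI)
    fix x y :: 'a
    have "norm (v (x + (\<Sum>b\<in>Basis. ((y - x) \<bullet> b) *\<^sub>R b)) - v x) \<le> (\<Sum>b\<in>Basis. M b * \<bar>(y - x) \<bullet> b\<bar>)"
      by (rule step) auto
    also have "\<dots> \<le> (\<Sum>b\<in>Basis. M b * norm (y - x))"
      by (intro sum_mono mult_left_mono Basis_le_norm M) auto
    also have "x + (\<Sum>b\<in>Basis. ((y - x) \<bullet> b) *\<^sub>R b) = y" unfolding euclidean_representation by simp
    finally show "dist (v x) (v y) \<le> sum M Basis * dist x y"
      by (simp add: dist_norm norm_minus_commute sum_distrib_right)
  qed (simp add: M sum_nonneg)
  thus ?thesis using that by blast
qed

section \<open>Weak estimate for the empirical measure\<close>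

lemma regular_density_mono: "regular_density M f \<Longrightarrow> M \<le> M' \<Longrightarrow> regular_density M' f"
  unfolding regular_density_def by (auto elim!: eventually_mono)

lemma regular_densityI:
  assumes "in_Linf f" "prob_density f" "compact (ess_support f)" "Linf_norm f \<le> ereal M"
  shows "regular_density M f"
proof -
  obtain R where "AE x in lborel. R < norm x \<longrightarrow> f x = 0" using compact_ess_support_bound[OF assms(3)] by blast
  moreover have "AE x in lborel. \<bar>f x\<bar> \<le> M" using Linf_norm_AE_bound[OF assms(4)] by simp
  ultimately show ?thesis using assms unfolding regular_density_def in_Linf_def by auto
qed

lemma Linf_norm_finite:
  assumes "Linf_norm f < \<infinity>"
  obtains M where "M \<ge> 0" "Linf_norm f \<le> ereal M"
  using assms Linf_norm_nonneg[of f] by (cases "Linf_norm f") auto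

section \<open>Cutoffs and pairings in L2\<close>

definition cutoff :: "real \<Rightarrow> 'a::real_normed_vector \<Rightarrow> real" where
  "cutoff R x = max 0 (min 1 (R + 1 - norm x))"

lemma cutoff:
  shows cutoff_range: "0 \<le> cutoff R x" "cutoff R x \<le> 1"
    and cutoff_inside: "norm x \<le> R \<Longrightarrow> cutoff R x = 1"
    and cutoff_outside: "x \<notin> cball 0 (R + 1) \<Longrightarrow> cutoff R x = 0"
    and cutoff_lipschitz: "\<bar>cutoff R x - cutoff R y\<bar> \<le> norm (x - y)"
  using norm_triangle_ineq2[of x y] norm_triangle_ineq2[of y x]
  by (auto simp: cutoff_def norm_minus_commute)

lemma cutoff_mult_lipschitz:
  fixes F :: "'a::real_normed_vector \<Rightarrow> real"
  assumes F: "L-lipschitz_on UNIV F" "\<And>x. \<bar>F x\<bar> \<le> 1"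
  shows "(L + 1)-lipschitz_on UNIV (\<lambda>x. F x * cutoff R x)"
proof (rule lipschitz_onI)
  fix x y :: 'a
  have "F x * cutoff R x - F y * cutoff R y = (F x - F y) * cutoff R x + F y * (cutoff R x - cutoff R y)"
    by (simp add: algebra_simps)
  hence "\<bar>F x * cutoff R x - F y * cutoff R y\<bar> \<le> \<bar>F x - F y\<bar> * \<bar>cutoff R x\<bar> + \<bar>F y\<bar> * \<bar>cutoff R x - cutoff R y\<bar>"
    by (metis abs_mult abs_triangle_ineq)
  also have "\<dots> \<le> (L * norm (x - y)) * 1 + 1 * norm (x - y)"
    using lipschitz_on_normD[OF F(1), of x y] cutoff_range[of R x] cutoff_lipschitz[of R x y] F(2)[of y]
      lipschitz_on_nonneg[OF F(1)]
    by (intro add_mono mult_mono) auto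
  finally show "dist (F x * cutoff R x) (F y * cutoff R y) \<le> (L + 1) * dist x y"
    by (simp add: dist_norm algebra_simps)
qed (use lipschitz_on_nonneg[OF F(1)] in simp)

text \<open>The modulated energy applies \<open>enn2real\<close> to an L2 norm, which would turn an
  infinite norm into 0. A bounded integrable function is square integrable, by f^2 \<le> |M| |f|, so
  the real value is the true norm.\<close>

lemma L2_norm_eq:
  fixes f :: "'a::euclidean_space \<Rightarrow> real"
  assumes f: "integrable lborel f" "AE x in lborel. \<bar>f x\<bar> \<le> M"
  shows "integrable lborel (\<lambda>x. (f x)\<^sup>2)" "L2_norm f = ennreal (sqrt (\<integral>x. (f x)\<^sup>2 \<partial>lborel))"
proof -
  have [measurable]: "f \<in> borel_measurable borel" using f(1) by auto
  have ae: "AE x in lborel. norm ((f x)\<^sup>2) \<le> norm (M * f x)"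
    using f(2)
  proof eventually_elim
    case (elim x)
    have "\<bar>f x\<bar> * \<bar>f x\<bar> \<le> M * \<bar>f x\<bar>" using elim by (intro mult_right_mono) auto
    also have "\<dots> \<le> \<bar>M\<bar> * \<bar>f x\<bar>" by (intro mult_right_mono) auto
    finally show ?case by (simp add: power2_eq_square abs_mult)
  qed
  show i: "integrable lborel (\<lambda>x. (f x)\<^sup>2)"
    by (rule Bochner_Integration.integrable_bound[OF integrable_mult_right[OF f(1), of M] _ ae]) simp
  have "(\<integral>\<^sup>+x. ennreal ((f x)\<^sup>2) \<partial>lborel) = ennreal (\<integral>x. (f x)\<^sup>2 \<partial>lborel)"
    using i by (rule nn_integral_eq_integral) auto
  thus "L2_norm f = ennreal (sqrt (\<integral>x. (f x)\<^sup>2 \<partial>lborel))"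
    by (simp add: L2_norm_def ennsqrt_def)
qed

text \<open>Cauchy-Schwarz, where the squared L2 norm of \<open>g\<close> is at most the volume of
  the ball that carries it. It removes \<omega> - \<omega>_N from the estimate on the combined
  measure.\<close>

lemma L2_pairing_bound:
  fixes f g :: "'a::euclidean_space \<Rightarrow> real"
  assumes f: "integrable lborel f" "AE x in lborel. \<bar>f x\<bar> \<le> M"
    and g: "continuous_on UNIV g" "\<And>x. \<bar>g x\<bar> \<le> 1" "\<And>x. x \<notin> cball 0 R \<Longrightarrow> g x = 0"
  shows "\<bar>\<integral>x. f x * g x \<partial>lborel\<bar> \<le> enn2real (L2_norm f) * sqrt (measure lborel (cball (0::'a) R))"
proof -
  have [measurable]: "f \<in> borel_measurable borel" "g \<in> borel_measurable borel"
    using f(1) borel_measurable_continuous_onI[OF g(1)] by auto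
  define A where "A = (\<integral>x. (f x)\<^sup>2 \<partial>lborel)"
  define V where "V = measure lborel (cball (0::'a) R)"
  have A: "A \<ge> 0" unfolding A_def by (intro integral_nonneg_AE) auto
  have fA: "(\<integral>\<^sup>+x. (ennreal \<bar>f x\<bar>)\<^sup>2 \<partial>lborel) = ennreal A"
    unfolding A_def using nn_integral_eq_integral[OF L2_norm_eq(1)[OF f]] by (simp add: ennreal_power)
  have gV: "(\<integral>\<^sup>+x. (ennreal \<bar>g x\<bar>)\<^sup>2 \<partial>lborel) \<le> ennreal V"
  proof -
    have "(\<integral>\<^sup>+x. (ennreal \<bar>g x\<bar>)\<^sup>2 \<partial>lborel) \<le> (\<integral>\<^sup>+x. indicator (cball (0::'a) R) x \<partial>lborel)"
    proof (rule nn_integral_mono)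
      fix x :: 'a
      show "(ennreal \<bar>g x\<bar>)\<^sup>2 \<le> indicator (cball 0 R) x"
        using g(2)[of x] g(3)[of x] by (cases "x \<in> cball 0 R") (auto simp: ennreal_power abs_square_le_1)
    qed
    also have "\<dots> = ennreal V"
      unfolding V_def using emeasure_bounded_finite[OF bounded_cball, of "0::'a" R]
      by (simp add: emeasure_eq_ennreal_measure less_top)
    finally show ?thesis .
  qed
  have i: "integrable lborel (\<lambda>x. f x * g x)"
    by (rule Bochner_Integration.integrable_bound[OF f(1)]) (use g(2) in \<open>auto simp: abs_mult intro!: mult_left_le\<close>)
  define T where "T = (\<integral>x. \<bar>f x * g x\<bar> \<partial>lborel)"
  have T0: "T \<ge> 0" unfolding T_def by (intro integral_nonneg_AE) auto
  have "(\<integral>\<^sup>+x. ennreal \<bar>f x\<bar> * ennreal \<bar>g x\<bar> \<partial>lborel) = (\<integral>\<^sup>+x. ennreal \<bar>f x * g x\<bar> \<partial>lborel)"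
    by (simp add: abs_mult ennreal_mult)
  also have "\<dots> = ennreal T"
    unfolding T_def by (rule nn_integral_eq_integral[OF integrable_abs[OF i]]) simp
  finally have "ennreal (T\<^sup>2) = (\<integral>\<^sup>+x. ennreal \<bar>f x\<bar> * ennreal \<bar>g x\<bar> \<partial>lborel)\<^sup>2"
    using T0 by (simp add: ennreal_power)
  also have "\<dots> \<le> ennreal A * ennreal V"
    by (rule order_trans[OF Cauchy_Schwarz_nn_integral]) (auto simp: fA intro!: mult_left_mono gV)
  also have "\<dots> = ennreal (A * V)" using A by (simp add: ennreal_mult V_def)
  finally have "T\<^sup>2 \<le> A * V" using A by (subst (asm) ennreal_le_iff) (auto simp: V_def)
  hence "T \<le> sqrt A * sqrt V" using real_le_rsqrt by (simp add: real_sqrt_mult[symmetric])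
  moreover have "\<bar>\<integral>x. f x * g x \<partial>lborel\<bar> \<le> T" unfolding T_def by (rule integral_abs_bound)
  ultimately show ?thesis using A by (simp add: L2_norm_eq(2)[OF f] A_def V_def)
qed

lemma cmod_cis_diff: "cmod (cis a - cis b) \<le> \<bar>a - b\<bar>"
proof -
  have "cmod (cis (a - b) - 1) \<le> \<bar>a - b\<bar>"
    using iexp_approx1[of "a - b" 0] by (simp add: cis_conv_exp)
  moreover have "cis a - cis b = cis b * (cis (a - b) - 1)" by (simp add: algebra_simps cis_mult)
  ultimately show ?thesis by (simp add: norm_mult)
qed

lemma cos_sin_lipschitz:
  fixes \<theta> :: "'a::metric_space \<Rightarrow> real"
  assumes "L-lipschitz_on UNIV \<theta>"
  shows "L-lipschitz_on UNIV (\<lambda>x. cos (\<theta> x))" "L-lipschitz_on UNIV (\<lambda>x. sin (\<theta> x))"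
proof -
  have "\<bar>cos (\<theta> x) - cos (\<theta> y)\<bar> \<le> L * dist x y \<and> \<bar>sin (\<theta> x) - sin (\<theta> y)\<bar> \<le> L * dist x y" for x y
    using cmod_cis_diff[of "\<theta> x" "\<theta> y"] lipschitz_onD[OF assms, of x y]
      abs_Re_le_cmod[of "cis (\<theta> x) - cis (\<theta> y)"] abs_Im_le_cmod[of "cis (\<theta> x) - cis (\<theta> y)"]
    by (simp add: dist_real_def)
  thus "L-lipschitz_on UNIV (\<lambda>x. cos (\<theta> x))" "L-lipschitz_on UNIV (\<lambda>x. sin (\<theta> x))"
    using lipschitz_on_nonneg[OF assms] by (auto intro!: lipschitz_onI simp: dist_real_def)
qed

section \<open>Estimates for a fixed number of particles\<close>

context
  fixes N :: nat and q :: "nat \<Rightarrow> real^2" and \<omega> \<rho> \<omega>N :: "real^2 \<Rightarrow> real" and M R :: real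
  assumes N: "N \<ge> 1" and inj: "inj_on q {1..N}" and M: "M \<ge> 0"
    and \<omega>: "regular_density M \<omega>" and \<rho>: "regular_density M \<rho>" and \<omega>N: "regular_density M \<omega>N"
    and R: "AE x in lborel. R < norm x \<longrightarrow> \<rho> x = 0"
begin

definition "smeared_energy_bound = 4 * pi * exp 1 * (4 * pi * interaction_energy N \<omega> \<rho> \<omega>N q
    + ln (real N) / real N + 30 * (M * inverse_norm_mass + 1) / sqrt (real N))"

text \<open>The coefficient of the Lipschitz constant in \<open>pairing_lipschitz_bound\<close> at
  \<epsilon> = 1 / N. There 8 is twice the absolute mass 4, and the radius is R + 2 because test
  functions live in radius R + 1 and that bound enlarges it by 1.\<close>

definition "weak_error = (8 / sqrt (real N)
     + sqrt (2 * measure lborel (cball (0::real^2) (R + 2)) * smeared_energy_bound))"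

definition "L2_error = enn2real (L2_norm (\<lambda>x. \<omega> x - \<omega>N x)) * sqrt (measure lborel (cball (0::real^2) (R + 1)))"

text \<open>The energy estimate applies to \<rho> + \<omega> - \<rho>_N - \<omega>_N as a whole.
  Subtracting the contribution of \<omega> - \<omega>_N, bounded in L2, isolates the difference
  between \<rho>_N and \<rho>.\<close>

lemma smeared_pairing_bound:
  assumes g: "L-lipschitz_on UNIV g" "\<And>x. \<bar>g x\<bar> \<le> 1" "\<And>x. x \<notin> cball 0 (R + 1) \<Longrightarrow> g x = 0"
  shows "0 \<le> smeared_energy_bound"
    and "\<bar>(\<integral>x. g x \<partial>empirical_measure N q) - (\<integral>x. \<rho> x * g x \<partial>lborel)\<bar> \<le> L * weak_error + L2_error"
proof -
  define K where "K = M * inverse_norm_mass + 1"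
  have K: "K \<ge> 0" using M inverse_norm_mass_nonneg by (simp add: K_def)
  note d = diffuse_ac_measure[OF _ M, folded K_def]
  note rd = regular_densityD[OF \<omega>] regular_densityD[OF \<rho>] regular_densityD[OF \<omega>N]
  define \<sigma> :: "(real^2) signed_measure" where "\<sigma> = [(1, ac_measure \<rho>), (1, ac_measure \<omega>), (-1, empirical_measure N q), (-1, ac_measure \<omega>N)]"
  define \<epsilon> where "\<epsilon> = 1 / real N"
  have eps: "\<epsilon> > 0" using N by (simp add: \<epsilon>_def)
  note ob = offdiag_energy_lower_bound[OF N inj K rd(7,8) d[OF \<rho>] rd(3,4) d[OF \<omega>] rd(11,12) d[OF \<omega>N], folded \<sigma>_def \<epsilon>_def]
  define E where "E = energy (\<lambda>x. - ln ((norm x)\<^sup>2 + \<epsilon>)) \<sigma>"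
  have ae: "AE z in \<mu> \<Otimes>\<^sub>M \<nu>. 0 < (norm (fst z - snd z))\<^sup>2 + \<epsilon>" for \<mu> \<nu> :: "(real^2) measure"
    using eps by (simp add: add_nonneg_pos)
  note lb = energy_log_lower_bound[OF ob(1,2) less_imp_le[OF eps] ae ob(4), folded E_def]
  define J where "J = smeared_energy_bound"
  have EJ: "4 * pi * exp 1 * E \<le> J"
    unfolding J_def smeared_energy_bound_def using ob(5)
    by (intro mult_left_mono) (auto simp: E_def interaction_energy_def \<sigma>_def K_def)
  have J: "J \<ge> 0" using lb(1) by (intro order_trans[OF _ EJ]) simp
  thus "0 \<le> smeared_energy_bound" by (simp add: J_def)
  have I: "(\<integral>\<^sup>+\<xi>. ennreal (exp (- \<epsilon> * (norm \<xi>)\<^sup>2 / 2) * (cmod (fourier \<sigma> \<xi>))\<^sup>2 / (norm \<xi>)\<^sup>2) \<partial>lborel) \<le> ennreal J"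
    by (rule order_trans[OF lb(2) ennreal_leI[OF EJ]])
  have P: "\<bar>pairing \<sigma> g\<bar> \<le> L * weak_error"
    using pairing_lipschitz_bound[OF ob(1) eps J I g(1) _ g(2), of "R + 1"] g(3) unfolding ob(3)
    by (simp add: weak_error_def J_def \<epsilon>_def real_sqrt_divide algebra_simps)
  have gc: "continuous_on UNIV g" using g(1) by (rule lipschitz_on_continuous_on)
  have gm: "g \<in> borel_measurable borel" using gc by (rule borel_measurable_continuous_onI)
  have int: "integrable lborel f" if "prob_density f" for f :: "real^2 \<Rightarrow> real" using that by (simp add: prob_density_def)
  have ig: "integrable lborel (\<lambda>x. f x * g x)" if "prob_density f" for f
    by (rule Bochner_Integration.integrable_bound[OF int[OF that]])
      (use g(2) gm int[OF that] in \<open>auto simp: abs_mult intro!: mult_left_le\<close>)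
  have D: "\<bar>\<integral>x. (\<omega> x - \<omega>N x) * g x \<partial>lborel\<bar> \<le> L2_error"
    unfolding L2_error_def
  proof (rule L2_pairing_bound[OF _ _ gc g(2,3)])
    show "integrable lborel (\<lambda>x. \<omega> x - \<omega>N x)" using rd int by simp
    have "AE x in lborel. \<bar>\<omega> x\<bar> \<le> M" "AE x in lborel. \<bar>\<omega>N x\<bar> \<le> M" using \<omega> \<omega>N by (auto simp: regular_density_def)
    thus "AE x in lborel. \<bar>\<omega> x - \<omega>N x\<bar> \<le> 2 * M" by eventually_elim linarith
  qed
  have "pairing \<sigma> g = (\<integral>x. \<rho> x * g x \<partial>lborel) + (\<integral>x. \<omega> x * g x \<partial>lborel) - (\<integral>x. g x \<partial>empirical_measure N q) - (\<integral>x. \<omega>N x * g x \<partial>lborel)"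
    unfolding pairing_def \<sigma>_def using rd gm by (simp add: integral_ac_measure(1))
  moreover have "(\<integral>x. (\<omega> x - \<omega>N x) * g x \<partial>lborel) = (\<integral>x. \<omega> x * g x \<partial>lborel) - (\<integral>x. \<omega>N x * g x \<partial>lborel)"
    using rd ig by (simp add: left_diff_distrib)
  ultimately show "\<bar>(\<integral>x. g x \<partial>empirical_measure N q) - (\<integral>x. \<rho> x * g x \<partial>lborel)\<bar> \<le> L * weak_error + L2_error"
    using P D by linarith
qed

text \<open>The mass that the empirical measure carries outside the cutoff is
  controlled by testing against the cutoff itself.\<close>

lemma bounded_lipschitz_estimate:
  assumes F: "L-lipschitz_on UNIV F" "\<And>x. \<bar>F x\<bar> \<le> 1"
  shows "\<bar>(\<integral>x. F x \<partial>empirical_measure N q) - (\<integral>x. \<rho> x * F x \<partial>lborel)\<bar> \<le> 2 * ((L + 1) * weak_error + L2_error)"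
proof -
  define b where "b = (L + 1) * weak_error + L2_error"
  define E where "E = empirical_measure N q"
  have L: "L \<ge> 0" by (rule lipschitz_on_nonneg[OF F(1)])
  note rd = regular_densityD[OF \<rho>]
  have int: "integrable lborel \<rho>" "(\<integral>x. \<rho> x \<partial>lborel) = 1" using rd by (simp_all add: prob_density_def)
  have one: "L-lipschitz_on UNIV (\<lambda>_::real^2. 1::real)" using L by (auto intro!: lipschitz_onI)
  have sup: "G x * cutoff R x = 0" if "x \<notin> cball 0 (R + 1)" for x :: "real^2" and G :: "real^2 \<Rightarrow> real" using cutoff_outside[OF that] by simp
  have le1: "\<bar>F x * cutoff R x\<bar> \<le> 1" for x
    using mult_mono[OF F(2)[of x] cutoff_range(2)[of R x]] cutoff_range(1)[of R x] by (simp add: abs_mult)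
  have 1: "\<bar>(\<integral>x. F x * cutoff R x \<partial>E) - (\<integral>x. \<rho> x * (F x * cutoff R x) \<partial>lborel)\<bar> \<le> b"
    unfolding E_def b_def by (rule smeared_pairing_bound(2)[OF cutoff_mult_lipschitz[OF F, of R] le1 sup[of _ F]])
  have c1: "\<bar>1 * cutoff R x\<bar> \<le> 1" for x :: "real^2" using cutoff_range[of R x] by simp
  have 2: "\<bar>(\<integral>x. 1 * cutoff R x \<partial>E) - (\<integral>x. \<rho> x * (1 * cutoff R x) \<partial>lborel)\<bar> \<le> b"
    unfolding E_def b_def by (rule smeared_pairing_bound(2)[OF cutoff_mult_lipschitz[OF one, of R] c1 sup[of _ "\<lambda>_. 1"]]) auto
  have r: "(\<integral>x. \<rho> x * (G x * cutoff R x) \<partial>lborel) = (\<integral>x. \<rho> x * G x \<partial>lborel)"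
    if G: "G \<in> borel_measurable borel" for G
  proof (rule integral_cong_AE)
    have "cutoff R \<in> borel_measurable (borel :: (real^2) measure)" unfolding cutoff_def[abs_def] by measurable
    note m = this G rd(1)
    show "(\<lambda>x. \<rho> x * (G x * cutoff R x)) \<in> borel_measurable lborel" "(\<lambda>x. \<rho> x * G x) \<in> borel_measurable lborel"
      using m by simp_all
    show "AE x in lborel. \<rho> x * (G x * cutoff R x) = \<rho> x * G x"
      using R by eventually_elim (use cutoff_inside[of _ R] in \<open>force simp: not_less\<close>)
  qed
  have Fc: "continuous_on UNIV F" using F(1) by (rule lipschitz_on_continuous_on)
  have Fm[measurable]: "F \<in> borel_measurable borel" using Fc by (rule borel_measurable_continuous_onI)
  have cm[measurable]: "cutoff R \<in> borel_measurable (borel :: (real^2) measure)" unfolding cutoff_def[abs_def] by measurable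
  define m where "m G = (1 / real N) * (\<Sum>i=1..N. G (q i))" for G :: "real^2 \<Rightarrow> real"
  have E: "(\<integral>x. G x \<partial>E) = m G" if "G \<in> borel_measurable borel" for G
    unfolding E_def m_def using integral_empirical[OF that] by simp
  have "\<bar>m F - m (\<lambda>x. F x * cutoff R x)\<bar> = (1 / real N) * \<bar>\<Sum>i=1..N. F (q i) * (1 - cutoff R (q i))\<bar>"
    unfolding m_def right_diff_distrib[symmetric] sum_subtractf[symmetric] abs_mult by (simp add: algebra_simps)
  also have "\<dots> \<le> (1 / real N) * (\<Sum>i=1..N. 1 - cutoff R (q i))"
  proof (intro mult_left_mono order_trans[OF sum_abs] sum_mono)
    fix i
    show "\<bar>F (q i) * (1 - cutoff R (q i))\<bar> \<le> 1 - cutoff R (q i)"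
      using mult_right_mono[OF F(2)[of "q i"], of "1 - cutoff R (q i)"] cutoff_range[of R "q i"] by (simp add: abs_mult)
  qed auto
  also have "\<dots> = 1 - m (\<lambda>x. 1 * cutoff R x)"
    using N by (simp add: m_def sum_subtractf right_diff_distrib)
  also have "\<dots> \<le> b" using 2 r[of "\<lambda>_. 1"] int E[of "\<lambda>x. 1 * cutoff R x"] by simp
  finally have "\<bar>m F - m (\<lambda>x. F x * cutoff R x)\<bar> \<le> b" .
  moreover have "\<bar>m (\<lambda>x. F x * cutoff R x) - (\<integral>x. \<rho> x * F x \<partial>lborel)\<bar> \<le> b"
    using 1 r[OF Fm] E[of "\<lambda>x. F x * cutoff R x"] by simp
  ultimately have "\<bar>m F - (\<integral>x. \<rho> x * F x \<partial>lborel)\<bar> \<le> 2 * b" by linarith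
  thus ?thesis using E[OF Fm] by (simp add: E_def b_def)
qed

text \<open>Cosine and sine of the phase are Lipschitz with the same constant and bounded by 1;
  adding the two real bounds gives the factor 4.\<close>

lemma oscillatory_estimate:
  assumes \<theta>: "L-lipschitz_on UNIV \<theta>"
  shows "cmod ((\<integral>x. cis (\<theta> x) \<partial>empirical_measure N q) - (\<integral>x. \<rho> x *\<^sub>R cis (\<theta> x) \<partial>lborel)) \<le> 4 * ((L + 1) * weak_error + L2_error)"
proof -
  have [measurable]: "\<theta> \<in> borel_measurable borel"
    using lipschitz_on_continuous_on[OF \<theta>] by (rule borel_measurable_continuous_onI)
  note rd = regular_densityD[OF \<rho>]
  have "integrable lborel \<rho>" using rd by (simp add: prob_density_def)
  hence i: "integrable lborel (\<lambda>x. \<rho> x *\<^sub>R cis (\<theta> x))"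
    by (rule Bochner_Integration.integrable_bound) (use rd in auto)
  define z where "z = (\<integral>x. cis (\<theta> x) \<partial>empirical_measure N q) - (\<integral>x. \<rho> x *\<^sub>R cis (\<theta> x) \<partial>lborel)"
  have "Re z = (\<integral>x. cos (\<theta> x) \<partial>empirical_measure N q) - (\<integral>x. \<rho> x * cos (\<theta> x) \<partial>lborel)"
    "Im z = (\<integral>x. sin (\<theta> x) \<partial>empirical_measure N q) - (\<integral>x. \<rho> x * sin (\<theta> x) \<partial>lborel)"
    unfolding z_def using integral_Re[OF i] integral_Im[OF i] by (simp_all add: integral_empirical)
  hence "\<bar>Re z\<bar> \<le> 2 * ((L + 1) * weak_error + L2_error)" "\<bar>Im z\<bar> \<le> 2 * ((L + 1) * weak_error + L2_error)"
    using bounded_lipschitz_estimate[OF cos_sin_lipschitz(1)[OF \<theta>]] bounded_lipschitz_estimate[OF cos_sin_lipschitz(2)[OF \<theta>]]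
    by simp_all
  thus ?thesis using cmod_le[of z] unfolding z_def by linarith
qed

end

section \<open>Sobolev norms\<close>

lemma nn_integral_inverse_power_tail:
  fixes p :: real
  assumes p: "p > 1/2"
  shows "(\<integral>\<^sup>+(x::real). ennreal ((1 + x\<^sup>2) powr (- p)) \<partial>lborel) < \<infinity>"
proof -
  define F where "F x = ennreal (indicator {0..1} x) + ennreal (x powr (- 2 * p)) * indicator {1..} x" for x :: real
  have [measurable]: "F \<in> borel_measurable borel" unfolding F_def by measurable
  have "((\<lambda>x::real. x powr (1 - 2 * p) / (1 - 2 * p)) \<longlongrightarrow> 0 / (1 - 2 * p)) at_top"
    using p by (intro tendsto_divide tendsto_neg_powr filterlim_ident tendsto_const) auto
  hence "(\<integral>\<^sup>+x. ennreal (x powr (- 2 * p)) * indicator {1..} x \<partial>lborel) = ennreal (0 / (1 - 2 * p) - 1 powr (1 - 2 * p) / (1 - 2 * p))"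
    using p by (intro nn_integral_FTC_atLeast) (auto intro!: derivative_eq_intros)
  moreover have "(\<integral>\<^sup>+(x::real). ennreal (indicator {0..1} x) \<partial>lborel) = ennreal 1"
    by (simp add: ennreal_indicator)
  ultimately have F: "(\<integral>\<^sup>+x. F x \<partial>lborel) < \<infinity>"
    unfolding F_def by (subst nn_integral_add) (auto simp: less_top[symmetric])
  have F': "(\<integral>\<^sup>+x. F (- x) \<partial>lborel) = (\<integral>\<^sup>+x. F x \<partial>lborel)"
  proof -
    have "(\<integral>\<^sup>+x. F x \<partial>distr lborel borel uminus) = (\<integral>\<^sup>+x. F (- x) \<partial>lborel)"
      by (rule nn_integral_distr) auto
    thus ?thesis by (simp add: lborel_distr_uminus)
  qed
  have half: "ennreal ((1 + x\<^sup>2) powr (- p)) \<le> F x" if "x \<ge> 0" for x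
  proof (cases "x \<le> 1")
    case True
    have "(1 + x\<^sup>2) powr (- p) \<le> 1 powr (- p)" using p by (intro powr_mono2') auto
    hence "ennreal ((1 + x\<^sup>2) powr (- p)) \<le> ennreal (indicator {0..1} x)" using True that by (intro ennreal_leI) simp
    thus ?thesis unfolding F_def by (simp add: add_increasing2)
  next
    case False
    have "(1 + x\<^sup>2) powr (- p) \<le> (x\<^sup>2) powr (- p)" using False p by (intro powr_mono2') auto
    also have "x\<^sup>2 = x powr 2" using False by simp
    also have "(x powr 2) powr (- p) = x powr (- 2 * p)" by (simp add: powr_powr)
    finally show ?thesis using False unfolding F_def by (simp add: ennreal_leI)
  qed
  have "(\<integral>\<^sup>+(x::real). ennreal ((1 + x\<^sup>2) powr (- p)) \<partial>lborel) \<le> (\<integral>\<^sup>+x. F x + F (- x) \<partial>lborel)"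
  proof (rule nn_integral_mono)
    fix x :: real
    show "ennreal ((1 + x\<^sup>2) powr (- p)) \<le> F x + F (- x)"
      using half[of x] half[of "- x"] by (cases "x \<ge> 0") (simp_all add: add_increasing add_increasing2)
  qed
  also have "\<dots> = (\<integral>\<^sup>+x. F x \<partial>lborel) + (\<integral>\<^sup>+x. F x \<partial>lborel)"
    by (subst nn_integral_add) (auto simp: F')
  also have "\<dots> < \<infinity>" using F by simp
  finally show ?thesis .
qed

text \<open>The Bessel weight is dominated by a product of one-dimensional weights.\<close>

lemma nn_integral_Bessel_weight:
  assumes s: "s > real DIM('a) / 2"
  shows "(\<integral>\<^sup>+(x::'a::euclidean_space). ennreal ((1 + (norm x)\<^sup>2) powr (- s)) \<partial>lborel) < \<infinity>"
proof -
  define p where "p = s / real DIM('a)"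
  have p: "p > 1/2" "p * real DIM('a) = s" using s by (auto simp: p_def field_simps)
  have "(\<integral>\<^sup>+(x::'a). ennreal ((1 + (norm x)\<^sup>2) powr (- s)) \<partial>lborel)
     \<le> (\<integral>\<^sup>+(x::'a). (\<Prod>b\<in>Basis. ennreal ((1 + (x \<bullet> b)\<^sup>2) powr (- p))) \<partial>lborel)"
  proof (rule nn_integral_mono)
    fix x :: 'a
    have pos: "1 + (norm x)\<^sup>2 > 0" by (simp add: add_pos_nonneg)
    have "(1 + (norm x)\<^sup>2) powr (- s) = (\<Prod>b\<in>(Basis::'a set). (1 + (norm x)\<^sup>2) powr (- p))"
      using pos by (simp add: powr_power p(2)[symmetric] mult.commute)
    also have "\<dots> \<le> (\<Prod>b\<in>Basis. (1 + (x \<bullet> b)\<^sup>2) powr (- p))"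
    proof (intro prod_mono conjI)
      fix b :: 'a assume "b \<in> Basis"
      hence "(x \<bullet> b)\<^sup>2 \<le> (norm x)\<^sup>2" using power_mono[OF Basis_le_norm[of b x], of 2] by simp
      thus "(1 + (norm x)\<^sup>2) powr (- p) \<le> (1 + (x \<bullet> b)\<^sup>2) powr (- p)"
        using p(1) by (intro powr_mono2') (auto simp: add_pos_nonneg)
    qed auto
    finally show "ennreal ((1 + (norm x)\<^sup>2) powr (- s)) \<le> (\<Prod>b\<in>Basis. ennreal ((1 + (x \<bullet> b)\<^sup>2) powr (- p)))"
      by (subst prod_ennreal) (auto intro: ennreal_leI)
  qed
  also have "\<dots> = (\<Prod>b\<in>(Basis::'a set). (\<integral>\<^sup>+x. ennreal ((1 + x\<^sup>2) powr (- p)) \<partial>lborel))"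
    by (rule nn_integral_lborel_prod) auto
  also have "\<dots> < \<infinity>"
    using nn_integral_inverse_power_tail[OF p(1)] by (simp add: less_top[symmetric] power_eq_top_ennreal)
  finally show ?thesis .
qed

lemma borel_measurable_Bessel_weight:
  "(\<lambda>x::'a::euclidean_space. (1 + (norm x)\<^sup>2) powr s) \<in> borel_measurable borel"
proof (intro borel_measurable_continuous_onI continuous_on_powr continuous_intros ballI)
  show "1 + (norm x)\<^sup>2 \<noteq> 0" for x :: 'a using zero_le_power2[of "norm x"] by argo
qed

lemma ennsqrt_le: "x \<le> ennreal r \<Longrightarrow> r \<ge> 0 \<Longrightarrow> ennsqrt x \<le> ennreal (sqrt r)"
  by (cases x) (auto simp: ennsqrt_def top_unique intro!: ennreal_leI)

lemma tendsto_ennsqrt_0: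
  assumes "(f \<longlongrightarrow> 0) F" shows "((\<lambda>x. ennsqrt (f x)) \<longlongrightarrow> 0) F"
proof -
  have "((\<lambda>x. enn2real (f x)) \<longlongrightarrow> enn2real 0) F"
    using assms tendsto_enn2real[of f 0 F] by simp
  hence "((\<lambda>x. ennreal (sqrt (enn2real (f x)))) \<longlongrightarrow> ennreal (sqrt 0)) F"
    by (intro tendsto_ennrealI tendsto_real_sqrt) simp
  moreover have "eventually (\<lambda>x. f x < 1) F" using assms by (rule order_tendstoD) simp
  hence "eventually (\<lambda>x. ennreal (sqrt (enn2real (f x))) = ennsqrt (f x)) F"
    by eventually_elim (auto simp: ennsqrt_def)
  ultimately show ?thesis by (auto intro: Lim_transform_eventually)
qed

lemma norm_fourier_le_abs_mass: "finite_borel \<sigma> \<Longrightarrow> cmod (fourier \<sigma> \<xi>) \<le> abs_mass \<sigma>"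
proof (induction \<sigma>)
  case (Cons p \<sigma>)
  obtain a \<mu> where p: "p = (a, \<mu>)" by fastforce
  interpret finite_measure \<mu> using Cons.prems by (auto simp: p finite_borel_def)
  have "cmod (\<integral>x. cis (- (x \<bullet> \<xi>)) \<partial>\<mu>) \<le> (\<integral>x. cmod (cis (- (x \<bullet> \<xi>))) \<partial>\<mu>)" by (rule integral_norm_bound)
  also have "\<dots> = measure \<mu> (space \<mu>)" by simp
  finally have "cmod (complex_of_real a * (\<integral>x. cis (- (x \<bullet> \<xi>)) \<partial>\<mu>)) \<le> \<bar>a\<bar> * measure \<mu> (space \<mu>)"
    unfolding norm_mult norm_of_real by (intro mult_left_mono) auto
  moreover have "cmod (fourier \<sigma> \<xi>) \<le> abs_mass \<sigma>" using Cons by (simp add: finite_borel_def)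
  ultimately show ?case
    unfolding fourier_def abs_mass_def p by (auto intro: order_trans[OF norm_triangle_ineq])
qed (simp add: fourier_def abs_mass_def)

lemma finite_borel_difference:
  assumes "prob_borel \<mu>" "prob_borel \<nu>"
  shows "finite_borel [(1, \<mu>), (-1, \<nu>)]" "abs_mass [(1, \<mu>), (-1, \<nu>)] = 2"
  using prob_borelD[OF assms(1)] prob_borelD[OF assms(2)] by (auto simp: finite_borel_def abs_mass_def)

lemma Sobolev_norm_difference_tendsto_0:
  fixes \<mu> :: "nat \<Rightarrow> 'a::euclidean_space measure" and \<nu> :: "'a measure"
  assumes pb: "\<And>n. n \<ge> 1 \<Longrightarrow> prob_borel (\<mu> n)" "prob_borel \<nu>" and s: "s < - real DIM('a) / 2"
    and lim: "\<And>\<xi>. (\<lambda>n. fourier [(1, \<mu> n), (-1, \<nu>)] \<xi>) \<longlonglongrightarrow> 0"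
  shows "(\<lambda>n. Sobolev_norm s [(1, \<mu> n), (-1, \<nu>)]) \<longlonglongrightarrow> 0"
proof -
  \<comment> \<open>The shift avoids N = 0, where the empirical measure is not a probability
    measure.\<close>
  define F where "F n = fourier [(1, \<mu> (Suc n)), (-1, \<nu>)]" for n
  note fb = finite_borel_difference[OF pb(1) pb(2)]
  have [measurable]: "F n \<in> borel_measurable borel" for n unfolding F_def by (rule borel_measurable_fourier[OF fb(1)]) simp
  have F2: "cmod (F n \<xi>) \<le> 2" for n \<xi>
    using norm_fourier_le_abs_mass[OF fb(1), of "Suc n" \<xi>] fb(2)[of "Suc n"] by (simp add: F_def)
  have Flim: "(\<lambda>n. F n \<xi>) \<longlonglongrightarrow> 0" for \<xi> unfolding F_def using LIMSEQ_Suc[OF lim] by simp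
  define u where "u n \<xi> = ennreal ((1 + (norm \<xi>)\<^sup>2) powr s * (cmod (F n \<xi>))\<^sup>2 / (2 * pi) ^ DIM('a))" for n and \<xi> :: 'a
  define w where "w \<xi> = ennreal (4 / (2 * pi) ^ DIM('a)) * ennreal ((1 + (norm \<xi>)\<^sup>2) powr (- (- s)))" for \<xi> :: 'a
  have "(\<lambda>n. \<integral>\<^sup>+\<xi>. u n \<xi> \<partial>lborel) \<longlonglongrightarrow> (\<integral>\<^sup>+(\<xi>::'a). 0 \<partial>lborel)"
  proof (rule nn_integral_dominated_convergence[where w = w])
    note m = borel_measurable_Bessel_weight[where 'a = 'a]
    have "(\<lambda>\<xi>. (cmod (F n \<xi>))\<^sup>2) \<in> borel_measurable borel" for n by measurable
    thus "u n \<in> borel_measurable lborel" for n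
      unfolding u_def using m by (intro measurable_compose[OF _ measurable_ennreal] borel_measurable_divide borel_measurable_times) simp_all
    show "w \<in> borel_measurable lborel"
      unfolding w_def using m by (intro borel_measurable_times_ennreal measurable_compose[OF _ measurable_ennreal]) simp_all
    have "(\<integral>\<^sup>+\<xi>. w \<xi> \<partial>lborel) = ennreal (4 / (2 * pi) ^ DIM('a)) * (\<integral>\<^sup>+(\<xi>::'a). ennreal ((1 + (norm \<xi>)\<^sup>2) powr (- (- s))) \<partial>lborel)"
      unfolding w_def by (rule nn_integral_cmult[OF measurable_compose[OF _ measurable_ennreal]]) (simp add: m)
    also have "\<dots> < \<infinity>"
      unfolding infinity_ennreal_def
      by (intro ennreal_mult_less_top[THEN iffD2] conjI disjI2 impI ennreal_less_top
          nn_integral_Bessel_weight[unfolded infinity_ennreal_def]) (use s in linarith)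
    finally show "(\<integral>\<^sup>+\<xi>. w \<xi> \<partial>lborel) < \<infinity>" .
    show "AE \<xi> in lborel. u n \<xi> \<le> w \<xi>" for n
    proof (rule AE_I2)
      fix \<xi> :: 'a
      have "(cmod (F n \<xi>))\<^sup>2 \<le> 2\<^sup>2" by (intro power_mono F2) auto
      hence "(1 + (norm \<xi>)\<^sup>2) powr s * (cmod (F n \<xi>))\<^sup>2 / (2 * pi) ^ DIM('a) \<le> (1 + (norm \<xi>)\<^sup>2) powr s * 4 / (2 * pi) ^ DIM('a)"
        by (intro divide_right_mono mult_left_mono) auto
      also have "\<dots> = 4 / (2 * pi) ^ DIM('a) * (1 + (norm \<xi>)\<^sup>2) powr (- (- s))" by simp
      finally show "u n \<xi> \<le> w \<xi>" unfolding u_def w_def by (subst ennreal_mult[symmetric]) (auto intro!: ennreal_leI)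
    qed
    show "AE \<xi> in lborel. (\<lambda>n. u n \<xi>) \<longlonglongrightarrow> 0"
    proof (rule AE_I2)
      fix \<xi> :: 'a
      have "(\<lambda>n. (1 + (norm \<xi>)\<^sup>2) powr s * (cmod (F n \<xi>))\<^sup>2 / (2 * pi) ^ DIM('a)) \<longlonglongrightarrow> (1 + (norm \<xi>)\<^sup>2) powr s * (cmod 0)\<^sup>2 / (2 * pi) ^ DIM('a)"
        by (intro tendsto_intros Flim) auto
      from tendsto_ennrealI[OF this] show "(\<lambda>n. u n \<xi>) \<longlonglongrightarrow> 0" unfolding u_def by simp
    qed
  qed simp
  hence "(\<lambda>n. ennsqrt (\<integral>\<^sup>+\<xi>. u n \<xi> \<partial>lborel)) \<longlonglongrightarrow> 0" by (intro tendsto_ennsqrt_0) simp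
  hence "(\<lambda>n. Sobolev_norm s [(1, \<mu> (Suc n)), (-1, \<nu>)]) \<longlonglongrightarrow> 0"
    unfolding Sobolev_norm_def u_def F_def .
  thus ?thesis by (rule LIMSEQ_imp_Suc)
qed

text \<open>The linear growth is absorbed through 1 + |\<xi>| \<le> 2 (1 + |\<xi>|^2), which costs
  one power of the Bessel weight; hence the extra 1 in the condition on \<open>s\<close>.\<close>

lemma Sobolev_norm_bound:
  fixes \<sigma> :: "'a::euclidean_space signed_measure"
  assumes A: "A \<ge> 0" and F: "\<And>\<xi>. (cmod (fourier \<sigma> \<xi>))\<^sup>2 \<le> A * (1 + norm \<xi>)" and s: "s < - real DIM('a) / 2 - 1"
  shows "Sobolev_norm s \<sigma> \<le> ennreal (sqrt (A * enn2real (\<integral>\<^sup>+(\<xi>::'a). ennreal (2 * (1 + (norm \<xi>)\<^sup>2) powr (s + 1)) \<partial>lborel)))"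
proof -
  define I where "I = (\<integral>\<^sup>+(\<xi>::'a). ennreal (2 * (1 + (norm \<xi>)\<^sup>2) powr (s + 1)) \<partial>lborel)"
  have "I = ennreal 2 * (\<integral>\<^sup>+(\<xi>::'a). ennreal ((1 + (norm \<xi>)\<^sup>2) powr (- (- s - 1))) \<partial>lborel)"
    unfolding I_def ennreal_mult[OF zero_le_numeral powr_ge_zero]
    by (subst nn_integral_cmult[OF measurable_compose[OF _ measurable_ennreal]])
      (simp_all add: borel_measurable_Bessel_weight add.commute)
  also have "\<dots> < \<infinity>"
    unfolding infinity_ennreal_def
    by (intro ennreal_mult_less_top[THEN iffD2] conjI disjI2 impI ennreal_less_top
        nn_integral_Bessel_weight[unfolded infinity_ennreal_def]) (use s in linarith)
  finally have I: "I < \<infinity>" .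
  have "(\<integral>\<^sup>+\<xi>. ennreal ((1 + (norm \<xi>)\<^sup>2) powr s * (cmod (fourier \<sigma> \<xi>))\<^sup>2 / (2 * pi) ^ DIM('a)) \<partial>lborel)
     \<le> (\<integral>\<^sup>+(\<xi>::'a). ennreal A * ennreal (2 * (1 + (norm \<xi>)\<^sup>2) powr (s + 1)) \<partial>lborel)"
  proof (rule nn_integral_mono)
    fix \<xi> :: 'a
    have pos: "1 + (norm \<xi>)\<^sup>2 > 0" by (simp add: add_pos_nonneg)
    have "0 \<le> (norm \<xi> - 1)\<^sup>2" by simp
    hence "2 * norm \<xi> \<le> (norm \<xi>)\<^sup>2 + 1" by (simp add: power2_diff)
    moreover have "0 \<le> (norm \<xi>)\<^sup>2" by simp
    ultimately have n: "1 + norm \<xi> \<le> 2 * (1 + (norm \<xi>)\<^sup>2)" by argo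
    have "1 \<le> (2 * pi) ^ DIM('a)" using pi_ge_two by (intro one_le_power) linarith
    hence "(1 + (norm \<xi>)\<^sup>2) powr s * (cmod (fourier \<sigma> \<xi>))\<^sup>2 / (2 * pi) ^ DIM('a) \<le> (1 + (norm \<xi>)\<^sup>2) powr s * (cmod (fourier \<sigma> \<xi>))\<^sup>2 / 1"
      by (intro divide_left_mono) auto
    also have "\<dots> \<le> (1 + (norm \<xi>)\<^sup>2) powr s * (A * (2 * (1 + (norm \<xi>)\<^sup>2)))"
      using order_trans[OF F mult_left_mono[OF n A]] by (simp add: mult_left_mono)
    also have "\<dots> = A * (2 * (1 + (norm \<xi>)\<^sup>2) powr (s + 1))"
      using pos by (simp add: powr_add)
    finally show "ennreal ((1 + (norm \<xi>)\<^sup>2) powr s * (cmod (fourier \<sigma> \<xi>))\<^sup>2 / (2 * pi) ^ DIM('a))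
       \<le> ennreal A * ennreal (2 * (1 + (norm \<xi>)\<^sup>2) powr (s + 1))"
      using A by (subst ennreal_mult[symmetric]) (auto intro: ennreal_leI)
  qed
  also have "\<dots> = ennreal A * I"
    unfolding I_def by (rule nn_integral_cmult[OF measurable_compose[OF _ measurable_ennreal]])
      (simp add: borel_measurable_Bessel_weight)
  also have "\<dots> = ennreal (A * enn2real I)" using A I by (simp add: ennreal_mult)
  finally show ?thesis unfolding Sobolev_norm_def I_def[symmetric] using A by (intro ennsqrt_le) auto
qed

text \<open>Under the root, everything is at most a multiple of \<open>H\<close> plus a multiple of
  n powr (- min \<gamma> (1/2)). The square root halves the exponent, which is the origin of
  \<open>\<beta>\<close>.\<close>

lemma weak_error_rate:
  fixes n X H B K V \<gamma> \<beta> :: real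
  assumes n: "n \<ge> 1" and g: "\<gamma> > 0" and \<beta>: "\<beta> = min \<gamma> (1/2) / 2" and K: "K \<ge> 0" and V: "V \<ge> 0" and H: "H \<ge> 0"
    and X: "X \<le> H + \<bar>B\<bar> * n powr (- \<gamma>)"
  shows "8 / sqrt n + sqrt (2 * V * (4 * pi * exp 1 * (4 * pi * X + ln n / n + 30 * K / sqrt n)))
    \<le> (8 + sqrt (2 * V) * (sqrt (16 * pi\<^sup>2 * exp 1) + sqrt (4 * pi * exp 1 * (4 * pi * \<bar>B\<bar> + 2 + 30 * K)))) * (sqrt H + n powr (- \<beta>))"
proof -
  define d where "d = n powr (- \<beta>)"
  have d: "d > 0" using n by (simp add: d_def)
  have d2: "d\<^sup>2 = n powr (- min \<gamma> (1/2))" unfolding d_def \<beta> using n by (simp add: powr_power)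
  have sq: "1 / sqrt n = n powr (- (1/2))" using n by (simp add: powr_minus_divide powr_half_sqrt)
  have g2: "n powr (- \<gamma>) \<le> d\<^sup>2" "1 / sqrt n \<le> d\<^sup>2" unfolding d2 sq using n by (intro powr_mono; simp)+
  have g1: "1 / sqrt n \<le> d" unfolding d_def sq \<beta> using n g by (intro powr_mono) auto
  \<comment> \<open>Writing ln n as 2 ln (sqrt n) brings ln n / n down to the rate 1 / sqrt n of the
    other errors.\<close>
  have "ln n = 2 * ln (sqrt n)" using n by (simp add: ln_sqrt)
  also have "\<dots> \<le> 2 * sqrt n" using n ln_le_minus_one[of "sqrt n"] by simp
  finally have "ln n / n \<le> 2 * sqrt n / n" using n by (intro divide_right_mono) auto
  also have "\<dots> = 2 * (1 / sqrt n)" using n by (simp add: field_simps)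
  finally have ln: "ln n / n \<le> 2 * d\<^sup>2" using g2 by linarith
  have "4 * pi * X + ln n / n + 30 * K / sqrt n \<le> 4 * pi * (H + \<bar>B\<bar> * d\<^sup>2) + 2 * d\<^sup>2 + 30 * K * d\<^sup>2"
  proof (intro add_mono mult_left_mono ln)
    show "X \<le> H + \<bar>B\<bar> * d\<^sup>2" using X mult_left_mono[OF g2(1), of "\<bar>B\<bar>"] by simp
    show "30 * K / sqrt n \<le> 30 * K * d\<^sup>2" using mult_left_mono[OF g2(2), of "30 * K"] K by simp
  qed auto
  hence "4 * pi * exp 1 * (4 * pi * X + ln n / n + 30 * K / sqrt n) \<le> 4 * pi * exp 1 * (4 * pi * (H + \<bar>B\<bar> * d\<^sup>2) + 2 * d\<^sup>2 + 30 * K * d\<^sup>2)"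
    by (intro mult_left_mono) auto
  also have "\<dots> = 16 * pi\<^sup>2 * exp 1 * H + 4 * pi * exp 1 * (4 * pi * \<bar>B\<bar> + 2 + 30 * K) * d\<^sup>2"
    by (simp add: algebra_simps power2_eq_square)
  finally have J: "4 * pi * exp 1 * (4 * pi * X + ln n / n + 30 * K / sqrt n) \<le> 16 * pi\<^sup>2 * exp 1 * H + 4 * pi * exp 1 * (4 * pi * \<bar>B\<bar> + 2 + 30 * K) * d\<^sup>2" .
  define c1 where "c1 = sqrt (16 * pi\<^sup>2 * exp 1)"
  define c2 where "c2 = sqrt (4 * pi * exp 1 * (4 * pi * \<bar>B\<bar> + 2 + 30 * K))"
  have c: "c1 \<ge> 0" "c2 \<ge> 0" using K by (auto simp: c1_def c2_def)
  have "sqrt (2 * V * (4 * pi * exp 1 * (4 * pi * X + ln n / n + 30 * K / sqrt n))) = sqrt (2 * V) * sqrt (4 * pi * exp 1 * (4 * pi * X + ln n / n + 30 * K / sqrt n))"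
    by (rule real_sqrt_mult)
  also have "\<dots> \<le> sqrt (2 * V) * sqrt (16 * pi\<^sup>2 * exp 1 * H + 4 * pi * exp 1 * (4 * pi * \<bar>B\<bar> + 2 + 30 * K) * d\<^sup>2)"
    using V by (intro mult_left_mono real_sqrt_le_mono J) auto
  also have "\<dots> \<le> sqrt (2 * V) * (sqrt (16 * pi\<^sup>2 * exp 1 * H) + sqrt (4 * pi * exp 1 * (4 * pi * \<bar>B\<bar> + 2 + 30 * K) * d\<^sup>2))"
    using V K H by (intro mult_left_mono sqrt_add_le_add_sqrt) auto
  also have "\<dots> = sqrt (2 * V) * (c1 * sqrt H + c2 * d)"
    unfolding real_sqrt_mult[of _ H] real_sqrt_mult[of _ "d\<^sup>2"] using d by (simp add: c1_def c2_def)
  also have "\<dots> \<le> sqrt (2 * V) * ((c1 + c2) * (sqrt H + d))"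
    using V c d H by (intro mult_left_mono) (auto simp: algebra_simps)
  finally have 1: "sqrt (2 * V * (4 * pi * exp 1 * (4 * pi * X + ln n / n + 30 * K / sqrt n))) \<le> sqrt (2 * V) * ((c1 + c2) * (sqrt H + d))" .
  have "8 / sqrt n = 8 * (1 / sqrt n)" by simp
  also have "\<dots> \<le> 8 * (sqrt H + d)" using g1 real_sqrt_ge_zero[OF H] by (intro mult_left_mono) linarith+
  finally have "8 / sqrt n \<le> 8 * (sqrt H + d)" .
  with 1 show ?thesis unfolding c1_def[symmetric] c2_def[symmetric] d_def[symmetric] by (simp add: algebra_simps)
qed

section \<open>Phase-space measures and velocity fluctuations\<close>

lemma prob_borel_monokinetic:
  assumes "f \<in> borel_measurable borel" "prob_density f" "continuous_on UNIV v"
  shows "prob_borel (monokinetic f v)"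
proof -
  note pb = prob_borelD[OF prob_borel_ac_measure[OF assms(1,2)]]
  have "(\<lambda>x. (x, v x)) \<in> ac_measure f \<rightarrow>\<^sub>M borel"
    unfolding measurable_cong_sets[OF pb(4) refl]
    using assms(3) by (intro borel_measurable_continuous_onI continuous_on_Pair) auto
  thus ?thesis unfolding monokinetic_def prob_borel_def by (simp add: prob_space.prob_space_distr[OF pb(1)])
qed

lemma integral_monokinetic:
  fixes g :: "'a::euclidean_space \<times> 'a \<Rightarrow> 'b::{banach, second_countable_topology}"
  assumes f: "f \<in> borel_measurable borel" "prob_density f" and v: "continuous_on UNIV v" and g: "g \<in> borel_measurable borel"
  shows "(\<integral>z. g z \<partial>monokinetic f v) = (\<integral>x. f x *\<^sub>R g (x, v x) \<partial>lborel)"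
proof -
  note pb = prob_borelD[OF prob_borel_ac_measure[OF f]]
  have m: "(\<lambda>x. (x, v x)) \<in> borel_measurable borel"
    using v by (intro borel_measurable_continuous_onI continuous_on_Pair) auto
  have "(\<integral>z. g z \<partial>monokinetic f v) = (\<integral>x. g (x, v x) \<partial>ac_measure f)"
    unfolding monokinetic_def
    by (rule integral_distr[OF _ g]) (simp add: measurable_cong_sets[OF pb(4) refl] m)
  also have "\<dots> = (\<integral>x. f x *\<^sub>R g (x, v x) \<partial>lborel)"
    by (rule integral_ac_measure(1)[OF f measurable_compose[OF m g]])
  finally show ?thesis .
qed

text \<open>The character is Lipschitz in its argument with constant |\<zeta>|, and Cauchy-Schwarz
  turns the mean displacement into the root of the mean square, the form in which it occurs in the
  modulated energy.\<close>

lemma velocity_fluctuation_bound: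
  fixes z w :: "nat \<Rightarrow> 'a::euclidean_space"
  assumes N: "N \<ge> 1"
  shows "cmod ((1 / real N) *\<^sub>R (\<Sum>i=1..N. cis (- (z i \<bullet> \<zeta>))) - (1 / real N) *\<^sub>R (\<Sum>i=1..N. cis (- (w i \<bullet> \<zeta>))))
    \<le> norm \<zeta> * sqrt ((1 / real N) * (\<Sum>i=1..N. (norm (w i - z i))\<^sup>2))"
proof -
  have "cmod ((1 / real N) *\<^sub>R (\<Sum>i=1..N. cis (- (z i \<bullet> \<zeta>))) - (1 / real N) *\<^sub>R (\<Sum>i=1..N. cis (- (w i \<bullet> \<zeta>))))
     = (1 / real N) * cmod (\<Sum>i=1..N. cis (- (z i \<bullet> \<zeta>)) - cis (- (w i \<bullet> \<zeta>)))"
    unfolding scaleR_diff_right[symmetric] sum_subtractf[symmetric] norm_scaleR by simp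
  also have "\<dots> \<le> (1 / real N) * (\<Sum>i=1..N. norm \<zeta> * norm (w i - z i))"
  proof (intro mult_left_mono sum_norm_le)
    fix i
    have "cmod (cis (- (z i \<bullet> \<zeta>)) - cis (- (w i \<bullet> \<zeta>))) \<le> \<bar>(w i - z i) \<bullet> \<zeta>\<bar>"
      using cmod_cis_diff[of "- (z i \<bullet> \<zeta>)" "- (w i \<bullet> \<zeta>)"] by (simp add: inner_diff_left)
    also have "\<dots> \<le> norm (w i - z i) * norm \<zeta>" by (rule Cauchy_Schwarz_ineq2)
    finally show "cmod (cis (- (z i \<bullet> \<zeta>)) - cis (- (w i \<bullet> \<zeta>))) \<le> norm \<zeta> * norm (w i - z i)" by (simp add: mult.commute)
  qed auto
  also have "\<dots> = norm \<zeta> * ((\<Sum>i=1..N. norm (w i - z i)) / real N)" by (simp add: sum_distrib_left[symmetric])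
  also have "\<dots> \<le> norm \<zeta> * sqrt ((1 / real N) * (\<Sum>i=1..N. (norm (w i - z i))\<^sup>2))"
  proof (intro mult_left_mono real_le_rsqrt)
    have "(\<Sum>i=1..N. norm (w i - z i))\<^sup>2 \<le> (\<Sum>i=1..N. (norm (w i - z i))\<^sup>2) * real N"
      using sum_squared_le_sum_of_squares[of "\<lambda>i. norm (w i - z i)" "{1..N}"] by simp
    hence "(\<Sum>i=1..N. norm (w i - z i))\<^sup>2 / (real N)\<^sup>2 \<le> (\<Sum>i=1..N. (norm (w i - z i))\<^sup>2) * real N / (real N)\<^sup>2"
      by (intro divide_right_mono) auto
    thus "((\<Sum>i=1..N. norm (w i - z i)) / real N)\<^sup>2 \<le> (1 / real N) * (\<Sum>i=1..N. (norm (w i - z i))\<^sup>2)"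
      using N by (simp add: power_divide power2_eq_square)
  qed auto
  finally show ?thesis .
qed

lemma L2_norm_minus_commute: "L2_norm (\<lambda>x. f x - g x) = L2_norm (\<lambda>x. g x - f x)"
  unfolding L2_norm_def by (simp add: power2_commute)

text \<open>Exchanging the two densities only changes the sign of the Fourier transform. The factor
  (2 pi)^(-2) of the norm is at most 1 and is dropped.\<close>

lemma homogeneous_Sobolev_norm_difference_le:
  fixes f g :: "real^2 \<Rightarrow> real"
  assumes f: "regular_density M f" and g: "regular_density M g" and M: "M \<ge> 0"
  defines "e \<equiv> (\<integral>z. log_kernel (fst z - snd z) * (f (fst z) - g (fst z)) * (f (snd z) - g (snd z)) \<partial>(lborel \<Otimes>\<^sub>M lborel))"
  shows "0 \<le> e"
    and "homogeneous_Sobolev_norm (-1) [(1, ac_measure g), (-1, ac_measure f)] \<le> ennreal (sqrt (16 * pi\<^sup>2 * exp 1 * e))"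
proof -
  define K where "K = M * inverse_norm_mass + 1"
  have K: "K \<ge> 0" using M inverse_norm_mass_nonneg by (simp add: K_def)
  note rf = regular_densityD[OF f] and rg = regular_densityD[OF g]
  note d = diffuse_ac_measure[OF _ M, folded K_def]
  define \<sigma> :: "(real^2) signed_measure" where "\<sigma> = [(1, ac_measure f), (-1, ac_measure g)]"
  note en = energy_log_kernel_densities[OF K rf(3,4) d[OF f] rg(3,4) d[OF g], folded \<sigma>_def]
  have e: "e = energy log_kernel \<sigma>"
    unfolding e_def \<sigma>_def by (rule interaction_energy_ac_difference[OF rf(1,2) rg(1,2)]) (use en(2) in \<open>simp add: \<sigma>_def\<close>)
  show "0 \<le> e" using en(1) by (simp add: e)
  have "(\<integral>\<^sup>+\<xi>. ennreal (norm \<xi> powr (2 * -1) * (cmod (fourier [(1, ac_measure g), (-1, ac_measure f)] \<xi>))\<^sup>2 / (2 * pi) ^ DIM(real^2)) \<partial>lborel)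
     \<le> (\<integral>\<^sup>+\<xi>. ennreal ((cmod (fourier \<sigma> \<xi>))\<^sup>2 / (norm \<xi>)\<^sup>2) \<partial>lborel)"
  proof (rule nn_integral_mono)
    fix \<xi> :: "real^2"
    have "fourier [(1, ac_measure g), (-1, ac_measure f)] \<xi> = - fourier \<sigma> \<xi>" by (simp add: fourier_def \<sigma>_def)
    moreover have "norm \<xi> powr (2 * -1) = 1 / (norm \<xi>)\<^sup>2"
      by (cases "\<xi> = 0") (simp_all add: powr_minus_divide)
    ultimately have "norm \<xi> powr (2 * -1) * (cmod (fourier [(1, ac_measure g), (-1, ac_measure f)] \<xi>))\<^sup>2 / (2 * pi) ^ DIM(real^2)
       = ((cmod (fourier \<sigma> \<xi>))\<^sup>2 / (norm \<xi>)\<^sup>2) / (2 * pi) ^ DIM(real^2)" by simp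
    also have "1 \<le> (2 * pi) ^ DIM(real^2)" using pi_ge_two by (intro one_le_power) linarith
    hence "((cmod (fourier \<sigma> \<xi>))\<^sup>2 / (norm \<xi>)\<^sup>2) / (2 * pi) ^ DIM(real^2) \<le> ((cmod (fourier \<sigma> \<xi>))\<^sup>2 / (norm \<xi>)\<^sup>2) / 1"
      by (intro divide_left_mono) auto
    finally show "ennreal (norm \<xi> powr (2 * -1) * (cmod (fourier [(1, ac_measure g), (-1, ac_measure f)] \<xi>))\<^sup>2 / (2 * pi) ^ DIM(real^2))
       \<le> ennreal ((cmod (fourier \<sigma> \<xi>))\<^sup>2 / (norm \<xi>)\<^sup>2)" by (intro ennreal_leI) simp
  qed
  also have "\<dots> \<le> ennreal (16 * pi\<^sup>2 * exp 1 * e)" using en(3) by (simp add: e)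
  finally show "homogeneous_Sobolev_norm (-1) [(1, ac_measure g), (-1, ac_measure f)] \<le> ennreal (sqrt (16 * pi\<^sup>2 * exp 1 * e))"
    unfolding homogeneous_Sobolev_norm_def using \<open>0 \<le> e\<close> by (intro ennsqrt_le) auto
qed

lemma Winf_2_lipschitz:
  fixes v :: "'a::euclidean_space \<Rightarrow> 'b::euclidean_space"
  assumes "in_Winf 2 v" "continuous_on UNIV v"
  obtains L where "L-lipschitz_on UNIV v"
proof (rule lipschitz_of_bounded_weak_partials[OF assms(2)])
  fix b :: 'a assume b: "b \<in> Basis"
  have "in_Winf (Suc (Suc 0)) v" using assms(1) by (simp add: numeral_2_eq_2)
  then show "\<exists>h. is_weak_partial b v h \<and> in_Linf h" using b by auto
qed (use that in auto)

theorem proposition1p11: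
  fixes Q P :: "nat \<Rightarrow> nat \<Rightarrow> real^2"
    and \<omega> \<rho> :: "real^2 \<Rightarrow> real"
    and \<omega>N :: "nat \<Rightarrow> real^2 \<Rightarrow> real"
    and v :: "real^2 \<Rightarrow> real^2"
    and B \<gamma> :: real
  defines "H \<equiv> \<lambda>N. modulated_energy B \<gamma> N \<omega> \<rho> v (\<omega>N N) (Q N) (P N)"
  assumes Q_distinct: "\<And>N. N \<ge> 1 \<Longrightarrow> inj_on (Q N) {1..N}"
    and \<omega>: "in_Linf \<omega>" "prob_density \<omega>" "compact (ess_support \<omega>)"
    and \<rho>: "in_Linf \<rho>" "prob_density \<rho>" "compact (ess_support \<rho>)"
    and \<omega>N: "\<And>N. N \<ge> 1 \<Longrightarrow> in_Linf (\<omega>N N)" "\<And>N. N \<ge> 1 \<Longrightarrow> prob_density (\<omega>N N)"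
      "\<And>N. N \<ge> 1 \<Longrightarrow> compact (ess_support (\<omega>N N))"
    and v: "in_Winf 2 v" "continuous_on UNIV v"
    and \<omega>N_bounded: "(SUP N\<in>{1..}. Linf_norm (\<omega>N N)) < \<infinity>"
    and \<gamma>: "0 < \<gamma>" "\<gamma> < 1"
    and B: "\<And>N. N \<ge> 1 \<Longrightarrow>
      0 \<le> interaction_energy N \<omega> \<rho> (\<omega>N N) (Q N) + B * real N powr (- \<gamma>)"
  shows "(\<exists>C>0. \<exists>\<beta>>0. \<forall>N\<ge>1.
           Sobolev_norm (-5)
             [(1, empirical_measure N (\<lambda>i. (Q N i, P N i))), (-1, monokinetic \<rho> v)]
           \<le> ennreal (C * (1 + (real_of_ereal (grad_Winf_norm 1 v))\<^sup>2)
               * sqrt (sqrt (H N)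
                   + (1 + real_of_ereal (Linf_norm \<rho>)) * real N powr (- \<beta>))))
       \<and> (H \<longlonglongrightarrow> 0 \<longrightarrow>
           (\<forall>a<(-1). (\<lambda>N. Sobolev_norm a [(1, empirical_measure N (Q N)), (-1, ac_measure \<rho>)])
                     \<longlonglongrightarrow> 0)
         \<and> (\<lambda>N. L2_norm (\<lambda>x. \<omega>N N x - \<omega> x)) \<longlonglongrightarrow> 0
         \<and> (\<lambda>N. homogeneous_Sobolev_norm (-1) [(1, ac_measure (\<omega>N N)), (-1, ac_measure \<omega>)])
             \<longlonglongrightarrow> 0
         \<and> (\<lambda>N. Sobolev_norm (-5)
               [(1, empirical_measure N (\<lambda>i. (Q N i, P N i))), (-1, monokinetic \<rho> v)])
             \<longlonglongrightarrow> 0)"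
proof -
  define pos where "pos N = (\<integral>z. log_kernel (fst z - snd z) * (\<omega> (fst z) - \<omega>N N (fst z)) * (\<omega> (snd z) - \<omega>N N (snd z))
      \<partial>(lborel \<Otimes>\<^sub>M lborel))" for N
  define l2 where "l2 N = enn2real (L2_norm (\<lambda>x. \<omega> x - \<omega>N N x))" for N
  define kin where "kin N = (1 / real N) * (\<Sum>i=1..N. (norm (v (Q N i) - P N i))\<^sup>2)" for N
  define X where "X N = interaction_energy N \<omega> \<rho> (\<omega>N N) (Q N)" for N
  have H: "H N = kin N + X N + pos N + (l2 N)\<^sup>2 + B * real N powr (- \<gamma>)" for N
    by (simp add: H_def modulated_energy_def kin_def X_def pos_def l2_def)

  \<comment> \<open>One bound for all densities at once; uniformity in N comes from the finite
    supremum of the norms of the \<omega>_N.\<close>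
  obtain M where M: "M \<ge> 0" "regular_density M \<omega>" "regular_density M \<rho>" "\<And>N. N \<ge> 1 \<Longrightarrow> regular_density M (\<omega>N N)"
  proof -
    obtain m1 where m1: "m1 \<ge> 0" "Linf_norm \<omega> \<le> ereal m1" using \<omega>(1) Linf_norm_finite[of \<omega>] by (auto simp: in_Linf_def)
    obtain m2 where m2: "m2 \<ge> 0" "Linf_norm \<rho> \<le> ereal m2" using \<rho>(1) Linf_norm_finite[of \<rho>] by (auto simp: in_Linf_def)
    obtain m3 where m3: "m3 \<ge> 0" "(SUP N\<in>{1..}. Linf_norm (\<omega>N N)) \<le> ereal m3"
    proof -
      have "0 \<le> (SUP N\<in>{1..}. Linf_norm (\<omega>N N))"
        by (rule SUP_upper2[of 1]) (auto simp: Linf_norm_nonneg)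
      thus ?thesis using \<omega>N_bounded that by (cases "SUP N\<in>{1..}. Linf_norm (\<omega>N N)") auto
    qed
    have "Linf_norm (\<omega>N N) \<le> ereal m3" if "N \<ge> 1" for N
      using m3(2) that by (meson SUP_upper atLeast_iff order_trans)
    hence "regular_density (max m1 (max m2 m3)) (\<omega>N N)" if "N \<ge> 1" for N
      using that by (intro regular_density_mono[OF regular_densityI[OF \<omega>N]]) auto
    thus ?thesis using that[of "max m1 (max m2 m3)"] m1 m2
      by (meson max.cobounded1 max.cobounded2 order_trans regular_densityI regular_density_mono \<omega> \<rho>)
  qed
  obtain R where R: "R \<ge> 0" "AE x in lborel. R < norm x \<longrightarrow> \<rho> x = 0" by (rule compact_ess_support_bound[OF \<rho>(3)])
  obtain Lv where Lv: "Lv-lipschitz_on UNIV v" by (rule Winf_2_lipschitz[OF v])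
  have Lv0: "Lv \<ge> 0" using Lv by (rule lipschitz_on_nonneg)

  have kin0: "0 \<le> kin N" for N unfolding kin_def by (intro mult_nonneg_nonneg sum_nonneg) auto
  have pos0: "0 \<le> pos N" if "N \<ge> 1" for N
    unfolding pos_def by (rule homogeneous_Sobolev_norm_difference_le(1)[OF M(2) M(4)[OF that] M(1)])
  have XB: "0 \<le> X N + B * real N powr (- \<gamma>)" if "N \<ge> 1" for N using B[OF that] by (simp add: X_def)
  \<comment> \<open>\<open>X N\<close> may be negative, but with its correction it is nonnegative,
    so \<open>H N\<close> is a sum of nonnegative groups and dominates each of them.
    \<open>X N\<close> alone is dominated only up to the correction, with an absolute value because
    \<open>B\<close> may have either sign.\<close>
  have parts: "0 \<le> H N" "kin N \<le> H N" "pos N \<le> H N" "(l2 N)\<^sup>2 \<le> H N" "X N \<le> H N + \<bar>B\<bar> * real N powr (- \<gamma>)" if "N \<ge> 1" for N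
  proof -
    have "0 \<le> (l2 N)\<^sup>2" by simp
    moreover have "- B * real N powr (- \<gamma>) \<le> \<bar>B\<bar> * real N powr (- \<gamma>)" by (intro mult_right_mono) auto
    ultimately show "0 \<le> H N" "kin N \<le> H N" "pos N \<le> H N" "(l2 N)\<^sup>2 \<le> H N" "X N \<le> H N + \<bar>B\<bar> * real N powr (- \<gamma>)"
      using kin0[of N] pos0[OF that] XB[OF that] unfolding H by linarith+
  qed
  have l2: "L2_norm (\<lambda>x. \<omega> x - \<omega>N N x) = ennreal (l2 N)" "0 \<le> l2 N" "l2 N \<le> sqrt (H N)" if "N \<ge> 1" for N
  proof -
    note rd = M(2) M(4)[OF that]
    have "integrable lborel (\<lambda>x. \<omega> x - \<omega>N N x)" using \<omega>(2) \<omega>N(2)[OF that] by (simp add: prob_density_def)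
    moreover have "AE x in lborel. \<bar>\<omega> x\<bar> \<le> M" "AE x in lborel. \<bar>\<omega>N N x\<bar> \<le> M" using rd by (auto simp: regular_density_def)
    hence "AE x in lborel. \<bar>\<omega> x - \<omega>N N x\<bar> \<le> 2 * M" by eventually_elim linarith
    ultimately show "L2_norm (\<lambda>x. \<omega> x - \<omega>N N x) = ennreal (l2 N)" by (simp add: l2_def L2_norm_eq(2))
    show "0 \<le> l2 N" by (simp add: l2_def)
    show "l2 N \<le> sqrt (H N)" using parts(4)[OF that] by (rule real_le_rsqrt)
  qed

  define \<beta> where "\<beta> = min \<gamma> (1/2) / 2"
  have \<beta>: "\<beta> > 0" using \<gamma> by (simp add: \<beta>_def)
  define \<delta> where "\<delta> N = sqrt (H N) + real N powr (- \<beta>)" for N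
  have \<delta>0: "0 \<le> \<delta> N" "sqrt (H N) \<le> \<delta> N" if "N \<ge> 1" for N using parts(1)[OF that] by (auto simp: \<delta>_def)
  define K where "K = M * inverse_norm_mass + 1"
  have K: "K \<ge> 0" using M(1) inverse_norm_mass_nonneg by (simp add: K_def)
  define V1 where "V1 = measure lborel (cball (0::real^2) (R + 1))"
  define V2 where "V2 = measure lborel (cball (0::real^2) (R + 2))"
  define c where "c = 8 + sqrt (2 * V2) * (sqrt (16 * pi\<^sup>2 * exp 1) + sqrt (4 * pi * exp 1 * (4 * pi * \<bar>B\<bar> + 2 + 30 * K)))"
  define C0 where "C0 = c + sqrt V1"
  have V: "V1 \<ge> 0" "V2 \<ge> 0" by (simp_all add: V1_def V2_def)
  have C0: "C0 \<ge> 0" using K V by (simp add: C0_def c_def)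
  \<comment> \<open>Both errors of \<open>oscillatory_estimate\<close> are at most constant
    multiples of \<open>\<delta> N\<close>. The volumes \<open>V1\<close> and \<open>V2\<close>
    involve only the support radius of \<rho>, so \<open>C0\<close> is independent of N.\<close>
  have osc: "cmod ((\<integral>x. cis (\<theta> x) \<partial>empirical_measure N (Q N)) - (\<integral>x. \<rho> x *\<^sub>R cis (\<theta> x) \<partial>lborel)) \<le> 4 * ((L + 1) * C0 * \<delta> N)"
    if N: "N \<ge> 1" and \<theta>: "L-lipschitz_on UNIV \<theta>" for N L \<theta>
  proof -
    have L: "L \<ge> 0" using \<theta> by (rule lipschitz_on_nonneg)
    define w where "w = weak_error N (Q N) \<omega> \<rho> (\<omega>N N) M R"
    define l where "l = L2_error \<omega> (\<omega>N N) R"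
    have 1: "cmod ((\<integral>x. cis (\<theta> x) \<partial>empirical_measure N (Q N)) - (\<integral>x. \<rho> x *\<^sub>R cis (\<theta> x) \<partial>lborel)) \<le> 4 * ((L + 1) * w + l)"
      unfolding w_def l_def by (rule oscillatory_estimate[OF N Q_distinct[OF N] M(1,2,3) M(4)[OF N] R(2) \<theta>])
    have w: "w \<le> c * \<delta> N"
      unfolding w_def weak_error_def[OF N Q_distinct[OF N] M(1,2,3) M(4)[OF N] R(2)]
        smeared_energy_bound_def[OF N Q_distinct[OF N] M(1,2,3) M(4)[OF N] R(2)] c_def \<delta>_def V2_def
      using weak_error_rate[OF _ \<gamma>(1) \<beta>_def K, of "real N" V2 "H N" "X N" B] N V(2) parts[OF N]
      by (simp add: K_def V2_def X_def)
    have "l = l2 N * sqrt V1"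
      unfolding l_def L2_error_def[OF N Q_distinct[OF N] M(1,2,3) M(4)[OF N] R(2)] l2_def V1_def ..
    also have "\<dots> \<le> \<delta> N * sqrt V1" using l2(3)[OF N] \<delta>0(2)[OF N] V by (intro mult_right_mono) auto
    also have "\<dots> \<le> (L + 1) * (\<delta> N * sqrt V1)" using L \<delta>0[OF N] V by (simp add: mult_le_cancel_right1 algebra_simps)
    finally have l: "l \<le> (L + 1) * (\<delta> N * sqrt V1)" .
    have "(L + 1) * w \<le> (L + 1) * (c * \<delta> N)" using w L by (intro mult_left_mono) auto
    hence "4 * ((L + 1) * w + l) \<le> 4 * ((L + 1) * C0 * \<delta> N)" using l by (simp add: C0_def algebra_simps)
    with 1 show ?thesis by linarith
  qed

  note \<rho>m = regular_densityD[OF M(3)]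
  have pbE: "prob_borel (empirical_measure N z)" if "N \<ge> 1" for N and z :: "nat \<Rightarrow> 'z::euclidean_space"
    using that by (rule prob_borel_empirical)
  note pbM = prob_borel_monokinetic[OF \<rho>m(1,2) v(2)]
  define \<mu> where "\<mu> N = empirical_measure N (\<lambda>i. (Q N i, P N i))" for N
  have cm: "(\<lambda>x. cis (- (x \<bullet> \<xi>))) \<in> borel_measurable borel" for \<xi> :: "'z::euclidean_space" by measurable

  define C2 where "C2 = 1 + 4 * ((1 + Lv) * C0)"
  have C2: "C2 \<ge> 0" using Lv0 C0 by (simp add: C2_def)
  have F: "cmod (fourier [(1, \<mu> N), (-1, monokinetic \<rho> v)] \<zeta>) \<le> C2 * (1 + norm \<zeta>) * \<delta> N" if N: "N \<ge> 1" for N \<zeta>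
  proof -
    define \<theta> where "\<theta> x = - ((x, v x) \<bullet> \<zeta>)" for x
    have \<theta>: "((1 + Lv) * norm \<zeta>)-lipschitz_on UNIV \<theta>"
    proof (rule lipschitz_onI)
      fix x y :: "real^2"
      have "\<bar>\<theta> x - \<theta> y\<bar> = \<bar>(y - x, v y - v x) \<bullet> \<zeta>\<bar>" by (simp add: \<theta>_def inner_diff_left flip: diff_Pair)
      also have "\<dots> \<le> norm (y - x, v y - v x) * norm \<zeta>" by (rule Cauchy_Schwarz_ineq2)
      also have "\<dots> \<le> (norm (y - x) + norm (v y - v x)) * norm \<zeta>" by (intro mult_right_mono norm_Pair_le) auto
      also have "\<dots> \<le> (norm (y - x) + Lv * norm (y - x)) * norm \<zeta>"
        using lipschitz_on_normD[OF Lv, of y x] by (intro mult_right_mono add_left_mono) auto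
      finally show "dist (\<theta> x) (\<theta> y) \<le> (1 + Lv) * norm \<zeta> * dist x y"
        by (simp add: dist_norm norm_minus_commute algebra_simps)
    qed (use Lv0 in simp)
    have \<theta>m: "(\<lambda>x. cis (\<theta> x)) \<in> borel_measurable borel"
      using lipschitz_on_continuous_on[OF \<theta>] by (intro measurable_compose[OF borel_measurable_continuous_onI borel_measurable_cis])
    \<comment> \<open>First the velocities \<open>P N i\<close> are replaced by v (Q N i), at the
      cost of the kinetic term. What remains is the position measure tested on the phase
      \<open>\<theta>\<close>.\<close>
    define D where "D = (1 / real N) *\<^sub>R (\<Sum>i=1..N. cis (- ((Q N i, P N i) \<bullet> \<zeta>))) - (1 / real N) *\<^sub>R (\<Sum>i=1..N. cis (- ((Q N i, v (Q N i)) \<bullet> \<zeta>)))"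
    have f: "fourier [(1, \<mu> N), (-1, monokinetic \<rho> v)] \<zeta> =
       D
       + ((\<integral>x. cis (\<theta> x) \<partial>empirical_measure N (Q N)) - (\<integral>x. \<rho> x *\<^sub>R cis (\<theta> x) \<partial>lborel))"
      unfolding fourier_def \<mu>_def D_def integral_empirical[OF \<theta>m]
      by (simp add: integral_empirical[OF cm] integral_monokinetic[OF \<rho>m(1,2) v(2) cm] \<theta>_def)
    have nPair: "norm ((Q N i, v (Q N i)) - (Q N i, P N i)) = norm (v (Q N i) - P N i)" for i
      by (simp add: norm_Pair)
    have "cmod D
       \<le> norm \<zeta> * sqrt ((1 / real N) * (\<Sum>i=1..N. (norm ((Q N i, v (Q N i)) - (Q N i, P N i)))\<^sup>2))"
      unfolding D_def by (rule velocity_fluctuation_bound[OF N])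
    also have "\<dots> = norm \<zeta> * sqrt (kin N)" unfolding nPair kin_def ..
    also have "\<dots> \<le> norm \<zeta> * \<delta> N"
      by (intro mult_left_mono order_trans[OF real_sqrt_le_mono[OF parts(2)[OF N]] \<delta>0(2)[OF N]]) simp
    finally have 1: "cmod D \<le> norm \<zeta> * \<delta> N" .
    have "(1 + Lv) * norm \<zeta> + 1 \<le> (1 + Lv) * (1 + norm \<zeta>)" using Lv0 by (simp add: algebra_simps)
    hence "4 * (((1 + Lv) * norm \<zeta> + 1) * C0 * \<delta> N) \<le> 4 * (((1 + Lv) * (1 + norm \<zeta>)) * C0 * \<delta> N)"
      using C0 \<delta>0[OF N] by (intro mult_left_mono mult_right_mono) auto
    with 1 osc[OF N \<theta>] have "cmod (fourier [(1, \<mu> N), (-1, monokinetic \<rho> v)] \<zeta>) \<le> norm \<zeta> * \<delta> N + 4 * (((1 + Lv) * (1 + norm \<zeta>)) * C0 * \<delta> N)"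
      unfolding f by (intro order_trans[OF norm_triangle_ineq]) linarith
    also have "\<dots> \<le> C2 * (1 + norm \<zeta>) * \<delta> N" using \<delta>0[OF N] by (simp add: C2_def algebra_simps)
    finally show ?thesis .
  qed

  \<comment> \<open>The phase space has dimension 4, so the weight is integrable for every exponent
    below - 2, and - 5 + 1 satisfies this.\<close>
  define I where "I = enn2real (\<integral>\<^sup>+(\<xi>::(real^2) \<times> (real^2)). ennreal (2 * (1 + (norm \<xi>)\<^sup>2) powr (- 5 + 1)) \<partial>lborel)"
  have Sob5: "Sobolev_norm (-5) [(1, \<mu> N), (-1, monokinetic \<rho> v)] \<le> ennreal (sqrt (2 * C2 * I) * sqrt (\<delta> N))" if N: "N \<ge> 1" for N
  proof -
    have "(cmod (fourier [(1, \<mu> N), (-1, monokinetic \<rho> v)] \<zeta>))\<^sup>2 \<le> (2 * C2 * \<delta> N) * (1 + norm \<zeta>)" for \<zeta>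
    proof -
      have fb: "prob_borel (\<mu> N)" unfolding \<mu>_def by (rule prob_borel_empirical[OF N])
      have "cmod (fourier [(1, \<mu> N), (-1, monokinetic \<rho> v)] \<zeta>) \<le> 2"
        using norm_fourier_le_abs_mass[OF finite_borel_difference(1)[OF fb pbM]] finite_borel_difference(2)[OF fb pbM] by simp
      hence "cmod (fourier [(1, \<mu> N), (-1, monokinetic \<rho> v)] \<zeta>) * cmod (fourier [(1, \<mu> N), (-1, monokinetic \<rho> v)] \<zeta>)
         \<le> 2 * (C2 * (1 + norm \<zeta>) * \<delta> N)" using F[OF N, of \<zeta>] by (intro mult_mono) auto
      thus ?thesis by (simp add: power2_eq_square mult_ac)
    qed
    hence "Sobolev_norm (-5) [(1, \<mu> N), (-1, monokinetic \<rho> v)] \<le> ennreal (sqrt ((2 * C2 * \<delta> N) * I))"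
      unfolding I_def using C2 \<delta>0[OF N] by (intro Sobolev_norm_bound) auto
    also have "(2 * C2 * \<delta> N) * I = (2 * C2 * I) * \<delta> N" by simp
    finally show ?thesis by (simp only: real_sqrt_mult[of "2 * C2 * I"])
  qed

  have bound: "\<exists>C>0. \<exists>\<beta>>0. \<forall>N\<ge>1.
           Sobolev_norm (-5)
             [(1, empirical_measure N (\<lambda>i. (Q N i, P N i))), (-1, monokinetic \<rho> v)]
           \<le> ennreal (C * (1 + (real_of_ereal (grad_Winf_norm 1 v))\<^sup>2)
               * sqrt (sqrt (H N)
                   + (1 + real_of_ereal (Linf_norm \<rho>)) * real N powr (- \<beta>)))"
  \<comment> \<open>The summand 1 makes the constant strictly positive.\<close>
  proof (rule exI[of _ "sqrt (2 * C2 * I) + 1"], intro exI[of _ \<beta>] conjI allI impI)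
    have I0: "0 \<le> sqrt (2 * C2 * I)" using C2 by (simp add: I_def)
    thus "0 < sqrt (2 * C2 * I) + 1" by linarith
    show "0 < \<beta>" by (rule \<beta>)
    fix N :: nat assume N: "1 \<le> N"
    have "real N powr (- \<beta>) \<le> (1 + real_of_ereal (Linf_norm \<rho>)) * real N powr (- \<beta>)"
      using real_of_ereal_pos[OF Linf_norm_nonneg[of \<rho>]] by (simp add: mult_le_cancel_right1)
    hence "sqrt (\<delta> N) \<le> sqrt (sqrt (H N) + (1 + real_of_ereal (Linf_norm \<rho>)) * real N powr (- \<beta>))"
      by (intro real_sqrt_le_mono) (simp add: \<delta>_def)
    \<comment> \<open>The Lipschitz constant of \<open>v\<close> is already inside
      \<open>C2\<close>; the factor with the gradient norm is at least 1, so inserting it enlarges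
      the bound.\<close>
    moreover have "sqrt (2 * C2 * I) \<le> (sqrt (2 * C2 * I) + 1) * (1 + (real_of_ereal (grad_Winf_norm 1 v))\<^sup>2)"
    proof -
      have "(sqrt (2 * C2 * I) + 1) * 1 \<le> (sqrt (2 * C2 * I) + 1) * (1 + (real_of_ereal (grad_Winf_norm 1 v))\<^sup>2)"
        using I0 by (intro mult_left_mono) auto
      thus ?thesis by (rule order_trans[rotated]) simp
    qed
    ultimately have "sqrt (2 * C2 * I) * sqrt (\<delta> N) \<le> (sqrt (2 * C2 * I) + 1) * (1 + (real_of_ereal (grad_Winf_norm 1 v))\<^sup>2)
       * sqrt (sqrt (H N) + (1 + real_of_ereal (Linf_norm \<rho>)) * real N powr (- \<beta>))"
      using \<delta>0[OF N] I0 by (intro mult_mono) auto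
    thus "Sobolev_norm (-5) [(1, empirical_measure N (\<lambda>i. (Q N i, P N i))), (-1, monokinetic \<rho> v)]
       \<le> ennreal ((sqrt (2 * C2 * I) + 1) * (1 + (real_of_ereal (grad_Winf_norm 1 v))\<^sup>2)
               * sqrt (sqrt (H N) + (1 + real_of_ereal (Linf_norm \<rho>)) * real N powr (- \<beta>)))"
      using Sob5[OF N] unfolding \<mu>_def by (meson ennreal_leI order_trans)
  qed

  have squeeze: "f \<longlonglongrightarrow> 0" if "\<And>N. N \<ge> 1 \<Longrightarrow> f N \<le> ennreal (g N)" "g \<longlonglongrightarrow> 0" for f :: "nat \<Rightarrow> ennreal" and g
  proof (rule tendsto_sandwich[of "\<lambda>_. 0"])
    show "\<forall>\<^sub>F N in sequentially. f N \<le> ennreal (g N)"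
      by (rule eventually_mono[OF eventually_ge_at_top[of 1] that(1)])
    show "(\<lambda>N. ennreal (g N)) \<longlonglongrightarrow> 0" using tendsto_ennrealI[OF that(2)] by simp
  qed auto

  show ?thesis
  proof (intro conjI impI bound allI)
    assume H0: "H \<longlonglongrightarrow> 0"
    have sH: "(\<lambda>N. sqrt (H N)) \<longlonglongrightarrow> 0" using tendsto_real_sqrt[OF H0] by simp
    have "(\<lambda>N. real N powr (- \<beta>)) \<longlonglongrightarrow> 0" using \<beta> by (intro tendsto_neg_powr filterlim_real_sequentially) auto
    from tendsto_add[OF sH this] have \<delta>lim: "\<delta> \<longlonglongrightarrow> 0" by (simp add: \<delta>_def[abs_def])
    show "(\<lambda>N. L2_norm (\<lambda>x. \<omega>N N x - \<omega> x)) \<longlonglongrightarrow> 0"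
      by (rule squeeze[OF _ sH]) (simp add: L2_norm_minus_commute[of "\<omega>N _"] l2 ennreal_leI)
    show "(\<lambda>N. homogeneous_Sobolev_norm (-1) [(1, ac_measure (\<omega>N N)), (-1, ac_measure \<omega>)]) \<longlonglongrightarrow> 0"
    proof (rule squeeze)
      fix N :: nat assume N: "N \<ge> 1"
      have "homogeneous_Sobolev_norm (-1) [(1, ac_measure (\<omega>N N)), (-1, ac_measure \<omega>)] \<le> ennreal (sqrt (16 * pi\<^sup>2 * exp 1 * pos N))"
        unfolding pos_def by (rule homogeneous_Sobolev_norm_difference_le(2)[OF M(2) M(4)[OF N] M(1)])
      also have "\<dots> \<le> ennreal (sqrt (16 * pi\<^sup>2 * exp 1 * H N))"
        using parts(3)[OF N] by (intro ennreal_leI real_sqrt_le_mono mult_left_mono) auto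
      finally show "homogeneous_Sobolev_norm (-1) [(1, ac_measure (\<omega>N N)), (-1, ac_measure \<omega>)] \<le> ennreal (sqrt (16 * pi\<^sup>2 * exp 1 * H N))" .
    next
      show "(\<lambda>N. sqrt (16 * pi\<^sup>2 * exp 1 * H N)) \<longlonglongrightarrow> 0"
        using tendsto_real_sqrt[OF tendsto_mult_right_zero[OF H0, of "16 * pi\<^sup>2 * exp 1"]] by simp
    qed
    show "(\<lambda>N. Sobolev_norm (-5) [(1, empirical_measure N (\<lambda>i. (Q N i, P N i))), (-1, monokinetic \<rho> v)]) \<longlonglongrightarrow> 0"
    proof (rule squeeze[OF Sob5[unfolded \<mu>_def]])
      show "(\<lambda>N. sqrt (2 * C2 * I) * sqrt (\<delta> N)) \<longlonglongrightarrow> 0"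
        using tendsto_mult_right_zero[of "\<lambda>N. sqrt (\<delta> N)"] tendsto_real_sqrt[OF \<delta>lim] by simp
    qed
    fix a :: real assume a: "a < - 1"
    show "(\<lambda>N. Sobolev_norm a [(1, empirical_measure N (Q N)), (-1, ac_measure \<rho>)]) \<longlonglongrightarrow> 0"
    \<comment> \<open>For a fixed frequency the phase is linear with Lipschitz constant |\<xi>|, so
      \<open>osc\<close> gives pointwise convergence of the Fourier transforms.\<close>
    proof (rule Sobolev_norm_difference_tendsto_0[OF pbE \<rho>m(3)])
      show "a < - real DIM(real^2) / 2" using a by simp
      fix \<xi> :: "real^2"
      show "(\<lambda>N. fourier [(1, empirical_measure N (Q N)), (-1, ac_measure \<rho>)] \<xi>) \<longlonglongrightarrow> 0"
      proof (rule Lim_null_comparison)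
        show "(\<lambda>N. 4 * ((norm \<xi> + 1) * C0 * \<delta> N)) \<longlonglongrightarrow> 0"
          using tendsto_mult_right_zero[OF \<delta>lim, of "4 * ((norm \<xi> + 1) * C0)"] by (simp add: mult_ac)
        show "\<forall>\<^sub>F N in sequentially. norm (fourier [(1, empirical_measure N (Q N)), (-1, ac_measure \<rho>)] \<xi>) \<le> 4 * ((norm \<xi> + 1) * C0 * \<delta> N)"
          using eventually_ge_at_top[of 1]
        proof eventually_elim
          case (elim N)
          have "(norm \<xi>)-lipschitz_on UNIV (\<lambda>x. - (x \<bullet> \<xi>))"
          proof (rule lipschitz_onI)
            fix x y :: "real^2"
            show "dist (- (x \<bullet> \<xi>)) (- (y \<bullet> \<xi>)) \<le> norm \<xi> * dist x y"
              using Cauchy_Schwarz_ineq2[of "y - x" \<xi>] by (simp add: dist_norm inner_diff_left norm_minus_commute mult.commute)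
          qed simp
          from osc[OF elim this] show ?case
            by (simp add: fourier_def integral_ac_measure(1)[OF \<rho>m(1,2) cm])
        qed
      qed
    qed
  qed
qed

end
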